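(* Let $A\in\mathscr{R}$ be a fixed set. In the risk model described in the context, suppose that the claim vectors $\{\mathbf{X}^{(i)}, i\in\mathbb{N}\}$ are identically distributed with common distribution $F$ supported on the nonnegative quadrant; that $\{\mathbf{X}^{(i)}, i\in\mathbb{N}\}$, $\{N(t), t\ge 0\}$ and $\{\xi(t), t\ge 0\}$ are mutually independent; that $\{\mathbf{X}^{(i)}, i\in\mathbb{N}\}$ are quasi-asymptotically independent on $A$ ($QAI_A$); that $F\in(\mathcal{C}\cap\mathcal{P_D})_A$; and that there exist $p_1,p_2$ with $0<p_1<J_{F_A}^-\le J_{F_A}^+<p_2<\infty$ such that $$\sum_{i=1}^{\infty}\left(\mathbf{E}\left[e^{-p_1\xi(\tau_i)}\right]\vee\mathbf{E}\left[e^{-p_2\xi(\tau_i)}\right]\right)^{1/\rho}<\infty,$$ where $\rho=1$ if $0<J_{F_A}^+<1$ and $\rho=p_2$ if $J_{F_A}^+\ge1$. Then $$\lim_{x\to\infty}\frac{\mathbf{P}\left[\mathbf{D}(\infty)\in xA\right]}{\int_0^\infty \mathbf{P}\left[\mathbf{X}\,e^{-\xi(s)}\in xA\right]\lambda(ds)}=1 .$$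
   Context: Risk model. Fix $d\in\mathbb{N}$. The claim vectors $\mathbf{X}^{(i)}=(X^{(i)}_1,\dots,X^{(i)}_d)^\top$, $i\in\mathbb{N}$, are identically distributed copies of a random vector $\mathbf{X}$ with distribution $F$ supported on $[0,\infty)^d$; a claim vector may have zero components but is not the zero vector. They are not assumed independent of each other, and the components of each vector may be arbitrarily dependent. Claims arrive at random times $\{\tau_i, i\in\mathbb{N}\}$ forming a renewal counting process $N(t)=\sup\{i\in\mathbb{N}:\tau_i\le t\}$, $t\ge 0$ (with $\sup\emptyset=0$), i.e. $\tau_i$ are the partial sums of i.i.d. nonnegative inter-arrival times (not a.s. zero). Its renewal function $\lambda(t)=\mathbf{E}[N(t)]=\sum_{i\ge1}\mathbf{P}[\tau_i\le t]$ is finite for finite $t$, and $\lambda(ds)=\sum_{i\ge 1}\mathbf{P}[\tau_i\in ds]$ is the renewal measure. $\{\xi(t),t\ge0\}$ is a real-valued càdlàg stochastic process with $\xi(0)=0$. The discounted aggregate claim vector over the infinite horizon is $\mathbf{D}(\infty)=\sum_{i=1}^{\infty}\mathbf{X}^{(i)}e^{-\xi(\tau_i)}$. Sets. A set $B\subset\mathbb{R}^d$ is increasing if $\mathbf{x}+\mathbf{y}\in B$ for all $\mathbf{x}\in B$ and $\mathbf{y}\in[0,\infty)^d$. $\mathscr{R}$ is the family of all $A\subset\mathbb{R}^d$ that are open, increasing, with convex complement $A^c$, and with $\mathbf{0}\notin\overline{A}$. Reduction to one dimension. For a random vector $\mathbf{Z}$ supported on $[0,\infty)^d$ with distribution $V$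 and $A\in\mathscr{R}$, put $Z_A=\sup\{u:\mathbf{Z}\in uA\}$ (with $\sup\emptyset=0$); its distribution $V_A$ satisfies $\overline{V_A}(x)=\mathbf{P}[Z_A>x]=\mathbf{P}[\mathbf{Z}\in xA]$ for $x>0$. Here $\overline{G}=1-G$ denotes the tail of a distribution $G$. In particular $F_A$ is the distribution of $\sup\{u:\mathbf{X}\in uA\}$. Classes and indices. Let $G$ be a distribution on $[0,\infty)$ with $\overline G(x)>0$ for all $x\ge0$. For $y>1$ put $\overline{G}_*(y)=\liminf_{x\to\infty}\overline{G}(yx)/\overline{G}(x)$ and $\overline{G}^*(y)=\limsup_{x\to\infty}\overline{G}(yx)/\overline{G}(x)$. $G\in\mathcal{C}$ (consistently varying) if $\lim_{b\uparrow1}\limsup_{x\to\infty}\overline{G}(bx)/\overline{G}(x)=1$. $G\in\mathcal{P_D}$ (positively decreasing) if $\overline{G}^*(y)<1$ for any (equivalently, some) $y>1$. The upper and lower Matuszewska indices are $J_G^+=-\lim_{y\to\infty}\log\overline{G}_*(y)/\log y$ and $J_G^-=-\lim_{y\to\infty}\log\overline{G}^*(y)/\log y$. $V\in(\mathcal{C}\cap\mathcal{P_D})_A$ means $V_A\in\mathcal{C}\cap\mathcal{P_D}$. Dependence. Nonnegative random variables $\{Z_i,i\ge1\}$ with distributions $V_1,V_2,\dots$ are quasi-asymptotically independent (QAI) if $\lim_{x\to\infty}\mathbf{P}[Z_i>x,\,Z_j>x]/(\overline{V_i}(x)+\overline{V_j}(x))=0$ for all $i\ne j$. Nonnegative random vectors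 $\{\mathbf{Z}^{(i)},i\in\mathbb{N}\}$ are $QAI_A$ if the random variables $Z_A^{(i)}=\sup\{u:\mathbf{Z}^{(i)}\in uA\}$, $i\in\mathbb{N}$, are QAI. *)

theory Defs
  imports "HOL-Probability.Probability"
begin

section \<open>Sets\<close>

definition increasing_set :: "(real ^ 'd) set \<Rightarrow> bool" where
  "increasing_set B \<longleftrightarrow> (\<forall>x\<in>B. \<forall>y. (\<forall>k. 0 \<le> y $ k) \<longrightarrow> x + y \<in> B)"

definition ruin_sets :: "(real ^ 'd) set set" where
  "ruin_sets = {A. open A \<and> increasing_set A \<and> convex (- A) \<and> 0 \<notin> closure A}"

definition dilate :: "real \<Rightarrow> (real ^ 'd) set \<Rightarrow> (real ^ 'd) set" where
  "dilate u A = (\<lambda>a. u *\<^sub>R a) ` A"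

text \<open>An infinite sum of nonnegative vectors may diverge in a component that the set does not
  constrain (for instance the second one for the set of all vectors whose first component
  exceeds 1). Such sums are therefore taken in the extended half-line, and an increasing set is
  read there as its upward closure. On finite vectors nothing changes, see
  \<open>upward_extension_finite\<close> below.\<close>

definition upward_extension :: "(real ^ 'd) set \<Rightarrow> (ennreal ^ 'd) set" where
  "upward_extension B = {z. \<exists>y\<in>B. \<forall>k. ennreal (y $ k) \<le> z $ k}"

lemma upward_extension_finite:
  assumes B: "increasing_set B" and z: "\<And>k. 0 \<le> z $ k"
  shows "(\<chi> k. ennreal (z $ k)) \<in> upward_extension B \<longleftrightarrow> z \<in> B"
proof
  assume "(\<chi> k. ennreal (z $ k)) \<in> upward_extension B"
  then obtain y where y: "y \<in> B" "\<And>k. ennreal (y $ k) \<le> ennreal (z $ k)"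
    by (auto simp: upward_extension_def)
  have "0 \<le> (z - y) $ k" for k
    using y(2)[of k] z[of k] by (simp add: ennreal_le_iff)
  then have "y + (z - y) \<in> B"
    using B y(1) unfolding increasing_set_def by blast
  then show "z \<in> B" by simp
next
  assume "z \<in> B"
  then show "(\<chi> k. ennreal (z $ k)) \<in> upward_extension B"
    unfolding upward_extension_def by auto
qed

definition reduction :: "(real ^ 'd) set \<Rightarrow> real ^ 'd \<Rightarrow> real" where
  "reduction A z = (let U = {u. z \<in> dilate u A} in if U = {} then 0 else Sup U)"

definition reduced_distribution :: "(real ^ 'd) set \<Rightarrow> (real ^ 'd) measure \<Rightarrow> real measure" where
  "reduced_distribution A V = distr V borel (reduction A)"

section \<open>Distribution classes and indices\<close>

definition tail :: "real measure \<Rightarrow> real \<Rightarrow> real" where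
  "tail G x = measure G {x<..}"

definition unbounded_nonneg_distribution :: "real measure \<Rightarrow> bool" where
  "unbounded_nonneg_distribution G \<longleftrightarrow>
     prob_space G \<and> sets G = sets borel \<and> (AE x in G. 0 \<le> x) \<and> (\<forall>x\<ge>0. tail G x > 0)"

definition lower_tail_ratio :: "real measure \<Rightarrow> real \<Rightarrow> ereal" where
  "lower_tail_ratio G y = Liminf at_top (\<lambda>x. ereal (tail G (y * x) / tail G x))"

definition upper_tail_ratio :: "real measure \<Rightarrow> real \<Rightarrow> ereal" where
  "upper_tail_ratio G y = Limsup at_top (\<lambda>x. ereal (tail G (y * x) / tail G x))"

definition consistently_varying :: "real measure \<Rightarrow> bool" where
  "consistently_varying G \<longleftrightarrow>
     unbounded_nonneg_distribution G \<and> (upper_tail_ratio G \<longlongrightarrow> 1) (at_left 1)"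

definition positively_decreasing :: "real measure \<Rightarrow> bool" where
  "positively_decreasing G \<longleftrightarrow>
     unbounded_nonneg_distribution G \<and> (\<forall>y>1. upper_tail_ratio G y < 1)"

definition ereal_log :: "ereal \<Rightarrow> ereal" where
  "ereal_log x = (if x \<le> 0 then -\<infinity> else if x = \<infinity> then \<infinity> else ereal (ln (real_of_ereal x)))"

text \<open>The limits below exist in the extended reals for every unbounded distribution on the
  half-line, since \<open>- log\<close> of the lower (upper) ratio is subadditive (superadditive) and
  nondecreasing as a function of \<open>log y\<close>; the value may be infinite.\<close>

definition upper_Matuszewska :: "real measure \<Rightarrow> ereal" where
  "upper_Matuszewska G = - Lim at_top (\<lambda>y. ereal_log (lower_tail_ratio G y) / ereal (ln y))"

definition lower_Matuszewska :: "real measure \<Rightarrow> ereal" where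
  "lower_Matuszewska G = - Lim at_top (\<lambda>y. ereal_log (upper_tail_ratio G y) / ereal (ln y))"

section \<open>Dependence\<close>

definition QAI :: "'a measure \<Rightarrow> 'i set \<Rightarrow> ('i \<Rightarrow> 'a \<Rightarrow> real) \<Rightarrow> bool" where
  "QAI M I Z \<longleftrightarrow> (\<forall>i\<in>I. \<forall>j\<in>I. i \<noteq> j \<longrightarrow>
     ((\<lambda>x. measure M {\<omega>\<in>space M. Z i \<omega> > x \<and> Z j \<omega> > x} /
            (measure M {\<omega>\<in>space M. Z i \<omega> > x} + measure M {\<omega>\<in>space M. Z j \<omega> > x}))
      \<longlongrightarrow> 0) at_top)"

definition QAI_on :: "(real ^ 'd) set \<Rightarrow> 'a measure \<Rightarrow> 'i set \<Rightarrow> ('i \<Rightarrow> 'a \<Rightarrow> real ^ 'd) \<Rightarrow> bool" where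
  "QAI_on A M I Z \<longleftrightarrow> QAI M I (\<lambda>i \<omega>. reduction A (Z i \<omega>))"

definition generated_events ::
    "'a measure \<Rightarrow> 't set \<Rightarrow> 'b measure \<Rightarrow> ('t \<Rightarrow> 'a \<Rightarrow> 'b) \<Rightarrow> 'a set set" where
  "generated_events M I N Z =
     sigma_sets (space M) {Z t -` B \<inter> space M | t B. t \<in> I \<and> B \<in> sets N}"

section \<open>The risk model\<close>

text \<open>Claims, inter-arrival times and arrival times are numbered from 1; the entries of the
  sequences at index 0 play no role (and arrival time 0 is 0).\<close>

definition arrival :: "(nat \<Rightarrow> 'a \<Rightarrow> real) \<Rightarrow> nat \<Rightarrow> 'a \<Rightarrow> real" where
  "arrival \<theta> i \<omega> = (\<Sum>j\<in>{1..i}. \<theta> j \<omega>)"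

text \<open>The count takes values in the extended naturals because it is infinite on the null event
  where the arrival times stay bounded; there \<open>Sup {} = 0\<close>.\<close>

definition renewal_count :: "(nat \<Rightarrow> 'a \<Rightarrow> real) \<Rightarrow> real \<Rightarrow> 'a \<Rightarrow> enat" where
  "renewal_count \<theta> t \<omega> = Sup {enat i | i. i \<ge> 1 \<and> arrival \<theta> i \<omega> \<le> t}"

definition renewal_measure :: "'a measure \<Rightarrow> (nat \<Rightarrow> 'a \<Rightarrow> real) \<Rightarrow> real measure" where
  "renewal_measure M \<theta> = measure_of UNIV (sets borel)
     (\<lambda>B. \<Sum>i. emeasure M {\<omega>\<in>space M. arrival \<theta> (Suc i) \<omega> \<in> B})"

lemma sets_renewal_measure [simp]: "sets (renewal_measure M \<theta>) = sets borel"
  unfolding renewal_measure_def using sets.sigma_sets_eq[of borel] by simp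

lemma emeasure_renewal_measure:
  assumes [measurable]: "\<And>i. i \<ge> 1 \<Longrightarrow> \<theta> i \<in> borel_measurable M" and B: "B \<in> sets borel"
  shows "emeasure (renewal_measure M \<theta>) B =
    (\<Sum>i. emeasure M {\<omega>\<in>space M. arrival \<theta> (Suc i) \<omega> \<in> B})"
proof -
  have meas [measurable]: "arrival \<theta> i \<in> borel_measurable M" for i
    unfolding arrival_def[abs_def] by (rule borel_measurable_sum) (auto intro: assms(1))
  define \<mu> where "\<mu> B = (\<Sum>i. emeasure M {\<omega>\<in>space M. arrival \<theta> (Suc i) \<omega> \<in> B})" for B
  have eq: "emeasure M {\<omega>\<in>space M. arrival \<theta> i \<omega> \<in> C} = emeasure (distr M borel (arrival \<theta> i)) C"
    if "C \<in> sets borel" for C i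
    using that by (subst emeasure_distr) (auto intro!: arg_cong[where f = "emeasure M"])
  have "countably_additive (sets borel) \<mu>"
  proof (rule countably_additiveI)
    fix C :: "nat \<Rightarrow> real set"
    assume C: "range C \<subseteq> sets borel" "disjoint_family C"
    have "(\<Sum>n. \<mu> (C n)) =
        (\<Sum>n. \<Sum>i. emeasure (distr M borel (arrival \<theta> (Suc i))) (C n))"
      using C(1) by (auto simp: \<mu>_def eq intro!: suminf_cong)
    also have "\<dots> = (\<Sum>i. \<Sum>n. emeasure (distr M borel (arrival \<theta> (Suc i))) (C n))"
      unfolding nn_integral_count_space_nat[symmetric]
      by (rule pair_sigma_finite.Fubini')
         (auto simp: pair_sigma_finite_def pair_measure_countable
           intro: sigma_finite_measure_count_space)
    also have "\<dots> = (\<Sum>i. emeasure (distr M borel (arrival \<theta> (Suc i))) (\<Union>n. C n))"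
      using C by (intro suminf_cong suminf_emeasure) auto
    also have "\<dots> = \<mu> (\<Union>n. C n)"
    proof -
      have "(\<Union>n. C n) \<in> sets borel" using C(1) by blast
      then show ?thesis unfolding \<mu>_def by (simp only: eq)
    qed
    finally show "(\<Sum>n. \<mu> (C n)) = \<mu> (\<Union>n. C n)" .
  qed
  moreover have "positive (sets borel) \<mu>"
    by (simp add: positive_def \<mu>_def)
  moreover have "sigma_algebra (UNIV :: real set) (sets borel)"
    using sets.sigma_algebra_axioms[of "borel :: real measure"] by simp
  ultimately show ?thesis
    using B emeasure_measure_of_sigma[of UNIV "sets borel" \<mu> B]
    by (simp add: renewal_measure_def \<mu>_def[abs_def])
qed

locale risk_model = prob_space M
  for M :: "'a measure"
  and F :: "(real ^ 'd) measure"
  and X :: "nat \<Rightarrow> 'a \<Rightarrow> real ^ 'd"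
  and \<theta> :: "nat \<Rightarrow> 'a \<Rightarrow> real"
  and \<xi> :: "real \<Rightarrow> 'a \<Rightarrow> real" +
  assumes claim_measurable: "\<And>i. i \<ge> 1 \<Longrightarrow> random_variable borel (X i)"
    and claim_distribution: "\<And>i. i \<ge> 1 \<Longrightarrow> distr M borel (X i) = F"
    and claim_support: "AE z in F. (\<forall>k. 0 \<le> z $ k) \<and> z \<noteq> 0"
    and interarrival_indep: "indep_vars (\<lambda>_. borel) \<theta> {1..}"
    and interarrival_identical: "\<And>i. i \<ge> 1 \<Longrightarrow> distr M borel (\<theta> i) = distr M borel (\<theta> 1)"
    and interarrival_nonneg: "\<And>i \<omega>. i \<ge> 1 \<Longrightarrow> \<omega> \<in> space M \<Longrightarrow> 0 \<le> \<theta> i \<omega>"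
    and interarrival_nonzero: "\<not> (AE \<omega> in M. \<theta> 1 \<omega> = 0)"
    and returns_measurable: "\<And>t. t \<ge> 0 \<Longrightarrow> random_variable borel (\<xi> t)"
    and returns_right_continuous:
      "\<And>t \<omega>. t \<ge> 0 \<Longrightarrow> \<omega> \<in> space M \<Longrightarrow> ((\<lambda>s. \<xi> s \<omega>) \<longlongrightarrow> \<xi> t \<omega>) (at_right t)"
    and returns_left_limits:
      "\<And>t \<omega>. t > 0 \<Longrightarrow> \<omega> \<in> space M \<Longrightarrow> \<exists>l. ((\<lambda>s. \<xi> s \<omega>) \<longlongrightarrow> l) (at_left t)"
    and returns_start: "\<And>\<omega>. \<omega> \<in> space M \<Longrightarrow> \<xi> 0 \<omega> = 0"

definition discounted_claims ::
    "(nat \<Rightarrow> 'a \<Rightarrow> real ^ 'd) \<Rightarrow> (nat \<Rightarrow> 'a \<Rightarrow> real) \<Rightarrow> (real \<Rightarrow> 'a \<Rightarrow> real) \<Rightarrow> 'a \<Rightarrow> ennreal ^ 'd" where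
  "discounted_claims X \<theta> \<xi> \<omega> =
     (\<chi> k. \<Sum>i. ennreal (X (Suc i) \<omega> $ k * exp (- \<xi> (arrival \<theta> (Suc i) \<omega>) \<omega>)))"

definition independent_sources ::
    "'a measure \<Rightarrow> (nat \<Rightarrow> 'a \<Rightarrow> real ^ 'd) \<Rightarrow> (nat \<Rightarrow> 'a \<Rightarrow> real) \<Rightarrow> (real \<Rightarrow> 'a \<Rightarrow> real) \<Rightarrow> bool" where
  "independent_sources M X \<theta> \<xi> \<longleftrightarrow> prob_space.indep_sets M
     (\<lambda>k. [generated_events M {1..} borel X,
           generated_events M {0..} (count_space UNIV) (renewal_count \<theta>),
           generated_events M {0..} borel \<xi>] ! k) {..<3}"

text \<open>Meant for exponents \<open>a > 0\<close> only.\<close>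

definition ennreal_powr :: "ennreal \<Rightarrow> real \<Rightarrow> ennreal" where
  "ennreal_powr x a = (if x = \<infinity> then \<infinity> else ennreal (enn2real x powr a))"

definition discount_moment ::
    "'a measure \<Rightarrow> (nat \<Rightarrow> 'a \<Rightarrow> real) \<Rightarrow> (real \<Rightarrow> 'a \<Rightarrow> real) \<Rightarrow> real \<Rightarrow> nat \<Rightarrow> ennreal" where
  "discount_moment M \<theta> \<xi> p i = (\<integral>\<^sup>+ \<omega>. ennreal (exp (- p * \<xi> (arrival \<theta> i \<omega>) \<omega>)) \<partial>M)"

end

theory Submission
  imports Defs
begin

text \<open>
  Convexity of the complement of \<open>A\<close> makes \<open>reduction A\<close> subadditive, monotone and homogeneous on
  the nonnegative quadrant. With \<open>Y\<^sub>i = Z\<^sub>i \<Theta>\<^sub>i\<close>, where \<open>Z\<^sub>i\<close> is the reduced claim and \<open>\<Theta>\<^sub>i\<close> the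
  discount factor at the \<open>i\<close>-th arrival, the event in question therefore lies between
  \<open>sup\<^sub>i Y\<^sub>i > x\<close> and \<open>\<Sum>\<^sub>i Y\<^sub>i > x\<close>, and the integral equals \<open>\<Sum>\<^sub>i P(Y\<^sub>i > x)\<close>. Both bounds are
  asymptotic to this series. For finitely many indices this follows from quasi-asymptotic
  independence and consistent variation. The remaining terms are uniformly negligible compared with
  the tail \<open>T x\<close> of the reduced claim: a Potter bound between the Matuszewska indices controls the
  moment of order \<open>\<rho>\<close> of \<open>min Y\<^sub>i x\<close>, and convexity of the power \<open>\<rho>\<close> (with weights proportional to
  the \<open>1/\<rho>\<close>-th powers of the discount moments) combines the terms without any independence.
\<close>

section \<open>Increasing sets with convex complement\<close>

text \<open>The obstacle is an infinite sum of dependent terms: since \<open>\<rho>\<close> exceeds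
  the upper index, the reduced claim has no finite moment of order \<open>\<rho>\<close>, hence the
  truncation at \<open>x\<close>. Its dyadic layers are summable as soon as a Potter exponent
  \<open>q\<close> lies strictly between the upper index and \<open>\<rho>\<close>, and the
  definition of \<open>\<rho>\<close> leaves room for this in both cases. Two moment orders occur
  because the Potter bound is governed by one exponent for discounts below 1 and by another for
  discounts above 1. The discounts are unbounded and may depend on each other. To pass
  quasi-asymptotic independence and consistent variation from \<open>Z i\<close> to
  \<open>Y i\<close>, they are cut at a level \<open>L\<close>; the part beyond \<open>L\<close> is
  a small multiple of \<open>T x\<close> by dominated convergence. The order of choices matters: the
  cut index \<open>n\<close> comes first, with a remainder bound uniform in the number of terms, and
  only then does \<open>x\<close> grow. All errors are multiples of \<open>T x\<close>; the first
  claim alone shows that the series dominates a fixed multiple of \<open>T x\<close>.\<close>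

lemma mem_dilate_iff:
  "u \<noteq> 0 \<Longrightarrow> z \<in> dilate u A \<longleftrightarrow> (1 / u) *\<^sub>R z \<in> A"
  unfolding dilate_def by (auto simp: image_iff intro!: bexI[of _ "(1 / u) *\<^sub>R z"])

lemma mem_dilate_zero: "z \<in> dilate 0 A \<longleftrightarrow> z = 0 \<and> A \<noteq> {}"
  unfolding dilate_def by auto

lemma ruin_set_mono:
  assumes "A \<in> ruin_sets" "z \<in> A" "\<And>k. z $ k \<le> w $ k"
  shows "w \<in> A"
proof -
  have "increasing_set A" using assms by (simp add: ruin_sets_def)
  moreover have "\<forall>k. 0 \<le> (w - z) $ k" using assms(3) by simp
  ultimately have "z + (w - z) \<in> A" using assms(2) unfolding increasing_set_def by blast
  then show ?thesis by simp
qed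

text \<open>Since 0 is outside the closure, \<open>A\<close> keeps a distance \<open>e\<close> from
  the origin, which limits the factor. Boundedness is what gives the real-valued \<open>Sup\<close>
  in \<open>reduction\<close> its meaning.\<close>

lemma bdd_above_dilations:
  assumes "A \<in> ruin_sets"
  shows "bdd_above {u. z \<in> dilate u A}"
proof -
  have "0 \<notin> closure A" using assms by (simp add: ruin_sets_def)
  then obtain e where e: "e > 0" "\<And>a. a \<in> A \<Longrightarrow> e \<le> norm a"
    unfolding closure_approachable by (auto simp: dist_norm not_less)
  have "u \<le> norm z / e" if u: "z \<in> dilate u A" for u
  proof -
    obtain a where a: "a \<in> A" "z = u *\<^sub>R a" using u unfolding dilate_def by blast
    have "u * e \<le> \<bar>u\<bar> * norm a" using e a by (intro mult_mono) auto
    then show ?thesis using a e(1) by (simp add: field_simps)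
  qed
  then show ?thesis by (intro bdd_aboveI[of _ "norm z / e"]) auto
qed

text \<open>A negative factor would put a vector with nonpositive coordinates into \<open>A\<close>,
  and then also 0, because \<open>A\<close> is increasing.\<close>

lemma dilate_factor_nonneg:
  assumes A: "A \<in> ruin_sets" and z: "\<And>k. 0 \<le> z $ k" and "z \<in> dilate u A"
  shows "0 \<le> u"
proof (rule ccontr)
  assume "\<not> 0 \<le> u"
  then have u: "u < 0" by simp
  then have "(1 / u) *\<^sub>R z \<in> A" using assms(3) by (simp add: mem_dilate_iff)
  moreover have "((1 / u) *\<^sub>R z) $ k \<le> 0 $ k" for k
    using u z[of k] by (simp add: divide_nonneg_neg)
  ultimately have "0 \<in> A" by (rule ruin_set_mono[OF A])
  then show False using A closure_subset by (auto simp: ruin_sets_def)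
qed

lemma dilate_antimono:
  assumes A: "A \<in> ruin_sets" and z: "\<And>k. 0 \<le> z $ k" and "z \<in> dilate u A" "0 < x" "x \<le> u"
  shows "z \<in> dilate x A"
proof -
  have "(1 / u) *\<^sub>R z \<in> A" using assms by (simp add: mem_dilate_iff)
  then have "(1 / x) *\<^sub>R z \<in> A"
    by (rule ruin_set_mono[OF A]) (use assms in \<open>auto intro!: frac_le\<close>)
  then show ?thesis using assms by (simp add: mem_dilate_iff)
qed

text \<open>The strict inequality is matched by openness: membership at factor \<open>x\<close>
  persists at some slightly larger factor, so the supremum lies strictly above \<open>x\<close>. The
  other direction is monotonicity in the factor.\<close>

lemma less_reduction_iff_dilate:
  assumes A: "A \<in> ruin_sets" and z: "\<And>k. 0 \<le> z $ k" and x: "0 < x"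
  shows "x < reduction A z \<longleftrightarrow> z \<in> dilate x A"
proof
  let ?U = "{u. z \<in> dilate u A}"
  assume *: "x < reduction A z"
  have "?U \<noteq> {}"
  proof
    assume "?U = {}"
    then have "reduction A z = 0" unfolding reduction_def Let_def by simp
    with * x show False by simp
  qed
  then have "reduction A z = Sup ?U" unfolding reduction_def Let_def by (simp only: if_False)
  with * obtain u where "z \<in> dilate u A" "x < u"
    using less_cSup_iff[OF \<open>?U \<noteq> {}\<close> bdd_above_dilations[OF A]] by auto
  then show "z \<in> dilate x A" using dilate_antimono[OF A z _ x] by auto
next
  let ?U = "{u. z \<in> dilate u A}"
  assume *: "z \<in> dilate x A"
  then have in_A: "(1 / x) *\<^sub>R z \<in> A" using x by (simp add: mem_dilate_iff)
  have lim: "((\<lambda>u. (1 / u) *\<^sub>R z) \<longlongrightarrow> (1 / x) *\<^sub>R z) (at_right x)"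
    using x by (intro tendsto_intros) auto
  have "open A" using A by (simp add: ruin_sets_def)
  from topological_tendstoD[OF lim this in_A]
  have "\<forall>\<^sub>F u in at_right x. (1 / u) *\<^sub>R z \<in> A \<and> x < u"
    by (intro eventually_conj) (simp_all add: eventually_at_right_less)
  then obtain u where u: "(1 / u) *\<^sub>R z \<in> A" "x < u"
    using eventually_happens'[of "at_right x"] by auto
  then have "u \<in> ?U" using x by (simp add: mem_dilate_iff)
  then have "u \<le> Sup ?U" by (rule cSup_upper[OF _ bdd_above_dilations[OF A]])
  moreover have "reduction A z = Sup ?U"
    using \<open>u \<in> ?U\<close> unfolding reduction_def Let_def by auto
  ultimately show "x < reduction A z" using u by simp
qed

lemma reduction_nonneg:
  assumes A: "A \<in> ruin_sets" and z: "\<And>k. 0 \<le> z $ k"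
  shows "0 \<le> reduction A z"
proof (cases "{u. z \<in> dilate u A} = {}")
  case False
  then obtain u where u: "z \<in> dilate u A" by auto
  then have "u \<le> Sup {u. z \<in> dilate u A}"
    by (intro cSup_upper[OF _ bdd_above_dilations[OF A]]) auto
  with False dilate_factor_nonneg[OF A z u] show ?thesis
    unfolding reduction_def Let_def by auto
qed (simp add: reduction_def Let_def)

lemma reduction_leI:
  assumes A: "A \<in> ruin_sets" and z: "\<And>k. 0 \<le> z $ k" and "0 \<le> c"
    and "\<And>x. c < x \<Longrightarrow> z \<notin> dilate x A"
  shows "reduction A z \<le> c"
proof (rule ccontr)
  assume "\<not> reduction A z \<le> c"
  then obtain x where "c < x" "x < reduction A z" using dense[of c] unfolding not_le by blast
  then show False using less_reduction_iff_dilate[OF A z, of x] assms by auto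
qed

lemma reduction_mono:
  assumes A: "A \<in> ruin_sets" and z: "\<And>k. 0 \<le> z $ k" and zw: "\<And>k. z $ k \<le> w $ k"
  shows "reduction A z \<le> reduction A w"
proof -
  have w: "0 \<le> w $ k" for k using z[of k] zw[of k] by simp
  show ?thesis
  proof (rule reduction_leI[OF A z reduction_nonneg[OF A w]])
    fix x assume x: "reduction A w < x"
    then have x0: "0 < x" using reduction_nonneg[OF A w] by linarith
    show "z \<notin> dilate x A"
    proof
      assume "z \<in> dilate x A"
      then have "(1 / x) *\<^sub>R z \<in> A" using x0 by (simp add: mem_dilate_iff)
      then have "(1 / x) *\<^sub>R w \<in> A"
        by (rule ruin_set_mono[OF A]) (use zw x0 in \<open>auto intro: divide_right_mono\<close>)
      then show False
        using less_reduction_iff_dilate[OF A w x0] x x0 by (simp add: mem_dilate_iff)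
    qed
  qed
qed

text \<open>One inequality suffices: it is applied to \<open>c\<close> and to
  \<open>1 / c\<close>.\<close>

lemma reduction_scaleR:
  assumes A: "A \<in> ruin_sets" and z: "\<And>k. 0 \<le> z $ k" and c: "0 < c"
  shows "reduction A (c *\<^sub>R z) = c * reduction A z"
proof -
  have le: "reduction A (c *\<^sub>R z) \<le> c * reduction A z"
    if c: "0 < c" and z: "\<And>k. 0 \<le> z $ k" for c z
  proof (rule reduction_leI[OF A])
    fix x assume x: "c * reduction A z < x"
    moreover have "0 \<le> c * reduction A z" using c reduction_nonneg[OF A z] by simp
    ultimately have x0: "0 < x" by linarith
    have "z \<notin> dilate (x / c) A"
      using less_reduction_iff_dilate[OF A z, of "x / c"] x x0 c by (auto simp: field_simps)
    then show "c *\<^sub>R z \<notin> dilate x A" using x0 c by (simp add: mem_dilate_iff)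
  qed (use c z reduction_nonneg[OF A z] in auto)
  have "reduction A z = reduction A ((1 / c) *\<^sub>R (c *\<^sub>R z))" using c by simp
  also have "\<dots> \<le> (1 / c) * reduction A (c *\<^sub>R z)" using c z by (intro le) auto
  finally show ?thesis using le[OF c z] c by (simp add: field_simps)
qed

text \<open>This is where the convexity of the complement enters.\<close>

lemma reduction_add_le:
  assumes A: "A \<in> ruin_sets" and z: "\<And>k. 0 \<le> z $ k" and w: "\<And>k. 0 \<le> w $ k"
  shows "reduction A (z + w) \<le> reduction A z + reduction A w"
proof (rule reduction_leI[OF A])
  fix x assume x: "reduction A z + reduction A w < x"
  \<comment> \<open>Half of the slack goes to each summand, so that \<open>a\<close> and
    \<open>b\<close> are positive, lie strictly above the two reductions and add up to
    \<open>x\<close>.\<close>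
  define e where "e = (x - (reduction A z + reduction A w)) / 2"
  have e: "e > 0" using x by (simp add: e_def)
  define a b where "a = reduction A z + e" and "b = reduction A w + e"
  have ab: "a > 0" "b > 0" "a + b = x" "reduction A z < a" "reduction A w < b"
    using e reduction_nonneg[OF A z] reduction_nonneg[OF A w]
    by (auto simp: a_def b_def e_def field_simps)
  have "(1 / a) *\<^sub>R z \<in> - A" "(1 / b) *\<^sub>R w \<in> - A"
    using less_reduction_iff_dilate[OF A z ab(1)] less_reduction_iff_dilate[OF A w ab(2)] ab
    by (auto simp: mem_dilate_iff)
  moreover have "convex (- A)" using A by (simp add: ruin_sets_def)
  \<comment> \<open>These weights combine \<open>z / a\<close> and \<open>w / b\<close> to
    \<open>(z + w) / x\<close>.\<close>
  moreover have "0 \<le> a / x" "0 \<le> b / x" "a / x + b / x = 1"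
    using ab(1,2) unfolding ab(3)[symmetric] by (auto simp: add_divide_distrib[symmetric])
  ultimately have "(a / x) *\<^sub>R (1 / a) *\<^sub>R z + (b / x) *\<^sub>R (1 / b) *\<^sub>R w \<in> - A"
    by (intro convexD) auto
  moreover have "(a / x) *\<^sub>R (1 / a) *\<^sub>R z + (b / x) *\<^sub>R (1 / b) *\<^sub>R w = (1 / x) *\<^sub>R (z + w)"
    using ab by (simp add: scaleR_add_right)
  ultimately show "z + w \<notin> dilate x A" using ab by (simp add: mem_dilate_iff)
qed (use z w reduction_nonneg[OF A] in auto)

lemma reduction_zero: "A \<in> ruin_sets \<Longrightarrow> reduction A 0 = 0"
  using reduction_scaleR[of A 0 2] by simp

lemma reduction_sum_le:
  assumes A: "A \<in> ruin_sets" and z: "\<And>i k. i \<in> I \<Longrightarrow> 0 \<le> z i $ k"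
  shows "reduction A (\<Sum>i\<in>I. z i) \<le> (\<Sum>i\<in>I. reduction A (z i))"
  using z
proof (induction I rule: infinite_finite_induct)
  case (insert i I)
  have "reduction A (z i + (\<Sum>i\<in>I. z i)) \<le> reduction A (z i) + reduction A (\<Sum>i\<in>I. z i)"
    using insert.prems by (intro reduction_add_le[OF A]) (auto intro: sum_nonneg)
  also have "\<dots> \<le> reduction A (z i) + (\<Sum>i\<in>I. reduction A (z i))"
    using insert by (intro add_left_mono) auto
  finally show ?case using insert by simp
qed (auto simp: reduction_zero[OF A])

lemma open_dilate: "open A \<Longrightarrow> u \<noteq> 0 \<Longrightarrow> open (dilate u A)"
  unfolding dilate_def by (rule open_scaling)

text \<open>Off the quadrant the supremum may be negative, and it is 0 by convention where no factor
  exists, so a superlevel set has two sources. \<open>P\<close> and \<open>Q\<close> are open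
  because factor 0, whose dilation contains at most the origin, is left out; the origin is treated
  separately.\<close>

lemma borel_measurable_reduction:
  assumes A: "A \<in> ruin_sets"
  shows "reduction A \<in> borel_measurable borel"
proof (rule borel_measurable_iff_greater[THEN iffD2], rule allI)
  fix x :: real
  have opA: "open A" using A by (simp add: ruin_sets_def)
  define P where "P = (\<Union>u\<in>{x<..} - {0}. dilate u A)"
  define Q where "Q = (\<Union>u\<in>- {0}. dilate u A)"
  have "open P" "open Q" unfolding P_def Q_def by (auto intro!: open_UN open_dilate[OF opA])
  have empty: "z \<in> dilate u A \<longleftrightarrow> False" if "A = {}" for z u using that by (simp add: dilate_def)
  have zero: "0 \<notin> A" using A closure_subset by (auto simp: ruin_sets_def)
  have red0: "reduction A 0 = 0" by (rule reduction_zero[OF A])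
  have eq: "x < reduction A z \<longleftrightarrow> z \<in> P \<or> (x < 0 \<and> z \<notin> Q)" for z
  proof (cases "z = 0")
    case True
    have "0 \<notin> P" "0 \<notin> Q" unfolding P_def Q_def using zero by (auto simp: mem_dilate_iff)
    then show ?thesis using True red0 by simp
  next
    case False
    show ?thesis
    proof (cases "z \<in> Q")
      case True
      then have ne: "{u. z \<in> dilate u A} \<noteq> {}" by (auto simp: Q_def)
      have "x < reduction A z \<longleftrightarrow> (\<exists>u\<in>{u. z \<in> dilate u A}. x < u)"
        using less_cSup_iff[OF ne bdd_above_dilations[OF A]] ne
        unfolding reduction_def Let_def by (simp only: if_False)
      also have "\<dots> \<longleftrightarrow> z \<in> P" using False mem_dilate_zero[of z A] by (force simp: P_def)
      finally show ?thesis using True by simp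
    next
      case nQ: False
      have "{u. z \<in> dilate u A} = {}" using nQ mem_dilate_zero[of z A] \<open>z \<noteq> 0\<close> by (auto simp: Q_def)
      then have "reduction A z = 0" unfolding reduction_def Let_def by simp
      moreover have "z \<notin> P" using nQ by (auto simp: P_def Q_def)
      ultimately show ?thesis using nQ by simp
    qed
  qed
  have "{z \<in> space borel. x < reduction A z} = P \<union> (if x < 0 then - Q else {})"
    using eq by auto
  also have "\<dots> \<in> sets borel"
    using \<open>open P\<close> \<open>open Q\<close> by auto
  finally show "{z \<in> space borel. x < reduction A z} \<in> sets borel" .
qed

section \<open>Matuszewska indices and Potter bounds\<close>

text \<open>The least exponent that reaches \<open>y\<close> overshoots by at most one factor
  \<open>s\<close>.\<close>

lemma ex_power_ge:
  assumes "1 < (s::real)" "1 \<le> y"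
  obtains n where "y \<le> s ^ n" "s ^ n \<le> s * y"
proof -
  define n where "n = (LEAST n. y \<le> s ^ n)"
  have "\<exists>n. y \<le> s ^ n" using real_arch_pow[OF assms(1), of y] by (auto intro: less_imp_le)
  then have n: "y \<le> s ^ n" unfolding n_def by (rule LeastI_ex)
  have "s ^ n \<le> s * y"
  proof (cases n)
    case 0
    then show ?thesis using assms mult_mono[of 1 s 1 y] by simp
  next
    case (Suc m)
    then have "\<not> y \<le> s ^ m" using not_less_Least[of m "\<lambda>n. y \<le> s ^ n"] by (simp add: n_def)
    then show ?thesis using Suc assms by simp
  qed
  with n that show ?thesis by blast
qed

text \<open>Iteration of \<open>step\<close> reaches the points \<open>s ^ n * x\<close>. Rounding
  \<open>y\<close> up to a power of \<open>s\<close> costs at most one more factor \<open>s\<close>,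
  hence \<open>s * y\<close> in the bound.\<close>

lemma power_decay_lower:
  fixes T :: "real \<Rightarrow> real"
  assumes "antimono T" "\<And>x. 0 \<le> T x" and s: "1 < s" and p: "0 \<le> p" and x0: "0 < x0"
    and step: "\<And>x. x0 \<le> x \<Longrightarrow> s powr - p * T x \<le> T (s * x)"
    and x: "x0 \<le> x" and y: "1 \<le> y"
  shows "(s * y) powr - p * T x \<le> T (y * x)"
proof -
  have it: "(s ^ n) powr - p * T x \<le> T (s ^ n * x)" for n
  proof (induction n)
    case (Suc n)
    have "1 * x \<le> s ^ n * x" using s x x0 by (intro mult_right_mono) auto
    then have "s powr - p * T (s ^ n * x) \<le> T (s * (s ^ n * x))" using x by (intro step) auto
    moreover have "s powr - p * ((s ^ n) powr - p * T x) \<le> s powr - p * T (s ^ n * x)"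
      using Suc by (intro mult_left_mono) auto
    ultimately have "s powr - p * ((s ^ n) powr - p * T x) \<le> T (s * (s ^ n * x))" by linarith
    then show ?case using s by (simp add: powr_mult mult.assoc)
  qed (use assms in auto)
  obtain n where n: "y \<le> s ^ n" "s ^ n \<le> s * y" using ex_power_ge[OF s y] by blast
  have "(s * y) powr - p * T x \<le> (s ^ n) powr - p * T x"
    using n s p assms(2) by (intro mult_right_mono powr_mono2') auto
  also have "\<dots> \<le> T (s ^ n * x)" by (rule it)
  also have "\<dots> \<le> T (y * x)"
    using n x x0 by (intro antimonoD[OF assms(1)] mult_right_mono) auto
  finally show ?thesis .
qed

text \<open>Here \<open>y / s\<close> is rounded up, so that the power of \<open>s\<close> stays
  below \<open>y\<close>. For \<open>y \<le> s\<close> the claimed factor is at least 1 and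
  monotonicity suffices.\<close>

lemma power_decay_upper:
  fixes T :: "real \<Rightarrow> real"
  assumes "antimono T" "\<And>x. 0 \<le> T x" and s: "1 < s" and p: "0 \<le> p" and x0: "0 < x0"
    and step: "\<And>x. x0 \<le> x \<Longrightarrow> T (s * x) \<le> s powr - p * T x"
    and x: "x0 \<le> x" and y: "1 \<le> y"
  shows "T (y * x) \<le> (y / s) powr - p * T x"
proof -
  have it: "T (s ^ n * x) \<le> (s ^ n) powr - p * T x" for n
  proof (induction n)
    case (Suc n)
    have "1 * x \<le> s ^ n * x" using s x x0 by (intro mult_right_mono) auto
    then have "T (s * (s ^ n * x)) \<le> s powr - p * T (s ^ n * x)" using x by (intro step) auto
    moreover have "s powr - p * T (s ^ n * x) \<le> s powr - p * ((s ^ n) powr - p * T x)"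
      using Suc by (intro mult_left_mono) auto
    ultimately have "T (s * (s ^ n * x)) \<le> s powr - p * ((s ^ n) powr - p * T x)" by linarith
    then show ?case using s by (simp add: powr_mult mult.assoc)
  qed (use assms in auto)
  show ?thesis
  proof (cases "y \<le> s")
    case True
    have "T (y * x) \<le> T (1 * x)"
      using y x x0 by (intro antimonoD[OF assms(1)] mult_right_mono) auto
    also have "\<dots> = 1 powr - p * T x" by simp
    also have "\<dots> \<le> (y / s) powr - p * T x"
      using True y s p assms(2) by (intro mult_right_mono powr_mono2') auto
    finally show ?thesis .
  next
    case False
    then obtain n where n: "y / s \<le> s ^ n" "s ^ n \<le> s * (y / s)"
      using ex_power_ge[OF s, of "y / s"] s by auto
    have "T (y * x) \<le> T (s ^ n * x)"
      using n s x x0 by (intro antimonoD[OF assms(1)] mult_right_mono) auto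
    also have "\<dots> \<le> (s ^ n) powr - p * T x" by (rule it)
    also have "\<dots> \<le> (y / s) powr - p * T x"
      using n s y p assms(2) by (intro mult_right_mono powr_mono2') auto
    finally show ?thesis .
  qed
qed

text \<open>Dictionary between the quotient that defines an index and a power bound on a tail ratio;
  the conventions of \<open>ereal_log\<close> make it valid for zero and infinite ratios as
  well.\<close>

lemma less_ereal_log_divide_iff:
  assumes "1 < y"
  shows "ereal c < ereal_log r / ereal (ln y) \<longleftrightarrow> ereal (y powr c) < r"
proof (cases r)
  case (real r')
  have "c < ln r' / ln y \<longleftrightarrow> y powr c < r'" if "r' > 0"
  proof -
    have "c < ln r' / ln y \<longleftrightarrow> ln (y powr c) < ln r'"
      using assms by (simp add: pos_less_divide_eq ln_powr)
    then show ?thesis using that assms by (subst (asm) ln_less_cancel_iff) auto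
  qed
  moreover have "\<not> y powr c < r'" if "r' \<le> 0" using that by (smt (verit) powr_ge_zero)
  ultimately show ?thesis using real assms by (auto simp: ereal_log_def)
qed (use assms in \<open>auto simp: ereal_log_def\<close>)

lemma ereal_log_divide_less_iff:
  assumes "1 < y"
  shows "ereal_log r / ereal (ln y) < ereal c \<longleftrightarrow> r < ereal (y powr c)"
proof (cases r)
  case (real r')
  have "ln r' / ln y < c \<longleftrightarrow> r' < y powr c" if "r' > 0"
  proof -
    have "ln r' / ln y < c \<longleftrightarrow> ln r' < ln (y powr c)"
      using assms by (simp add: pos_divide_less_eq ln_powr)
    then show ?thesis using that assms by (subst (asm) ln_less_cancel_iff) auto
  qed
  moreover have "r' < y powr c" if "r' \<le> 0" using that assms by (smt (verit) powr_gt_zero)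
  ultimately show ?thesis using real assms by (auto simp: ereal_log_def)
qed (use assms in \<open>auto simp: ereal_log_def\<close>)

section \<open>Tail ratios and existence of the index limits\<close>

lemma tail_antimono: "prob_space G \<Longrightarrow> sets G = sets borel \<Longrightarrow> antimono (tail G)"
  unfolding tail_def
  by (intro antimonoI finite_measure.finite_measure_mono prob_space.finite_measure) auto

lemma tail_pos: "unbounded_nonneg_distribution G \<Longrightarrow> 0 < tail G x"
  using tail_antimono[of G] antimonoD[of "tail G" x "max 0 x"]
  unfolding unbounded_nonneg_distribution_def by (meson less_le_trans max.cobounded1 max.cobounded2)

lemma less_lower_tail_ratioD:
  assumes G: "unbounded_nonneg_distribution G" and "ereal c < lower_tail_ratio G y"
  obtains x0 where "0 < x0" "\<And>x. x0 \<le> x \<Longrightarrow> c * tail G x \<le> tail G (y * x)"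
proof -
  have "\<forall>\<^sub>F x in at_top. ereal c < ereal (tail G (y * x) / tail G x)"
    using assms(2) unfolding lower_tail_ratio_def by (rule less_LiminfD)
  then obtain x0 where "\<And>x. x0 \<le> x \<Longrightarrow> c < tail G (y * x) / tail G x"
    by (auto simp: eventually_at_top_linorder)
  then show ?thesis using that[of "max 1 x0"] tail_pos[OF G] by (auto simp: field_simps less_imp_le)
qed

lemma upper_tail_ratio_lessD:
  assumes G: "unbounded_nonneg_distribution G" and "upper_tail_ratio G y < ereal c"
  obtains x0 where "0 < x0" "\<And>x. x0 \<le> x \<Longrightarrow> tail G (y * x) \<le> c * tail G x"
proof -
  have "\<forall>\<^sub>F x in at_top. ereal (tail G (y * x) / tail G x) < ereal c"
    using assms(2) unfolding upper_tail_ratio_def by (rule Limsup_lessD)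
  then obtain x0 where "\<And>x. x0 \<le> x \<Longrightarrow> tail G (y * x) / tail G x < c"
    by (auto simp: eventually_at_top_linorder)
  then show ?thesis using that[of "max 1 x0"] tail_pos[OF G] by (auto simp: field_simps less_imp_le)
qed

lemma lower_tail_ratio_le_1:
  assumes G: "unbounded_nonneg_distribution G" and y: "1 \<le> y"
  shows "lower_tail_ratio G y \<le> 1"
proof (rule ccontr)
  assume "\<not> lower_tail_ratio G y \<le> 1"
  then obtain c where c: "1 < ereal c" "ereal c < lower_tail_ratio G y"
    using ereal_dense2[of 1 "lower_tail_ratio G y"] unfolding not_le by blast
  obtain x0 where x0: "0 < x0" "\<And>x. x0 \<le> x \<Longrightarrow> c * tail G x \<le> tail G (y * x)"
    using less_lower_tail_ratioD[OF G c(2)] by blast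
  have "tail G (y * x0) \<le> tail G (1 * x0)"
    using G x0(1) y unfolding unbounded_nonneg_distribution_def
    by (intro antimonoD[OF tail_antimono] mult_right_mono) auto
  then have "c * tail G x0 \<le> 1 * tail G x0" using x0(2)[of x0] by simp
  then show False using tail_pos[OF G, of x0] c(1) by simp
qed

lemma upper_tail_ratio_le_1:
  assumes G: "unbounded_nonneg_distribution G" and y: "1 \<le> y"
  shows "upper_tail_ratio G y \<le> 1"
  unfolding upper_tail_ratio_def
proof (rule Limsup_bounded)
  show "\<forall>\<^sub>F x in at_top. ereal (tail G (y * x) / tail G x) \<le> 1"
    using eventually_gt_at_top[of 0]
  proof eventually_elim
    case (elim x)
    have "tail G (y * x) \<le> tail G (1 * x)"
      using G elim y unfolding unbounded_nonneg_distribution_def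
      by (intro antimonoD[OF tail_antimono] mult_right_mono) auto
    then show ?case using tail_pos[OF G, of x] by simp
  qed
qed

lemma eventually_powr_gt:
  assumes "0 < (d::real)"
  shows "\<forall>\<^sub>F y in at_top. K < y powr d"
  using eventually_gt_at_top[of "\<bar>K\<bar> powr (1 / d)"]
proof eventually_elim
  case (elim y)
  then have "(\<bar>K\<bar> powr (1 / d)) powr d < y powr d" using assms by (intro powr_less_mono2) auto
  moreover have "(\<bar>K\<bar> powr (1 / d)) powr d = \<bar>K\<bar>" using assms by (simp add: powr_powr)
  ultimately show ?case by simp
qed

text \<open>A power bound at one scale \<open>s\<close> propagates to all scales, so the superior limit
  of the scaled logarithm cannot exceed its inferior limit. This replaces Fekete's lemma.\<close>

lemma upper_Matuszewska_tendsto: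
  assumes G: "unbounded_nonneg_distribution G"
  shows "((\<lambda>y. ereal_log (lower_tail_ratio G y) / ereal (ln y)) \<longlongrightarrow> - upper_Matuszewska G) at_top"
proof -
  let ?f = "\<lambda>y. ereal_log (lower_tail_ratio G y) / ereal (ln y)"
  note pr = G[unfolded unbounded_nonneg_distribution_def]
  have "Limsup at_top ?f \<le> Liminf at_top ?f"
  proof (rule ccontr)
    assume "\<not> Limsup at_top ?f \<le> Liminf at_top ?f"
    then obtain c where c: "Liminf at_top ?f < ereal c" "ereal c < Limsup at_top ?f"
      unfolding not_le using ereal_dense2 by blast
    \<comment> \<open>The gap between \<open>c'\<close> and \<open>c\<close> absorbs the constant
      \<open>s powr c\<close> lost when the bound is propagated from scale \<open>s\<close> to all
      scales.\<close>
    obtain c' where c': "Liminf at_top ?f < ereal c'" "ereal c' < ereal c"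
      using ereal_dense2[OF c(1)] by blast
    have "\<not> (\<forall>\<^sub>F y in at_top. ?f y \<le> ereal c)"
      using c(2) Limsup_bounded[of ?f "ereal c" at_top] unfolding not_le[symmetric] by blast
    then have "\<exists>s>1. ereal c < ?f s"
      using eventually_mono[OF eventually_gt_at_top[of 1], of "\<lambda>y. ?f y \<le> ereal c"]
      unfolding not_le[symmetric] by blast
    then obtain s where s: "1 < s" "ereal (s powr c) < lower_tail_ratio G s"
      using less_ereal_log_divide_iff by blast
    \<comment> \<open>Tail ratios at scales above 1 are at most 1, so the exponent is negative, as
      \<open>power_decay_lower\<close> requires.\<close>
    have "ereal (s powr c) < 1"
      using s lower_tail_ratio_le_1[OF G, of s] by (meson less_imp_le less_le_trans)
    then have "s powr c < s powr 0" using s by simp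
    then have c0: "c < 0" using s by (simp only: powr_less_cancel_iff)
    obtain x0 where x0: "0 < x0" "\<And>x. x0 \<le> x \<Longrightarrow> s powr c * tail G x \<le> tail G (s * x)"
      using less_lower_tail_ratioD[OF G s(2)] by blast
    have pot: "(s * y) powr c * tail G x \<le> tail G (y * x)" if "1 \<le> y" "x0 \<le> x" for x y
      using power_decay_lower[of "tail G" s "- c" x0 x y] tail_antimono pr
        tail_pos[OF G, THEN less_imp_le] s c0 x0 that by auto
    have ev: "\<forall>\<^sub>F y in at_top. s powr - c < y powr (c - c')"
      using c' by (intro eventually_powr_gt) simp
    have "\<forall>\<^sub>F y in at_top. ereal c' \<le> ?f y"
      using eventually_gt_at_top[of 1] ev
    proof eventually_elim
      case (elim y)
      have "(s * y) powr c \<le> lower_tail_ratio G y"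
        unfolding lower_tail_ratio_def
        by (rule Liminf_bounded, use eventually_ge_at_top[of x0] in eventually_elim)
          (use elim pot tail_pos[OF G] in \<open>simp add: pos_le_divide_eq pos_divide_le_eq\<close>)
      moreover have "y powr c' < (s * y) powr c"
        using elim s by (simp add: powr_diff powr_minus powr_mult field_simps)
      ultimately have "ereal (y powr c') < lower_tail_ratio G y"
        by (meson ereal_less_eq(3) ereal_less(2) less_ereal.simps(1) less_le_trans)
      then show ?case using elim less_ereal_log_divide_iff[of y c'] by (simp add: less_imp_le)
    qed
    then have "ereal c' \<le> Liminf at_top ?f" by (rule Liminf_bounded)
    with c'(1) show False by simp
  qed
  then have "Liminf at_top ?f = Limsup at_top ?f"
    by (intro antisym Liminf_le_Limsup) auto
  then have "(?f \<longlongrightarrow> Limsup at_top ?f) at_top"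
    by (intro Liminf_eq_Limsup) auto
  then show ?thesis by (simp add: upper_Matuszewska_def tendsto_Lim)
qed

text \<open>\<open>Lim\<close> is meaningful only once convergence is known. Dually to the lower
  ratio, an upper bound with exponent \<open>c\<close> at a single scale forces the limit superior
  down to any \<open>c'\<close> above \<open>c\<close>.\<close>

lemma lower_Matuszewska_tendsto:
  assumes G: "unbounded_nonneg_distribution G"
  shows "((\<lambda>y. ereal_log (upper_tail_ratio G y) / ereal (ln y)) \<longlongrightarrow> - lower_Matuszewska G) at_top"
proof -
  let ?f = "\<lambda>y. ereal_log (upper_tail_ratio G y) / ereal (ln y)"
  note pr = G[unfolded unbounded_nonneg_distribution_def]
  have "Limsup at_top ?f \<le> Liminf at_top ?f"
  proof (rule ccontr)
    assume "\<not> Limsup at_top ?f \<le> Liminf at_top ?f"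
    then obtain c where c: "Liminf at_top ?f < ereal c" "ereal c < Limsup at_top ?f"
      unfolding not_le using ereal_dense2 by blast
    obtain c' where c': "ereal c < ereal c'" "ereal c' < Limsup at_top ?f"
      using ereal_dense2[OF c(2)] by blast
    have "\<not> (\<forall>\<^sub>F y in at_top. ereal c \<le> ?f y)"
      using c(1) Liminf_bounded[of "ereal c" ?f at_top] unfolding not_le[symmetric] by blast
    then have "\<exists>s>1. ?f s < ereal c"
      using eventually_mono[OF eventually_gt_at_top[of 1], of "\<lambda>y. ereal c \<le> ?f y"]
      unfolding not_le[symmetric] by blast
    then obtain s where s: "1 < s" "upper_tail_ratio G s < ereal (s powr c)"
      using ereal_log_divide_less_iff by blast
    have "\<forall>\<^sub>F y in at_top. ?f y \<le> ereal 0"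
      using eventually_gt_at_top[of 1]
    proof eventually_elim
      case (elim y)
      then have "\<not> ereal (y powr 0) < upper_tail_ratio G y"
        using upper_tail_ratio_le_1[OF G, of y] by (simp add: not_less one_ereal_def)
      then have "\<not> ereal 0 < ?f y" using less_ereal_log_divide_iff[of y 0] elim by blast
      then show ?case by (simp only: not_less)
    qed
    then have "Limsup at_top ?f \<le> ereal 0" by (rule Limsup_bounded)
    then have "ereal c < ereal 0" using c(2) by (rule less_le_trans[rotated])
    then have c0: "c < 0" by simp
    obtain x0 where x0: "0 < x0" "\<And>x. x0 \<le> x \<Longrightarrow> tail G (s * x) \<le> s powr c * tail G x"
      using upper_tail_ratio_lessD[OF G s(2)] by blast
    have pot: "tail G (y * x) \<le> (y / s) powr c * tail G x" if "1 \<le> y" "x0 \<le> x" for x y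
      using power_decay_upper[of "tail G" s "- c" x0 x y] tail_antimono pr
        tail_pos[OF G, THEN less_imp_le] s c0 x0 that by auto
    have ev: "\<forall>\<^sub>F y in at_top. s powr - c < y powr (c' - c)"
      using c' by (intro eventually_powr_gt) simp
    have "\<forall>\<^sub>F y in at_top. ?f y \<le> ereal c'"
      using eventually_gt_at_top[of 1] ev
    proof eventually_elim
      case (elim y)
      have "upper_tail_ratio G y \<le> (y / s) powr c"
        unfolding upper_tail_ratio_def
        by (rule Limsup_bounded, use eventually_ge_at_top[of x0] in eventually_elim)
          (use elim pot tail_pos[OF G] in \<open>simp add: pos_le_divide_eq pos_divide_le_eq\<close>)
      moreover have "(y / s) powr c < y powr c'"
        using elim s by (simp add: powr_diff powr_minus powr_divide field_simps)
      ultimately have "upper_tail_ratio G y < ereal (y powr c')"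
        by (meson less_ereal.simps(1) le_less_trans)
      then show ?case using elim ereal_log_divide_less_iff[of y _ c'] by (simp add: less_imp_le)
    qed
    then have "Limsup at_top ?f \<le> ereal c'" by (rule Limsup_bounded)
    with c'(2) show False by simp
  qed
  then have "Liminf at_top ?f = Limsup at_top ?f"
    by (intro antisym Liminf_le_Limsup) auto
  then have "(?f \<longlongrightarrow> Limsup at_top ?f) at_top"
    by (intro Liminf_eq_Limsup) auto
  then show ?thesis by (simp add: lower_Matuszewska_def tendsto_Lim)
qed

text \<open>Convergence supplies one scale \<open>s\<close> at which the lower ratio exceeds
  \<open>s powr - p\<close>; iteration from that scale gives the bound with constant
  \<open>s powr p\<close>.\<close>

lemma upper_Matuszewska_lessD:
  assumes G: "unbounded_nonneg_distribution G" and "upper_Matuszewska G < ereal p" "0 \<le> p"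
  obtains C x0 where "0 < C" "0 < x0"
    "\<And>x y. x0 \<le> x \<Longrightarrow> 1 \<le> y \<Longrightarrow> tail G x \<le> C * y powr p * tail G (y * x)"
proof -
  note pr = G[unfolded unbounded_nonneg_distribution_def]
  have "ereal (- p) < - upper_Matuszewska G"
    using assms(2) by (simp add: ereal_uminus_less_reorder flip: uminus_ereal.simps)
  from order_tendstoD(1)[OF upper_Matuszewska_tendsto[OF G] this]
  have "\<forall>\<^sub>F s in at_top. 1 < s \<and>
      ereal (- p) < ereal_log (lower_tail_ratio G s) / ereal (ln s)"
    by (intro eventually_conj eventually_gt_at_top)
  then obtain s where s: "1 < s" "ereal (- p) < ereal_log (lower_tail_ratio G s) / ereal (ln s)"
    using eventually_happens'[OF trivial_limit_at_top_linorder] by fast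
  then have s2: "ereal (s powr - p) < lower_tail_ratio G s"
    using less_ereal_log_divide_iff[OF s(1)] by blast
  obtain x0 where x0: "0 < x0" "\<And>x. x0 \<le> x \<Longrightarrow> s powr - p * tail G x \<le> tail G (s * x)"
    using less_lower_tail_ratioD[OF G s2] by blast
  have "tail G x \<le> s powr p * y powr p * tail G (y * x)" if "x0 \<le> x" "1 \<le> y" for x y
  proof -
    have "(s * y) powr - p * tail G x \<le> tail G (y * x)"
      using power_decay_lower[of "tail G" s p x0 x y] tail_antimono pr
        tail_pos[OF G, THEN less_imp_le] s x0 that assms by auto
    then show ?thesis using s that by (simp add: powr_minus powr_mult field_simps)
  qed
  then show ?thesis using that[of "s powr p" x0] x0 s by auto
qed

lemma less_lower_MatuszewskaD:
  assumes G: "unbounded_nonneg_distribution G" and "ereal p < lower_Matuszewska G" "0 \<le> p"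
  obtains C x0 where "0 < C" "0 < x0"
    "\<And>x y. x0 \<le> x \<Longrightarrow> 1 \<le> y \<Longrightarrow> tail G (y * x) \<le> C * y powr - p * tail G x"
proof -
  note pr = G[unfolded unbounded_nonneg_distribution_def]
  have "- lower_Matuszewska G < ereal (- p)"
    using assms(2) by (simp add: ereal_less_uminus_reorder flip: uminus_ereal.simps)
  from order_tendstoD(2)[OF lower_Matuszewska_tendsto[OF G] this]
  have "\<forall>\<^sub>F s in at_top. 1 < s \<and>
      ereal_log (upper_tail_ratio G s) / ereal (ln s) < ereal (- p)"
    by (intro eventually_conj eventually_gt_at_top)
  then obtain s where s: "1 < s" "ereal_log (upper_tail_ratio G s) / ereal (ln s) < ereal (- p)"
    using eventually_happens'[OF trivial_limit_at_top_linorder] by fast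
  then have s2: "upper_tail_ratio G s < ereal (s powr - p)"
    using ereal_log_divide_less_iff[OF s(1)] by blast
  obtain x0 where x0: "0 < x0" "\<And>x. x0 \<le> x \<Longrightarrow> tail G (s * x) \<le> s powr - p * tail G x"
    using upper_tail_ratio_lessD[OF G s2] by blast
  have "tail G (y * x) \<le> s powr p * y powr - p * tail G x" if "x0 \<le> x" "1 \<le> y" for x y
  proof -
    have "tail G (y * x) \<le> (y / s) powr - p * tail G x"
      using power_decay_upper[of "tail G" s p x0 x y] tail_antimono pr
        tail_pos[OF G, THEN less_imp_le] s x0 that assms by auto
    then show ?thesis using s that by (simp add: powr_minus powr_divide field_simps)
  qed
  then show ?thesis using that[of "s powr p" x0] x0 s by auto
qed

text \<open>For \<open>t \<le> 1\<close> the tail is taken beyond \<open>x\<close> and decays with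
  exponent \<open>p\<close>; for \<open>t > 1\<close> it is taken before \<open>x\<close> and grows
  by at most a multiple of \<open>t powr q\<close>. The bound must cover every \<open>t\<close>,
  also when \<open>x / t\<close> leaves the range of the asymptotic estimates.\<close>

lemma tail_Potter_bound:
  assumes G: "unbounded_nonneg_distribution G"
    and p: "0 < p" "ereal p < lower_Matuszewska G"
    and q: "p < q" "upper_Matuszewska G < ereal q"
  obtains C D where "0 < C" "0 < D"
    "\<And>x t. D \<le> x \<Longrightarrow> 0 < t \<Longrightarrow> tail G (x / t) \<le> C * tail G x * max (t powr p) (t powr q)"
proof -
  note pr = G[unfolded unbounded_nonneg_distribution_def]
  note T0 = tail_pos[OF G]
  obtain C1 x1 where 1: "0 < C1" "0 < x1"
    "\<And>x y. x1 \<le> x \<Longrightarrow> 1 \<le> y \<Longrightarrow> tail G x \<le> C1 * y powr q * tail G (y * x)"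
    using upper_Matuszewska_lessD[OF G q(2)] p q by auto
  obtain C2 x2 where 2: "0 < C2" "0 < x2"
    "\<And>x y. x2 \<le> x \<Longrightarrow> 1 \<le> y \<Longrightarrow> tail G (y * x) \<le> C2 * y powr - p * tail G x"
    using less_lower_MatuszewskaD[OF G p(2)] p by auto
  define D where "D = max x1 x2"
  \<comment> \<open>\<open>C1 / tail G D\<close> serves the case \<open>x / t < D\<close>, where the
    tail on the left is only bounded by 1.\<close>
  define C where "C = max C2 (C1 / tail G D)"
  have D: "D > 0" using 1 by (simp add: D_def)
  have tail1: "tail G x \<le> 1" for x
    unfolding tail_def using pr by (simp add: prob_space.prob_le_1)
  have C: "C2 \<le> C" "C1 \<le> C" "C1 / tail G D \<le> C"
  proof -
    have "C1 \<le> C1 / tail G D" using tail1[of D] T0[of D] 1(1) by (simp add: field_simps)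
    then show "C2 \<le> C" "C1 \<le> C" "C1 / tail G D \<le> C" by (auto simp: C_def)
  qed
  have "tail G (x / t) \<le> C * tail G x * max (t powr p) (t powr q)" if x: "D \<le> x" and t: "0 < t" for x t
  proof -
    consider "t \<le> 1" | "1 < t" "D \<le> x / t" | "1 < t" "x / t < D" by linarith
    then show ?thesis
    proof cases
      assume "t \<le> 1"
      then have "tail G ((1 / t) * x) \<le> C2 * (1 / t) powr - p * tail G x"
        using t x by (intro 2(3)) (auto simp: D_def)
      also have "\<dots> = C2 * tail G x * t powr p" using t by (simp add: powr_divide powr_minus field_simps)
      also have "\<dots> \<le> C * tail G x * max (t powr p) (t powr q)"
        using T0[of x] C 2(1) by (intro mult_mono) auto
      finally show ?thesis by simp
    next
      assume *: "1 < t" "D \<le> x / t"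
      then have "tail G (x / t) \<le> C1 * t powr q * tail G (t * (x / t))"
        by (intro 1(3)) (auto simp: D_def)
      also have "\<dots> = C1 * tail G x * t powr q" using * by simp
      also have "\<dots> \<le> C * tail G x * max (t powr p) (t powr q)"
        using T0[of x] C 1(1) by (intro mult_mono) auto
      finally show ?thesis .
    next
      assume *: "1 < t" "x / t < D"
      \<comment> \<open>Since \<open>x / D < t\<close>, comparing the tail at \<open>D\<close> with
        that at \<open>x\<close> shows that the claimed bound is at least 1.\<close>
      have "tail G D \<le> C1 * (x / D) powr q * tail G ((x / D) * D)"
        using x D by (intro 1(3)) (auto simp: D_def)
      also have "\<dots> = C1 * (x / D) powr q * tail G x" using D by simp
      also have "\<dots> \<le> C1 * t powr q * tail G x"
        using * D x T0[of x] 1(1) p q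
        by (intro mult_right_mono mult_left_mono powr_mono2) (auto simp: field_simps)
      finally have "1 \<le> C1 / tail G D * tail G x * t powr q"
        using T0[of D] by (simp add: field_simps)
      also have "\<dots> \<le> C * tail G x * max (t powr p) (t powr q)"
        using T0[of x] T0[of D] C 1(1) by (intro mult_mono) auto
      finally show ?thesis using tail1[of "x / t"] by linarith
    qed
  qed
  moreover have "C > 0" using C 1(1) by linarith
  ultimately show ?thesis using D that by blast
qed

lemma consistently_varyingD:
  assumes G: "consistently_varying G" and "0 < e"
  obtains b D where "0 < b" "b < 1" "0 < D" "\<And>x. D \<le> x \<Longrightarrow> tail G (b * x) \<le> (1 + e) * tail G x"
proof -
  have U: "unbounded_nonneg_distribution G" and lim: "(upper_tail_ratio G \<longlongrightarrow> 1) (at_left 1)"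
    using G by (auto simp: consistently_varying_def)
  have "\<forall>\<^sub>F b in at_left 1. upper_tail_ratio G b < ereal (1 + e)"
    using assms by (intro order_tendstoD(2)[OF lim]) auto
  moreover have "\<forall>\<^sub>F b in at_left (1::real). b \<in> {0<..<1}"
    by (intro eventually_at_left_real) simp
  ultimately have "\<forall>\<^sub>F b in at_left 1. upper_tail_ratio G b < ereal (1 + e) \<and> b \<in> {0<..<1}"
    by (rule eventually_conj)
  then obtain b where b: "upper_tail_ratio G b < ereal (1 + e)" "0 < b" "b < 1"
    using eventually_happens'[of "at_left (1::real)"] by auto
  from upper_tail_ratio_lessD[OF U b(1)] show ?thesis using that b by metis
qed

section \<open>Measurability and independence in the risk model\<close>

text \<open>Openness allows a witness to be lowered by \<open>e\<close> in every coordinate; the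
  finitely many lowered coordinates are exceeded by a common partial sum, even where the series
  diverges. The event thus becomes a countable union.\<close>

lemma mem_upward_extension_suminf:
  fixes v :: "nat \<Rightarrow> real ^ 'd"
  assumes "open B" and B: "increasing_set B" and v: "\<And>i k. 0 \<le> v i $ k"
  shows "(\<chi> k. \<Sum>i. ennreal (v i $ k)) \<in> upward_extension B \<longleftrightarrow> (\<exists>N. (\<Sum>i<N. v i) \<in> B)"
proof
  assume "\<exists>N. (\<Sum>i<N. v i) \<in> B"
  then obtain N where N: "(\<Sum>i<N. v i) \<in> B" by auto
  have "ennreal ((\<Sum>i<N. v i) $ k) \<le> (\<Sum>i. ennreal (v i $ k))" for k
  proof -
    have "ennreal ((\<Sum>i<N. v i) $ k) = (\<Sum>i<N. ennreal (v i $ k))"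
      using v by (subst sum_ennreal) auto
    also have "\<dots> \<le> (\<Sum>i. ennreal (v i $ k))" by (rule sum_le_suminf) auto
    finally show ?thesis .
  qed
  with N show "(\<chi> k. \<Sum>i. ennreal (v i $ k)) \<in> upward_extension B"
    unfolding upward_extension_def by (intro CollectI bexI[of _ "\<Sum>i<N. v i"]) simp_all
next
  assume "(\<chi> k. \<Sum>i. ennreal (v i $ k)) \<in> upward_extension B"
  then obtain y where y: "y \<in> B" "\<And>k. ennreal (y $ k) \<le> (\<Sum>i. ennreal (v i $ k))"
    by (auto simp: upward_extension_def)
  have "((\<lambda>e. y - e *\<^sub>R 1) \<longlongrightarrow> y - 0 *\<^sub>R 1) (at_right (0::real))"
    by (intro tendsto_intros)
  then have "\<forall>\<^sub>F e in at_right (0::real). y - e *\<^sub>R 1 \<in> B"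
    using y(1) \<open>open B\<close> by (intro topological_tendstoD) auto
  then have "\<forall>\<^sub>F e in at_right (0::real). y - e *\<^sub>R 1 \<in> B \<and> 0 < e"
    by (intro eventually_conj) (simp_all add: eventually_at_right_less)
  then obtain e :: real where e: "0 < e" "y - e *\<^sub>R 1 \<in> B"
    using eventually_happens'[of "at_right (0::real)"] by auto
  have "\<forall>\<^sub>F N in sequentially. y $ k - e \<le> (\<Sum>i<N. v i $ k)" for k
  \<comment> \<open>\<open>ennreal\<close> sends negative reals to 0, so the strict comparison in
    the second case needs a nonnegative lowered coordinate.\<close>
  proof (cases "y $ k - e < 0")
    case True
    then have "y $ k - e \<le> (\<Sum>i<N. v i $ k)" for N
      using sum_nonneg[of "{..<N}" "\<lambda>i. v i $ k"] v by (simp add: less_imp_le order_trans[OF less_imp_le])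
    then show ?thesis by simp
  next
    case False
    then have "ennreal (y $ k - e) < ennreal (y $ k)" using e by (intro ennreal_lessI) auto
    also have "\<dots> \<le> (\<Sum>i. ennreal (v i $ k))" by (rule y)
    finally have lt: "ennreal (y $ k - e) < (\<Sum>i. ennreal (v i $ k))" .
    have "(\<lambda>N. \<Sum>i<N. ennreal (v i $ k)) \<longlonglongrightarrow> (\<Sum>i. ennreal (v i $ k))"
      by (rule summable_LIMSEQ) simp
    from order_tendstoD(1)[OF this lt] show ?thesis
    proof eventually_elim
      case (elim N)
      then have "ennreal (y $ k - e) < ennreal (\<Sum>i<N. v i $ k)" using v by (simp add: sum_ennreal)
      then show ?case by (meson ennreal_leI less_imp_le not_less)
    qed
  qed
  then have "\<forall>\<^sub>F N in sequentially. \<forall>k. y $ k - e \<le> (\<Sum>i<N. v i $ k)"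
    by (rule eventually_all_finite)
  then obtain N where N: "\<And>k. y $ k - e \<le> (\<Sum>i<N. v i $ k)"
    by (auto simp: eventually_sequentially)
  have "\<forall>k. 0 \<le> ((\<Sum>i<N. v i) - (y - e *\<^sub>R 1)) $ k" using N by simp
  with e(2) B have "(y - e *\<^sub>R 1) + ((\<Sum>i<N. v i) - (y - e *\<^sub>R 1)) \<in> B"
    unfolding increasing_set_def by blast
  then show "\<exists>N. (\<Sum>i<N. v i) \<in> B" by auto
qed

lemma increasing_dilate:
  assumes "increasing_set B" "0 < u"
  shows "increasing_set (dilate u B)"
  unfolding increasing_set_def
proof (intro ballI allI impI)
  fix x y :: "real ^ 'a" assume x: "x \<in> dilate u B" and y: "\<forall>k. 0 \<le> y $ k"
  have "(1 / u) *\<^sub>R x + (1 / u) *\<^sub>R y \<in> B"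
    using assms x y unfolding increasing_set_def by (simp add: mem_dilate_iff)
  then show "x + y \<in> dilate u B" using assms by (simp add: mem_dilate_iff scaleR_add_right)
qed

text \<open>The added 1 keeps the grid points strictly to the right of \<open>s\<close>, as the
  filter \<open>at_right\<close> demands.\<close>

lemma floor_shift_tendsto_right:
  fixes s :: real
  assumes "0 \<le> s"
  shows "filterlim (\<lambda>n. (real (nat \<lfloor>real (Suc n) * s\<rfloor>) + 1) / real (Suc n)) (at_right s) sequentially"
proof (rule tendsto_imp_filterlim_at_right)
  let ?g = "\<lambda>n. (real (nat \<lfloor>real (Suc n) * s\<rfloor>) + 1) / real (Suc n)"
  have b: "s < ?g n" "?g n \<le> s + 1 / real (Suc n)" for n
  proof -
    have "real (nat \<lfloor>real (Suc n) * s\<rfloor>) = of_int \<lfloor>real (Suc n) * s\<rfloor>"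
      using assms by simp
    then have "real (Suc n) * s < real (nat \<lfloor>real (Suc n) * s\<rfloor>) + 1"
      "real (nat \<lfloor>real (Suc n) * s\<rfloor>) \<le> real (Suc n) * s"
      by linarith+
    then show "s < ?g n" "?g n \<le> s + 1 / real (Suc n)"
      by (auto simp: pos_less_divide_eq pos_divide_le_eq mult.commute distrib_left simp del: of_nat_Suc)
  qed
  have "(\<lambda>n. s + 1 / real (Suc n)) \<longlonglongrightarrow> s + 0"
    by (intro tendsto_intros LIMSEQ_Suc[OF lim_1_over_n])
  then show "?g \<longlonglongrightarrow> s"
    using b by (intro tendsto_sandwich[of "\<lambda>_. s" ?g sequentially "\<lambda>n. s + 1 / real (Suc n)" s])
      (simp_all only: always_eventually less_imp_le add_0_right tendsto_const simp_thms)
  show "\<forall>\<^sub>F n in sequentially. s < ?g n" using b by simp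
qed

text \<open>The generated sigma-algebra as a \<open>measure\<close> object, so that the
  \<open>measurable\<close> calculus applies to it.\<close>

definition source :: "'a measure \<Rightarrow> 't set \<Rightarrow> 'b measure \<Rightarrow> ('t \<Rightarrow> 'a \<Rightarrow> 'b) \<Rightarrow> 'a measure" where
  "source M I N Z = sigma (space M) {Z t -` B \<inter> space M | t B. t \<in> I \<and> B \<in> sets N}"

lemma space_source [simp]: "space (source M I N Z) = space M"
  by (simp add: source_def space_measure_of_conv)

lemma sets_source: "sets (source M I N Z) = generated_events M I N Z"
  unfolding source_def generated_events_def by (rule sets_measure_of) auto

lemma measurable_source:
  assumes "t \<in> I" "\<And>\<omega>. \<omega> \<in> space M \<Longrightarrow> Z t \<omega> \<in> space N"
  shows "Z t \<in> measurable (source M I N Z) N"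
proof (rule measurableI)
  fix B assume "B \<in> sets N"
  then show "Z t -` B \<inter> space (source M I N Z) \<in> sets (source M I N Z)"
    unfolding sets_source generated_events_def using assms by (auto intro!: sigma_sets.Basic)
qed (use assms in auto)

text \<open>Independence makes the joint law a product, and Tonelli applies. Sub-sigma-algebras
  appear in the statement because one map is later the identity into \<open>return_source\<close>,
  which carries the whole path of the returns.\<close>

lemma (in prob_space) nn_integral_indep:
  assumes ind: "indep_set (sets P) (sets Q)" and sp: "space P = space M" "space Q = space M"
    and Z: "Z \<in> measurable P S" and W: "W \<in> measurable Q R"
    and f [measurable]: "f \<in> borel_measurable (S \<Otimes>\<^sub>M R)"
  shows "(\<integral>\<^sup>+\<omega>. f (Z \<omega>, W \<omega>) \<partial>M) = (\<integral>\<^sup>+\<omega>. (\<integral>\<^sup>+\<omega>'. f (Z \<omega>', W \<omega>) \<partial>M) \<partial>M)"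
proof -
  have ev: "sets P \<subseteq> events" "sets Q \<subseteq> events"
    using ind by (auto dest: indep_setD_ev1 indep_setD_ev2)
  have rv [measurable]: "random_variable S Z" "random_variable R W"
    using measurable_sets[OF Z] measurable_sets[OF W] measurable_space[OF Z] measurable_space[OF W] ev sp
    by (auto intro!: measurableI)
  interpret S: prob_space "distr M S Z" by (rule prob_space_distr) measurable
  interpret R: prob_space "distr M R W" by (rule prob_space_distr) measurable
  interpret pair_sigma_finite "distr M S Z" "distr M R W" ..
  have eq: "distr M S Z \<Otimes>\<^sub>M distr M R W = distr M (S \<Otimes>\<^sub>M R) (\<lambda>\<omega>. (Z \<omega>, W \<omega>))"
  proof (rule pair_measure_eqI)
    fix A B assume A: "A \<in> sets (distr M S Z)" and B: "B \<in> sets (distr M R W)"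
    have "prob ((Z -` A \<inter> space M) \<inter> (W -` B \<inter> space M)) =
        prob (Z -` A \<inter> space M) * prob (W -` B \<inter> space M)"
      using A B measurable_sets[OF Z, of A] measurable_sets[OF W, of B] sp
      by (intro indep_setD[OF ind]) auto
    moreover have "(Z -` A \<inter> space M) \<inter> (W -` B \<inter> space M) = (\<lambda>\<omega>. (Z \<omega>, W \<omega>)) -` (A \<times> B) \<inter> space M"
      by auto
    ultimately show "emeasure (distr M S Z) A * emeasure (distr M R W) B =
        emeasure (distr M (S \<Otimes>\<^sub>M R) (\<lambda>\<omega>. (Z \<omega>, W \<omega>))) (A \<times> B)"
      using A B by (simp add: emeasure_distr emeasure_eq_measure ennreal_mult)
  qed (simp_all add: S.sigma_finite_measure_axioms R.sigma_finite_measure_axioms cong: sets_pair_measure_cong)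
  have f': "f \<in> borel_measurable (distr M S Z \<Otimes>\<^sub>M distr M R W)" by simp
  have "(\<integral>\<^sup>+\<omega>. f (Z \<omega>, W \<omega>) \<partial>M) = integral\<^sup>N (distr M (S \<Otimes>\<^sub>M R) (\<lambda>\<omega>. (Z \<omega>, W \<omega>))) f"
    by (subst nn_integral_distr) auto
  also have "\<dots> = (\<integral>\<^sup>+w. \<integral>\<^sup>+z. f (z, w) \<partial>distr M S Z \<partial>distr M R W)"
    unfolding eq[symmetric] using nn_integral_snd[of "case_prod (\<lambda>z w. f (z, w))"] f' by simp
  also have "\<dots> = (\<integral>\<^sup>+w. \<integral>\<^sup>+\<omega>'. f (Z \<omega>', w) \<partial>M \<partial>distr M R W)"
  proof (rule nn_integral_cong)
    fix w assume "w \<in> space (distr M R W)"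
    then have [measurable]: "w \<in> space R" by simp
    show "(\<integral>\<^sup>+z. f (z, w) \<partial>distr M S Z) = (\<integral>\<^sup>+\<omega>'. f (Z \<omega>', w) \<partial>M)"
      by (rule nn_integral_distr) measurable
  qed
  also have "\<dots> = (\<integral>\<^sup>+\<omega>. \<integral>\<^sup>+\<omega>'. f (Z \<omega>', W \<omega>) \<partial>M \<partial>M)"
    by (rule nn_integral_distr) measurable
  finally show ?thesis .
qed

lemma (in prob_space) indep_set_commute:
  assumes "indep_set A B"
  shows "indep_set B A"
proof (rule indep_setI)
  show "prob (b \<inter> a) = prob b * prob a" if "b \<in> B" "a \<in> A" for a b
    using indep_setD[OF assms that(2,1)] by (simp add: Int_commute)
qed (use indep_setD_ev1[OF assms] indep_setD_ev2[OF assms] in auto)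

context risk_model
begin

abbreviation "claim_source \<equiv> source M {1..} borel X"
abbreviation "count_source \<equiv> source M {0..} (count_space UNIV) (renewal_count \<theta>)"
abbreviation "return_source \<equiv> source M {0..} borel \<xi>"

text \<open>The joint information of counts and returns: each discount factor is measurable with
  respect to it, and under \<open>independent_sources\<close> it is independent of the
  claims.\<close>

definition discount_source :: "'a measure" where
  "discount_source = sigma (space M) (sets count_source \<union> sets return_source)"

lemma space_discount_source [simp]: "space discount_source = space M"
  by (simp add: discount_source_def space_measure_of_conv)

lemma sets_discount_source:
  "sets discount_source = sigma_sets (space M) (sets count_source \<union> sets return_source)"
  unfolding discount_source_def using sets.sets_into_space[of _ count_source]
    sets.sets_into_space[of _ return_source]
  by (intro sets_measure_of) auto

lemma measurable_discount_source:
  "f \<in> measurable count_source N \<Longrightarrow> f \<in> measurable discount_source N"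
  "f \<in> measurable return_source N \<Longrightarrow> f \<in> measurable discount_source N"
  unfolding measurable_def sets_discount_source by (auto intro!: sigma_sets.Basic)

section \<open>Arrival times and discount factors as functions of the independent sources\<close>

lemma arrival_mono:
  assumes "\<omega> \<in> space M" "i \<le> j"
  shows "arrival \<theta> i \<omega> \<le> arrival \<theta> j \<omega>"
  unfolding arrival_def using assms by (intro sum_mono2) (auto intro: interarrival_nonneg)

lemma arrival_nonneg: "\<omega> \<in> space M \<Longrightarrow> 0 \<le> arrival \<theta> i \<omega>"
  using arrival_mono[of \<omega> 0 i] by (simp add: arrival_def)

text \<open>Independence is assumed for the counting process, so arrival times must be expressed
  through it. Monotone arrivals make the counted indices an initial segment, which the supremum
  determines.\<close>

lemma arrival_le_iff_renewal_count:
  assumes \<omega>: "\<omega> \<in> space M"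
  shows "arrival \<theta> (Suc i) \<omega> \<le> t \<longleftrightarrow> enat (Suc i) \<le> renewal_count \<theta> t \<omega>"
proof
  assume "arrival \<theta> (Suc i) \<omega> \<le> t"
  then show "enat (Suc i) \<le> renewal_count \<theta> t \<omega>"
    unfolding renewal_count_def by (intro Sup_upper) auto
next
  assume *: "enat (Suc i) \<le> renewal_count \<theta> t \<omega>"
  show "arrival \<theta> (Suc i) \<omega> \<le> t"
  proof (rule ccontr)
    assume n: "\<not> arrival \<theta> (Suc i) \<omega> \<le> t"
    have "renewal_count \<theta> t \<omega> \<le> enat i"
      unfolding renewal_count_def
    proof (rule Sup_least, safe)
      fix j assume "arrival \<theta> j \<omega> \<le> t"
      then have "\<not> Suc i \<le> j" using n arrival_mono[OF \<omega>, of "Suc i" j] by linarith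
      then show "enat j \<le> enat i" by simp
    qed
    with * have "enat (Suc i) \<le> enat i" by (rule order_trans)
    then show False by simp
  qed
qed

lemma arrival_measurable: "arrival \<theta> (Suc i) \<in> borel_measurable count_source"
proof (rule borel_measurable_iff_le[THEN iffD2], rule allI)
  fix t :: real
  show "{\<omega>\<in>space count_source. arrival \<theta> (Suc i) \<omega> \<le> t} \<in> sets count_source"
  proof (cases "0 \<le> t")
    case True
    then have rm: "renewal_count \<theta> t \<in> measurable count_source (count_space UNIV)"
      by (intro measurable_source) auto
    have "{\<omega>\<in>space count_source. arrival \<theta> (Suc i) \<omega> \<le> t} =
        {\<omega>\<in>space count_source. enat (Suc i) \<le> renewal_count \<theta> t \<omega>}"
      using arrival_le_iff_renewal_count by auto
    also have "\<dots> = renewal_count \<theta> t -` {enat (Suc i)..} \<inter> space count_source" by auto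
    also have "\<dots> \<in> sets count_source" by (rule measurable_sets[OF rm]) simp
    finally show ?thesis .
  next
    case False
    then have "\<not> arrival \<theta> (Suc i) \<omega> \<le> t" if "\<omega> \<in> space M" for \<omega>
      using arrival_nonneg[OF that, of "Suc i"] by linarith
    then have "{\<omega>\<in>space count_source. arrival \<theta> (Suc i) \<omega> \<le> t} = {}" by auto
    then show ?thesis by (simp only: sets.empty_sets)
  qed
qed

text \<open>By right-continuity the time may be approximated from the right by multiples of \<open>1 / n\<close>,
  so that only countably many coordinates of the process are involved.\<close>

lemma returns_jointly_measurable:
  "(\<lambda>(t, \<omega>). \<xi> (max t 0) \<omega>) \<in> borel_measurable (borel \<Otimes>\<^sub>M return_source)"
proof (rule borel_measurable_LIMSEQ_real)
  let ?g = "\<lambda>n t. (real (nat \<lfloor>real (Suc n) * max t 0\<rfloor>) + 1) / real (Suc n)"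
  fix p :: "real \<times> 'a" assume "p \<in> space (borel \<Otimes>\<^sub>M return_source)"
  then obtain t \<omega> where p: "p = (t, \<omega>)" "\<omega> \<in> space M" by (auto simp: space_pair_measure)
  have "(\<lambda>n. \<xi> (?g n t) \<omega>) \<longlonglongrightarrow> \<xi> (max t 0) \<omega>"
    using p(2) by (intro filterlim_compose[OF returns_right_continuous floor_shift_tendsto_right]) auto
  then show "(\<lambda>n. case p of (t, \<omega>) \<Rightarrow> \<xi> (?g n t) \<omega>) \<longlonglongrightarrow> (case p of (t, \<omega>) \<Rightarrow> \<xi> (max t 0) \<omega>)"
    by (simp add: p)
next
  fix n
  have [measurable]: "\<xi> ((real k + 1) / real (Suc n)) \<in> borel_measurable return_source" for k
    by (intro measurable_source) auto
  have "(\<lambda>p. (\<lambda>k p. \<xi> ((real k + 1) / real (Suc n)) (snd p))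
      (nat \<lfloor>real (Suc n) * max (fst p) 0\<rfloor>) p) \<in> borel_measurable (borel \<Otimes>\<^sub>M return_source)"
    by (rule measurable_compose_countable) measurable
  then show "(\<lambda>(t, \<omega>). \<xi> ((real (nat \<lfloor>real (Suc n) * max t 0\<rfloor>) + 1) / real (Suc n)) \<omega>)
      \<in> borel_measurable (borel \<Otimes>\<^sub>M return_source)"
    by (simp add: case_prod_beta')
qed

definition \<Theta> :: "nat \<Rightarrow> 'a \<Rightarrow> real" where
  "\<Theta> i \<omega> = exp (- \<xi> (arrival \<theta> (Suc i) \<omega>) \<omega>)"

lemma returns_at_arrival_measurable:
  "(\<lambda>\<omega>. \<xi> (max (arrival \<theta> (Suc i) \<omega>) 0) \<omega>) \<in> borel_measurable discount_source"
proof -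
  have "(\<lambda>\<omega>. (arrival \<theta> (Suc i) \<omega>, \<omega>)) \<in> measurable discount_source (borel \<Otimes>\<^sub>M return_source)"
    using arrival_measurable[of i] by (intro measurable_Pair measurable_discount_source) auto
  from measurable_compose[OF this returns_jointly_measurable] show ?thesis by simp
qed

lemma \<Theta>_measurable: "\<Theta> i \<in> borel_measurable discount_source"
proof -
  have "\<Theta> i \<in> borel_measurable discount_source \<longleftrightarrow>
      (\<lambda>\<omega>. exp (- \<xi> (max (arrival \<theta> (Suc i) \<omega>) 0) \<omega>)) \<in> borel_measurable discount_source"
    using arrival_nonneg by (intro measurable_cong) (simp add: \<Theta>_def max_absorb1)
  then show ?thesis using returns_at_arrival_measurable[of i] by simp
qed

lemma \<Theta>_pos: "0 < \<Theta> i \<omega>"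
  by (simp add: \<Theta>_def)

text \<open>Independence of three sigma-algebras survives grouping: the claims, at index 0, remain
  independent of what indices 1 and 2 generate together.\<close>

lemma
  assumes "independent_sources M X \<theta> \<xi>"
  shows indep_claim_discount: "indep_set (sets claim_source) (sets discount_source)"
    and indep_return_count: "indep_set (sets return_source) (sets count_source)"
proof -
  let ?F = "\<lambda>k. [sets claim_source, sets count_source, sets return_source] ! k"
  have F: "indep_sets ?F {..<3}"
    using assms by (simp add: independent_sources_def sets_source)
  have ev: "?F k \<subseteq> events" if "k < 3" for k
    using F that unfolding indep_sets_def by blast
  have ev3: "sets claim_source \<subseteq> events" "sets count_source \<subseteq> events" "sets return_source \<subseteq> events"
    using ev[of 0] ev[of 1] ev[of 2] by (auto simp: numeral_2_eq_2)
  have "indep_set (sets count_source) (sets return_source)"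
  proof (rule indep_setI)
    fix a b assume "a \<in> sets count_source" "b \<in> sets return_source"
    then have *: "prob (\<Inter>j\<in>{1, 2::nat}. if j = 1 then a else b) = (\<Prod>j\<in>{1, 2::nat}. prob (if j = 1 then a else b))"
      by (intro indep_setsD[OF F]) (auto simp: numeral_2_eq_2)
    have "(\<Inter>j\<in>{1, 2::nat}. if j = 1 then a else b) = a \<inter> b" by auto
    with * show "prob (a \<inter> b) = prob a * prob b" by simp
  qed (use ev3 in auto)
  then show "indep_set (sets return_source) (sets count_source)" by (rule indep_set_commute)
  let ?I = "\<lambda>b. if b then {0} else {1, 2::nat}"
  have G: "indep_sets (\<lambda>b. sigma_sets (space M) (\<Union>k\<in>?I b. ?F k)) UNIV"
  proof (rule indep_sets_collect_sigma)
    have "(\<Union>b. ?I b) = {..<3}" by (auto simp: UNIV_bool)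
    then show "indep_sets ?F (\<Union>b. ?I b)" using F by simp
    show "disjoint_family ?I" by (auto simp: disjoint_family_on_def)
    show "Int_stable (?F k)" if "k \<in> ?I b" for k b
      using that by (auto simp: Int_stable_def numeral_2_eq_2 split: if_splits)
  qed
  have disc: "sets discount_source = sigma_sets (space M) (\<Union>k\<in>?I False. ?F k)"
    by (simp add: sets_discount_source numeral_2_eq_2)
  show "indep_set (sets claim_source) (sets discount_source)"
  proof (rule indep_setI)
    show "sets discount_source \<subseteq> events"
      unfolding sets_discount_source using ev3 by (intro sets.sigma_sets_subset) auto
    fix a b assume a: "a \<in> sets claim_source" and b: "b \<in> sets discount_source"
    have *: "prob (\<Inter>j\<in>{True, False}. if j then a else b) = (\<Prod>j\<in>{True, False}. prob (if j then a else b))"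
      using a b unfolding disc by (intro indep_setsD[OF G]) (auto intro: sigma_sets.Basic)
    have "(\<Inter>j\<in>{True, False}. if j then a else b) = a \<inter> b" by auto
    with * show "prob (a \<inter> b) = prob a * prob b" by simp
  qed (use ev3 in auto)
qed

section \<open>Integrals against the renewal measure\<close>

lemma interarrival_measurable: "i \<ge> 1 \<Longrightarrow> random_variable borel (\<theta> i)"
  using interarrival_indep by (auto simp: indep_vars_def)

lemma arrival_rv [measurable]: "random_variable borel (arrival \<theta> (Suc i))"
  unfolding arrival_def[abs_def] by (rule borel_measurable_sum) (auto intro: interarrival_measurable)

text \<open>As an image of counting measure times \<open>M\<close>, the renewal measure admits a
  change of variables followed by Tonelli.\<close>

lemma renewal_measure_eq_distr:
  "renewal_measure M \<theta> = distr (count_space UNIV \<Otimes>\<^sub>M M) borel (\<lambda>(i, \<omega>). arrival \<theta> (Suc i) \<omega>)"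
proof (rule measure_eqI)
  fix B assume "B \<in> sets (renewal_measure M \<theta>)"
  then have B [measurable]: "B \<in> sets borel" by simp
  let ?E = "{p \<in> space (count_space UNIV \<Otimes>\<^sub>M M). (case p of (i, \<omega>) \<Rightarrow> arrival \<theta> (Suc i) \<omega>) \<in> B}"
  have "emeasure (distr (count_space UNIV \<Otimes>\<^sub>M M) borel (\<lambda>(i, \<omega>). arrival \<theta> (Suc i) \<omega>)) B =
      emeasure (count_space UNIV \<Otimes>\<^sub>M M) ?E"
    by (subst emeasure_distr) (auto intro!: arg_cong2[where f = emeasure])
  also have "\<dots> = (\<integral>\<^sup>+i. emeasure M (Pair i -` ?E) \<partial>count_space UNIV)"
    by (rule emeasure_pair_measure_alt) measurable
  also have "\<dots> = (\<Sum>i. emeasure M {\<omega>\<in>space M. arrival \<theta> (Suc i) \<omega> \<in> B})"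
    unfolding nn_integral_count_space_nat
    by (intro suminf_cong arg_cong2[where f = emeasure]) (auto simp: space_pair_measure)
  finally show "emeasure (renewal_measure M \<theta>) B =
      emeasure (distr (count_space UNIV \<Otimes>\<^sub>M M) borel (\<lambda>(i, \<omega>). arrival \<theta> (Suc i) \<omega>)) B"
    using emeasure_renewal_measure[OF interarrival_measurable B] by simp
qed simp

lemma nn_integral_renewal_measure:
  assumes [measurable]: "f \<in> borel_measurable borel"
  shows "(\<integral>\<^sup>+s. f s \<partial>renewal_measure M \<theta>) = (\<Sum>i. \<integral>\<^sup>+\<omega>. f (arrival \<theta> (Suc i) \<omega>) \<partial>M)"
proof -
  have "(\<integral>\<^sup>+s. f s \<partial>renewal_measure M \<theta>) =
      (\<integral>\<^sup>+p. f (case p of (i, \<omega>) \<Rightarrow> arrival \<theta> (Suc i) \<omega>) \<partial>(count_space UNIV \<Otimes>\<^sub>M M))"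
    unfolding renewal_measure_eq_distr by (rule nn_integral_distr) measurable
  also have "\<dots> = (\<integral>\<^sup>+i. \<integral>\<^sup>+\<omega>. f (arrival \<theta> (Suc i) \<omega>) \<partial>M \<partial>count_space UNIV)"
    by (subst nn_integral_fst[symmetric]) (auto simp: case_prod_beta')
  finally show ?thesis by (simp add: nn_integral_count_space_nat)
qed

end

section \<open>Sums of heavy-tailed terms\<close>

text \<open>Jensen's inequality for the power \<open>r\<close>, with weights proportional to
  \<open>g i\<close> at the points \<open>v i / g i\<close>. It is applied pointwise to random
  terms, so their dependence does not matter.\<close>

lemma weighted_powr_sum_le:
  fixes g v :: "'i \<Rightarrow> real"
  assumes I: "finite I" and g: "\<And>i. i \<in> I \<Longrightarrow> 0 < g i" and v: "\<And>i. i \<in> I \<Longrightarrow> 0 \<le> v i"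
    and r: "1 \<le> r"
  shows "(\<Sum>i\<in>I. v i) powr r \<le> (\<Sum>i\<in>I. g i) powr (r - 1) * (\<Sum>i\<in>I. g i powr (1 - r) * v i powr r)"
proof -
  \<comment> \<open>Dropping zero terms makes all points \<open>v i / g i\<close> positive; the sums
    over \<open>J\<close> are enlarged to \<open>I\<close> at the end.\<close>
  define J where "J = {i \<in> I. 0 < v i}"
  have J: "finite J" "J \<subseteq> I" "\<And>i. i \<in> J \<Longrightarrow> 0 < g i" "\<And>i. i \<in> J \<Longrightarrow> 0 < v i"
    using I g by (auto simp: J_def)
  have vJ: "(\<Sum>i\<in>I. v i) = (\<Sum>i\<in>J. v i)"
    using I v by (intro sum.mono_neutral_right) (auto simp: J_def less_le)
  show ?thesis
  proof (cases "J = {}")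
    case True
    then show ?thesis using vJ by (auto intro!: mult_nonneg_nonneg sum_nonneg)
  next
    case False
    define s where "s = (\<Sum>i\<in>J. g i)"
    have s: "0 < s" unfolding s_def using J False by (intro sum_pos) auto
    have sI: "s \<le> (\<Sum>i\<in>I. g i)"
      unfolding s_def using I J g by (intro sum_mono2) (auto intro: less_imp_le)
    have one: "(\<Sum>i\<in>J. g i / s) = 1" using s by (simp add: s_def flip: sum_divide_distrib)
    have "(\<Sum>i\<in>J. (g i / s) *\<^sub>R (v i / g i)) powr r \<le> (\<Sum>i\<in>J. g i / s * (v i / g i) powr r)"
      by (rule convex_on_sum[OF J(1) False powr_convex[OF r] one])
        (use J s in \<open>auto intro!: divide_nonneg_pos less_imp_le\<close>)
    also have "(\<Sum>i\<in>J. (g i / s) *\<^sub>R (v i / g i)) = (\<Sum>i\<in>J. v i) / s"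
      unfolding sum_divide_distrib
    proof (intro sum.cong refl)
      fix i assume "i \<in> J"
      then show "(g i / s) *\<^sub>R (v i / g i) = v i / s" using J(3)[of i] s by simp
    qed
    also have "(\<Sum>i\<in>J. g i / s * (v i / g i) powr r) = (\<Sum>i\<in>J. g i powr (1 - r) * v i powr r) / s"
      unfolding sum_divide_distrib
    proof (intro sum.cong refl)
      fix i assume "i \<in> J"
      then show "g i / s * (v i / g i) powr r = g i powr (1 - r) * v i powr r / s"
        using J(3)[of i] J(4)[of i] by (simp add: powr_divide powr_diff)
    qed
    also have "((\<Sum>i\<in>J. v i) / s) powr r = (\<Sum>i\<in>J. v i) powr r / s powr r"
      by (rule powr_divide)
    finally have "(\<Sum>i\<in>J. v i) powr r \<le> s powr r / s * (\<Sum>i\<in>J. g i powr (1 - r) * v i powr r)"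
      using s by (simp add: field_simps)
    also have "s powr r / s = s powr (r - 1)" using s by (simp add: powr_diff)
    also have "s powr (r - 1) * (\<Sum>i\<in>J. g i powr (1 - r) * v i powr r) \<le>
        (\<Sum>i\<in>I. g i) powr (r - 1) * (\<Sum>i\<in>I. g i powr (1 - r) * v i powr r)"
      using s sI r I J by (intro mult_mono powr_mono2 sum_mono2) (auto intro: sum_nonneg)
    finally show ?thesis unfolding vJ .
  qed
qed

lemma half_power_powr: "((1 / 2) ^ k) powr s = 2 powr (- (s * real k))"
proof -
  have "(1 / 2 :: real) ^ k = 2 powr (- real k)"
    by (simp add: powr_minus powr_realpow power_one_over field_simps)
  then show ?thesis by (simp add: powr_powr mult.commute)
qed

lemma two_powr_power: "((2::real) powr s) ^ k = 2 powr (s * real k)"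
  by (subst powr_realpow[symmetric]) (simp_all add: powr_powr)

text \<open>A discrete layer-cake bound: the one layer with
  \<open>(1/2)^(k+1) < v \<le> (1/2)^k\<close> already dominates \<open>v powr r\<close>. It turns
  tail bounds at dyadic levels into a moment bound.\<close>

lemma powr_le_dyadic_sum:
  fixes v r :: real
  assumes "0 \<le> v" "v \<le> 1" "0 < r"
  shows "ennreal (v powr r) \<le> (\<Sum>k. ennreal ((2 powr - r) ^ k) * indicator {y. (1 / 2) ^ Suc k < y} v)"
proof (cases "v = 0")
  case False
  have "\<exists>k. (1 / 2) ^ Suc k < v"
  proof -
    obtain n where "(1 / 2) ^ n < v" using real_arch_pow_inv[of v "1 / 2"] False assms(1) by auto
    moreover have "(1 / 2 :: real) ^ Suc n \<le> (1 / 2) ^ n" by (rule power_decreasing) auto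
    ultimately show ?thesis by (meson le_less_trans)
  qed
  define k where "k = (LEAST k. (1 / 2) ^ Suc k < v)"
  have k: "(1 / 2) ^ Suc k < v" unfolding k_def by (rule LeastI_ex) fact
  have "v \<le> (1 / 2) ^ k"
  proof (cases k)
    case (Suc j)
    then show ?thesis using not_less_Least[of j "\<lambda>k. (1 / 2) ^ Suc k < v"] by (simp add: k_def)
  qed (use assms in simp)
  then have "v powr r \<le> ((1 / 2) ^ k) powr r" using assms by (intro powr_mono2) auto
  also have "\<dots> = (2 powr - r) ^ k"
    by (simp add: half_power_powr two_powr_power)
  finally have "ennreal (v powr r) \<le>
      (\<Sum>k\<in>{k}. ennreal ((2 powr - r) ^ k) * indicator {y. (1 / 2) ^ Suc k < y} v)"
    using k by (simp add: ennreal_leI)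
  also have "\<dots> \<le> (\<Sum>k. ennreal ((2 powr - r) ^ k) * indicator {y. (1 / 2) ^ Suc k < y} v)"
    by (rule sum_le_suminf) auto
  finally show ?thesis .
qed simp

text \<open>Bonferroni's inequality: a new event overlaps the previous union by at most the sum of
  its pairwise intersections.\<close>

lemma (in prob_space) prob_union_ge:
  fixes n :: nat
  assumes E: "\<And>i. E i \<in> events"
  shows "(\<Sum>i<n. prob (E i)) - (\<Sum>i<n. \<Sum>j<i. prob (E i \<inter> E j)) \<le> prob (\<Union>i<n. E i)"
proof (induction n)
  case (Suc n)
  have "prob ((\<Union>i<n. E i) \<union> E n) + prob (\<Union>j<n. E n \<inter> E j) = prob (\<Union>i<n. E i) + prob (E n)"
  proof -
    have "prob ((\<Union>i<n. E i) \<union> E n) = prob (\<Union>i<n. E i) + prob (E n) - prob ((\<Union>i<n. E i) \<inter> E n)"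
      using E by (intro measure_Un3) (auto simp: fmeasurable_eq_sets)
    moreover have "(\<Union>i<n. E i) \<inter> E n = (\<Union>j<n. E n \<inter> E j)" by auto
    ultimately show ?thesis by simp
  qed
  moreover have "prob (\<Union>j<n. E n \<inter> E j) \<le> (\<Sum>j<n. prob (E n \<inter> E j))"
    using E by (intro finite_measure_subadditive_finite) auto
  moreover have "(\<Union>i<Suc n. E i) = (\<Union>i<n. E i) \<union> E n" by (auto simp: less_Suc_eq)
  ultimately show ?case using Suc by simp
qed simp

text \<open>The one-dimensional core. \<open>T\<close> will be the tail of a single reduced claim
  and \<open>m i\<close> a moment of the discount. \<open>Potter\<close> is uniform in
  \<open>u\<close>, as the moment bound needs all dyadic levels; in \<open>consistent\<close> the
  factor \<open>b\<close> precedes \<open>i\<close>; \<open>first_term\<close> allows errors in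
  \<open>T\<close> to be compared with the series.\<close>

locale heavy_tailed_sequence = prob_space M
  for M :: "'a measure" and Y :: "nat \<Rightarrow> 'a \<Rightarrow> real" +
  fixes T :: "real \<Rightarrow> real" and m :: "nat \<Rightarrow> real" and q r C D c0 :: real
  assumes Y_measurable [measurable]: "\<And>i. random_variable borel (Y i)"
    and Y_nonneg: "\<And>i \<omega>. \<omega> \<in> space M \<Longrightarrow> 0 \<le> Y i \<omega>"
    and T_pos: "\<And>x. 0 < T x"
    and C_pos: "0 < C" and D_pos: "0 < D" and m_pos: "\<And>i. 0 < m i"
    and exponents: "0 < q" "q < r" "1 \<le> r"
    and m_summable: "summable (\<lambda>i. m i powr (1 / r))"
    and Potter: "\<And>i u x. D \<le> x \<Longrightarrow> 0 < u \<Longrightarrow> u \<le> 1 \<Longrightarrow>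
          prob {\<omega>\<in>space M. u * x < Y i \<omega>} \<le> C * T x * u powr - q * m i"
    and T_scale: "\<And>u x. D \<le> x \<Longrightarrow> 0 < u \<Longrightarrow> u \<le> 1 \<Longrightarrow> T (u * x) \<le> C * T x * u powr - q"
    and joint_negligible: "\<And>i j c. i \<noteq> j \<Longrightarrow> 0 < c \<Longrightarrow>
          ((\<lambda>x. prob {\<omega>\<in>space M. c * x < Y i \<omega> \<and> c * x < Y j \<omega>} / T x) \<longlongrightarrow> 0) at_top"
    and consistent: "\<And>\<eta>. 0 < \<eta> \<Longrightarrow> \<exists>b. 0 < b \<and> b < 1 \<and> (\<forall>i. \<forall>\<kappa>>0. \<forall>\<^sub>F x in at_top.
          prob {\<omega>\<in>space M. b * x < Y i \<omega>} \<le> (1 + \<eta>) * prob {\<omega>\<in>space M. x < Y i \<omega>} + \<kappa> * T x)"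
    and c0_pos: "0 < c0"
    and first_term: "\<forall>\<^sub>F x in at_top. c0 * T x \<le> prob {\<omega>\<in>space M. x < Y 0 \<omega>}"
begin

definition a :: "nat \<Rightarrow> real \<Rightarrow> real" where
  "a i x = prob {\<omega>\<in>space M. x < Y i \<omega>}"

text \<open>\<open>C\<close> times the sum over \<open>k\<close> of
  \<open>2 powr (q * (k + 1)) * 2 powr (- r * k)\<close>.\<close>

definition K :: real where
  "K = C * 2 powr q / (1 - 2 powr (q - r))"

lemma K_pos: "0 < K"
proof -
  have "2 powr (q - r) < (2::real) powr 0" using exponents by (intro powr_less_mono) auto
  then show ?thesis using C_pos by (simp add: K_def)
qed

text \<open>The level \<open>u = (1/2)^(k+1)\<close> carries weight \<open>2 powr (- r * k)\<close>
  and has probability at most a multiple of \<open>u powr - q\<close>, so \<open>q < r\<close> makes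
  the layers a convergent geometric series. Truncation confines the levels to
  \<open>u \<le> 1\<close>.\<close>

lemma truncated_moment:
  assumes x: "D \<le> x"
  shows "expectation (\<lambda>\<omega>. (min (Y i \<omega>) x / x) powr r) \<le> K * T x * m i"
proof -
  let ?V = "\<lambda>\<omega>. min (Y i \<omega>) x / x"
  have x0: "0 < x" using x D_pos by linarith
  have V: "0 \<le> ?V \<omega>" "?V \<omega> \<le> 1" if "\<omega> \<in> space M" for \<omega>
    using x0 Y_nonneg[OF that, of i] by auto
  have q1: "2 powr (q - r) < (1::real)" "2 powr (q - r) > (0::real)"
    using powr_less_mono[of "q - r" 0 "2::real"] exponents by auto
  have "(\<integral>\<^sup>+\<omega>. ennreal (?V \<omega> powr r) \<partial>M) \<le>
      (\<integral>\<^sup>+\<omega>. (\<Sum>k. ennreal ((2 powr - r) ^ k) * indicator {y. (1 / 2) ^ Suc k < y} (?V \<omega>)) \<partial>M)"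
    using V exponents by (intro nn_integral_mono powr_le_dyadic_sum) auto
  also have "\<dots> = (\<Sum>k. \<integral>\<^sup>+\<omega>. ennreal ((2 powr - r) ^ k) * indicator {y. (1 / 2) ^ Suc k < y} (?V \<omega>) \<partial>M)"
    by (rule nn_integral_suminf) measurable
  also have "\<dots> \<le> (\<Sum>k. ennreal (C * T x * m i * 2 powr q * (2 powr (q - r)) ^ k))"
  proof (rule suminf_le)
    fix k
    let ?u = "(1 / 2 :: real) ^ Suc k"
    have u: "0 < ?u" "?u \<le> 1" by (auto simp: power_le_one simp del: power_Suc)
    have "(\<integral>\<^sup>+\<omega>. ennreal ((2 powr - r) ^ k) * indicator {y. ?u < y} (?V \<omega>) \<partial>M) =
        ennreal ((2 powr - r) ^ k) * (\<integral>\<^sup>+\<omega>. indicator {y. ?u < y} (?V \<omega>) \<partial>M)"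
      by (rule nn_integral_cmult) measurable
    also have "(\<integral>\<^sup>+\<omega>. indicator {y. ?u < y} (?V \<omega>) \<partial>M) \<le>
        (\<integral>\<^sup>+\<omega>. indicator {\<omega>\<in>space M. ?u * x < Y i \<omega>} \<omega> \<partial>M)"
      
    proof (intro nn_integral_mono)
      fix \<omega> assume "\<omega> \<in> space M"
      moreover have "?u * x < Y i \<omega>" if "?u < ?V \<omega>"
        using that x0 by (simp add: pos_less_divide_eq del: power_Suc)
      ultimately show "indicator {y. ?u < y} (?V \<omega>) \<le>
          (indicator {\<omega>\<in>space M. ?u * x < Y i \<omega>} \<omega> :: ennreal)"
        by (auto simp: indicator_def simp del: power_Suc)
    qed
    also have "\<dots> = ennreal (prob {\<omega>\<in>space M. ?u * x < Y i \<omega>})"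
      by (simp add: emeasure_eq_measure)
    also have "\<dots> \<le> ennreal (C * T x * ?u powr - q * m i)"
      using Potter[OF x u] by (rule ennreal_leI)
    also have "ennreal ((2 powr - r) ^ k) * ennreal (C * T x * ?u powr - q * m i) =
        ennreal ((2 powr - r) ^ k * (C * T x * ?u powr - q * m i))"
      by (rule ennreal_mult[symmetric]) (use C_pos T_pos[of x] m_pos[of i] in auto)
    also have "(2 powr - r) ^ k * (C * T x * ?u powr - q * m i) =
        C * T x * m i * 2 powr q * (2 powr (q - r)) ^ k"
    proof -
      have "?u powr - q = 2 powr (q + q * real k)"
        unfolding half_power_powr by (simp add: algebra_simps)
      also have "\<dots> = 2 powr q * (2 powr q) ^ k" by (simp only: powr_add two_powr_power)
      finally have 1: "?u powr - q = 2 powr q * (2 powr q) ^ k" .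
      have 2: "(2 powr (q - r)) ^ k = (2 powr q) ^ k * ((2::real) powr - r) ^ k"
        unfolding power_mult_distrib[symmetric] powr_add[symmetric] by simp
      show ?thesis unfolding 1 2 by simp
    qed
    finally show "(\<integral>\<^sup>+\<omega>. ennreal ((2 powr - r) ^ k) * indicator {y. ?u < y} (?V \<omega>) \<partial>M) \<le>
        ennreal (C * T x * m i * 2 powr q * (2 powr (q - r)) ^ k)"
      by (simp add: mult_left_mono)
  qed auto
  also have "\<dots> = ennreal (\<Sum>k. C * T x * m i * 2 powr q * (2 powr (q - r)) ^ k)"
    using q1 C_pos T_pos[of x] m_pos[of i]
    by (intro suminf_ennreal2 summable_mult summable_geometric) auto
  also have "(\<Sum>k. C * T x * m i * 2 powr q * (2 powr (q - r)) ^ k) = K * T x * m i"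
    using q1 by (subst suminf_mult) (auto simp: suminf_geometric K_def intro!: summable_geometric)
  finally have le: "(\<integral>\<^sup>+\<omega>. ennreal (?V \<omega> powr r) \<partial>M) \<le> ennreal (K * T x * m i)" .
  have "expectation (\<lambda>\<omega>. ?V \<omega> powr r) = enn2real (\<integral>\<^sup>+\<omega>. ennreal (?V \<omega> powr r) \<partial>M)"
    by (rule integral_eq_nn_integral) auto
  also have "\<dots> \<le> enn2real (ennreal (K * T x * m i))"
    using le by (intro enn2real_mono) auto
  also have "\<dots> = K * T x * m i"
    using K_pos T_pos[of x] m_pos[of i] by simp
  finally show ?thesis .
qed

text \<open>Markov's inequality for the \<open>r\<close>-th power of the truncated sum. The weights
  \<open>g i = m i powr (1 / r)\<close> satisfy \<open>g i powr (1 - r) * m i = g i\<close>, so only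
  the quantity from \<open>m_summable\<close> remains, and the bound is uniform over finite index
  sets.\<close>

lemma prob_sum_le:
  assumes I: "finite I" and x: "D \<le> x"
  shows "prob {\<omega>\<in>space M. x < (\<Sum>i\<in>I. Y i \<omega>)} \<le> K * T x * (\<Sum>i\<in>I. m i powr (1 / r)) powr r"
proof -
  define g where "g i = m i powr (1 / r)" for i
  have g: "0 < g i" for i unfolding g_def using m_pos[of i] by simp
  have gr: "g i powr r = m i" for i
    unfolding g_def using m_pos[of i] exponents by (simp add: powr_powr)
  let ?V = "\<lambda>i \<omega>. min (Y i \<omega>) x / x"
  let ?u = "\<lambda>\<omega>. (\<Sum>i\<in>I. g i) powr (r - 1) * (\<Sum>i\<in>I. g i powr (1 - r) * ?V i \<omega> powr r)"
  have x0: "0 < x" using x D_pos by linarith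
  have V: "0 \<le> ?V i \<omega>" "?V i \<omega> \<le> 1" if "\<omega> \<in> space M" for i \<omega>
    using x0 Y_nonneg[OF that, of i] by auto
  have int: "integrable M (\<lambda>\<omega>. ?V i \<omega> powr r)" for i
  proof (rule integrable_const_bound[of _ 1])
    show "AE \<omega> in M. norm (?V i \<omega> powr r) \<le> 1"
    proof (rule AE_I2)
      fix \<omega> assume "\<omega> \<in> space M"
      then have "?V i \<omega> powr r \<le> 1 powr r" using V[of \<omega> i] exponents by (intro powr_mono2) auto
      then show "norm (?V i \<omega> powr r) \<le> 1" by simp
    qed
  qed measurable
  have "prob {\<omega>\<in>space M. x < (\<Sum>i\<in>I. Y i \<omega>)} \<le> prob {\<omega>\<in>space M. ?u \<omega> \<ge> 1}"
  proof (rule finite_measure_mono)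
    show "{\<omega>\<in>space M. x < (\<Sum>i\<in>I. Y i \<omega>)} \<subseteq> {\<omega>\<in>space M. ?u \<omega> \<ge> 1}"
    proof safe
      fix \<omega> assume \<omega>: "\<omega> \<in> space M" "x < (\<Sum>i\<in>I. Y i \<omega>)"
      have "1 \<le> (\<Sum>i\<in>I. ?V i \<omega>)"
      \<comment> \<open>Truncation loses nothing here: one term above \<open>x\<close> already
        contributes 1, and otherwise no term is truncated.\<close>
      proof (cases "\<exists>i\<in>I. x < Y i \<omega>")
        case True
        then obtain j where j: "j \<in> I" "x < Y j \<omega>" by auto
        then have "?V j \<omega> = 1" using x0 by simp
        then show ?thesis using member_le_sum[OF j(1) _ I, of "\<lambda>i. ?V i \<omega>"] V[OF \<omega>(1)] by simp
      next
        case False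
        then have "(\<Sum>i\<in>I. ?V i \<omega>) = (\<Sum>i\<in>I. Y i \<omega> / x)" by (intro sum.cong) auto
        also have "\<dots> = (\<Sum>i\<in>I. Y i \<omega>) / x" by (rule sum_divide_distrib[symmetric])
        finally show ?thesis using \<omega>(2) x0 by simp
      qed
      then have "1 powr r \<le> (\<Sum>i\<in>I. ?V i \<omega>) powr r" using exponents by (intro powr_mono2) auto
      also have "\<dots> \<le> ?u \<omega>"
        using V[OF \<omega>(1)] g exponents I by (intro weighted_powr_sum_le) auto
      finally show "1 \<le> ?u \<omega>" by simp
    qed
  qed measurable
  also have "\<dots> \<le> expectation ?u / 1"
  proof (rule integral_Markov_inequality_measure)
    show "integrable M ?u" using int by (intro integrable_mult_right integrable_sum) auto
    show "AE \<omega> in M. 0 \<le> ?u \<omega>"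
      by (intro AE_I2 mult_nonneg_nonneg sum_nonneg) auto
  qed (auto intro: sets.top)
  also have "expectation ?u / 1 = (\<Sum>i\<in>I. g i) powr (r - 1) *
      (\<Sum>i\<in>I. g i powr (1 - r) * expectation (\<lambda>\<omega>. ?V i \<omega> powr r))"
    using int by (subst div_by_1, subst integral_mult_right_zero, subst Bochner_Integration.integral_sum) auto
  also have "\<dots> \<le> (\<Sum>i\<in>I. g i) powr (r - 1) * (\<Sum>i\<in>I. g i powr (1 - r) * (K * T x * m i))"
    by (intro mult_left_mono sum_mono truncated_moment[OF x]) auto
  also have "(\<Sum>i\<in>I. g i powr (1 - r) * (K * T x * m i)) = K * T x * (\<Sum>i\<in>I. g i)"
    unfolding sum_distrib_left
  proof (intro sum.cong refl)
    fix i
    have "g i powr (1 - r) * m i = g i powr (1 - r) * g i powr r" by (simp only: gr)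
    also have "\<dots> = g i" using g[of i] by (simp flip: powr_add)
    finally show "g i powr (1 - r) * (K * T x * m i) = K * T x * g i" by simp
  qed
  also have "(\<Sum>i\<in>I. g i) powr (r - 1) * (K * T x * (\<Sum>i\<in>I. g i)) = K * T x * (\<Sum>i\<in>I. g i) powr r"
  proof -
    have "0 \<le> (\<Sum>i\<in>I. g i)" by (intro sum_nonneg less_imp_le g)
    then have "(\<Sum>i\<in>I. g i) powr r = (\<Sum>i\<in>I. g i) powr (r - 1) * (\<Sum>i\<in>I. g i)"
      using powr_add[of "\<Sum>i\<in>I. g i" "r - 1" 1] by simp
    then show ?thesis by simp
  qed
  finally show ?thesis by (simp add: g_def)
qed

section \<open>The series of marginal tails, compared with maximum and partial sums\<close>

lemma a_nonneg: "0 \<le> a i x"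
  by (simp add: a_def)

lemma a_le: "D \<le> x \<Longrightarrow> a i x \<le> C * T x * m i"
  using Potter[of x 1 i] by (simp add: a_def)

text \<open>Eventually \<open>m i powr (1 / r)\<close> is below 1, and raising it to the power
  \<open>r \<ge> 1\<close> makes it no larger.\<close>

lemma summable_m: "summable m"
proof (rule summable_comparison_test_ev[OF _ m_summable])
  have "(\<lambda>i. m i powr (1 / r)) \<longlonglongrightarrow> 0" by (rule summable_LIMSEQ_zero[OF m_summable])
  then have "\<forall>\<^sub>F i in sequentially. m i powr (1 / r) < 1" by (rule order_tendstoD) simp
  then show "\<forall>\<^sub>F i in sequentially. norm (m i) \<le> m i powr (1 / r)"
  proof eventually_elim
    case (elim i)
    have mi: "0 < m i" by (rule m_pos)
    have "(m i powr (1 / r)) powr r \<le> (m i powr (1 / r)) powr 1"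
      using elim mi exponents by (intro powr_mono') auto
    then show ?case using mi exponents by (simp add: powr_powr)
  qed
qed

lemma summable_a: "D \<le> x \<Longrightarrow> summable (\<lambda>i. a i x)"
  by (rule summable_comparison_test'[of "\<lambda>i. C * T x * m i" 0])
    (use a_le a_nonneg in \<open>auto intro!: summable_mult summable_m\<close>)

definition S :: "real \<Rightarrow> real" where
  "S x = (\<Sum>i. a i x)"

lemma sum_a_le_S: "D \<le> x \<Longrightarrow> (\<Sum>i<n. a i x) \<le> S x"
  unfolding S_def by (rule sum_le_suminf) (auto intro: summable_a a_nonneg)

lemma eventually_le_S: "\<forall>\<^sub>F x in at_top. c0 * T x \<le> S x"
  using first_term eventually_ge_at_top[of D]
proof eventually_elim
  case (elim x)
  then show ?case using sum_a_le_S[of x 1] by (simp add: a_def)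
qed

definition pairs :: "nat \<Rightarrow> real \<Rightarrow> real" where
  "pairs n x = (\<Sum>i<n. \<Sum>j<i. prob {\<omega>\<in>space M. x < Y i \<omega> \<and> x < Y j \<omega>})"

lemma eventually_pairs_le:
  assumes c: "0 < c" and e: "0 < e"
  shows "\<forall>\<^sub>F x in at_top. pairs n (c * x) \<le> e * T x"
proof -
  have "((\<lambda>x. \<Sum>i<n. \<Sum>j<i. prob {\<omega>\<in>space M. c * x < Y i \<omega> \<and> c * x < Y j \<omega>} / T x)
      \<longlongrightarrow> (\<Sum>i<n. \<Sum>j<i. 0)) at_top"
    by (intro tendsto_sum joint_negligible c) auto
  then have "((\<lambda>x. pairs n (c * x) / T x) \<longlongrightarrow> 0) at_top"
    by (simp add: pairs_def sum_divide_distrib)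
  from order_tendstoD(2)[OF this e] show ?thesis
  proof eventually_elim
    case (elim x)
    then show ?case using T_pos[of x] by (simp add: pos_divide_less_eq less_imp_le)
  qed
qed

text \<open>The cut \<open>n\<close> is fixed first, by the tail of the convergent series of
  \<open>m\<close>; for this fixed number of events the pair probabilities in Bonferroni's
  inequality are negligible as \<open>x\<close> grows.\<close>

lemma eventually_prob_max_ge:
  assumes e: "0 < e"
  obtains n where "\<forall>\<^sub>F x in at_top. S x - e * T x \<le> prob {\<omega>\<in>space M. \<exists>i<n. x < Y i \<omega>}"
proof -
  have "(\<lambda>n. C * (\<Sum>i. m (i + n))) \<longlonglongrightarrow> C * 0"
    by (intro tendsto_intros suminf_exist_split2 summable_m)
  then have "\<forall>\<^sub>F n in sequentially. C * (\<Sum>i. m (i + n)) < e / 2"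
    using e by (intro order_tendstoD) auto
  then obtain n where n: "C * (\<Sum>i. m (i + n)) < e / 2"
    by (auto simp: eventually_sequentially)
  have "\<forall>\<^sub>F x in at_top. pairs n (1 * x) \<le> e / 2 * T x"
    using e by (intro eventually_pairs_le) auto
  then have "\<forall>\<^sub>F x in at_top. S x - e * T x \<le> prob {\<omega>\<in>space M. \<exists>i<n. x < Y i \<omega>}"
    using eventually_ge_at_top[of D]
  proof eventually_elim
    case (elim x)
    have sm: "summable (\<lambda>i. a (i + n) x)" by (rule summable_ignore_initial_segment[OF summable_a[OF elim(2)]])
    have mm: "summable (\<lambda>i. m (i + n))" by (rule summable_ignore_initial_segment[OF summable_m])
    have "(\<Sum>i. a (i + n) x) \<le> (\<Sum>i. C * T x * m (i + n))"
      by (intro suminf_le a_le[OF elim(2)] sm mm summable_mult)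
    also have "\<dots> = C * (\<Sum>i. m (i + n)) * T x"
      using mm by (subst suminf_mult) auto
    also have "\<dots> \<le> e / 2 * T x" using n T_pos[of x] by (intro mult_right_mono) auto
    finally have "S x \<le> (\<Sum>i<n. a i x) + e / 2 * T x"
      unfolding S_def using suminf_split_initial_segment[OF summable_a[OF elim(2)], of n] by simp
    moreover have "(\<Sum>i<n. a i x) - pairs n x \<le> prob {\<omega>\<in>space M. \<exists>i<n. x < Y i \<omega>}"
    proof -
      let ?E = "\<lambda>i. {\<omega>\<in>space M. x < Y i \<omega>}"
      have "?E i \<inter> ?E j = {\<omega>\<in>space M. x < Y i \<omega> \<and> x < Y j \<omega>}" for i j by auto
      moreover have "(\<Union>i<n. ?E i) = {\<omega>\<in>space M. \<exists>i<n. x < Y i \<omega>}" by auto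
      ultimately show ?thesis
        using prob_union_ge[of ?E n] by (simp add: a_def pairs_def)
    qed
    ultimately show ?case using elim(1) by (simp add: field_simps)
  qed
  then show ?thesis by (rule that)
qed

text \<open>If the sum over \<open>i < n\<close> exceeds \<open>(1 - \<delta>) x\<close> but no summand exceeds \<open>(1 - 2 \<delta>) x\<close>, then
  the largest summand and some other one exceed \<open>\<delta> x / n\<close>.\<close>

lemma prob_finite_sum_le:
  assumes d: "0 < \<delta>" "\<delta> < 1 / 2" and x: "0 < x" and N: "n \<le> N"
  shows "prob {\<omega>\<in>space M. x < (\<Sum>i<N. Y i \<omega>)} \<le> (\<Sum>i<n. a i ((1 - 2 * \<delta>) * x)) +
    pairs n (\<delta> / Suc n * x) + prob {\<omega>\<in>space M. \<delta> * x < (\<Sum>i\<in>{n..<N}. Y i \<omega>)}"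
proof -
  \<comment> \<open>\<open>Suc n\<close> keeps this level positive for \<open>n = 0\<close> too, and
    \<open>n\<close> copies of it stay strictly below \<open>\<delta> * x\<close>.\<close>
  let ?c = "\<delta> / Suc n * x"
  let ?A = "\<lambda>i. {\<omega>\<in>space M. (1 - 2 * \<delta>) * x < Y i \<omega>}"
  let ?B = "\<lambda>i j. {\<omega>\<in>space M. ?c < Y i \<omega> \<and> ?c < Y j \<omega>}"
  let ?R = "{\<omega>\<in>space M. \<delta> * x < (\<Sum>i\<in>{n..<N}. Y i \<omega>)}"
  have c: "0 < ?c" "n * ?c < \<delta> * x" using d x by (auto simp: field_simps)
  have "{\<omega>\<in>space M. x < (\<Sum>i<N. Y i \<omega>)} \<subseteq> (\<Union>i<n. ?A i) \<union> (\<Union>i<n. \<Union>j<i. ?B i j) \<union> ?R"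
  proof (rule subsetI, rule ccontr)
    fix \<omega> assume "\<omega> \<in> {\<omega>\<in>space M. x < (\<Sum>i<N. Y i \<omega>)}"
      and *: "\<omega> \<notin> (\<Union>i<n. ?A i) \<union> (\<Union>i<n. \<Union>j<i. ?B i j) \<union> ?R"
    then have \<omega>: "\<omega> \<in> space M" "x < (\<Sum>i<N. Y i \<omega>)" by auto
    have A: "Y i \<omega> \<le> (1 - 2 * \<delta>) * x" if "i < n" for i using * \<omega> that by (auto simp: not_less)
    have B': "Y i \<omega> \<le> ?c \<or> Y j \<omega> \<le> ?c" if "i < n" "j < i" for i j
      using * \<omega> that by (auto simp: not_less)
    have B: "Y i \<omega> \<le> ?c \<or> Y j \<omega> \<le> ?c" if "i < n" "j < n" "i \<noteq> j" for i j
      using B'[of i j] B'[of j i] that by linarith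
    have R: "(\<Sum>i\<in>{n..<N}. Y i \<omega>) \<le> \<delta> * x" using * \<omega> by (auto simp: not_less)
    have split: "(\<Sum>i<N. Y i \<omega>) = (\<Sum>i<n. Y i \<omega>) + (\<Sum>i\<in>{n..<N}. Y i \<omega>)"
      using sum.atLeastLessThan_concat[of 0 n N "\<lambda>i. Y i \<omega>"] N by (simp add: lessThan_atLeast0)
    have "(\<Sum>i<n. Y i \<omega>) \<le> (1 - 2 * \<delta>) * x + \<delta> * x"
    proof (cases "\<exists>i<n. ?c < Y i \<omega>")
      case True
      then obtain i where i: "i < n" "?c < Y i \<omega>" by auto
      have "(\<Sum>j<n. Y j \<omega>) = Y i \<omega> + (\<Sum>j\<in>{..<n} - {i}. Y j \<omega>)"
        using i by (subst sum.remove[of _ i]) auto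
      also have "(\<Sum>j\<in>{..<n} - {i}. Y j \<omega>) \<le> (\<Sum>j\<in>{..<n} - {i}. ?c)"
        using B[of i] i by (intro sum_mono) force
      also have "\<dots> \<le> n * ?c" using i c(1) mult_right_mono[of "real n - 1" "real n" ?c] by simp
      finally show ?thesis using A[OF i(1)] c(2) by linarith
    next
      case False
      then have "(\<Sum>i<n. Y i \<omega>) \<le> (\<Sum>i<n. ?c)" by (intro sum_mono) (meson lessThan_iff not_less)
      then have "(\<Sum>i<n. Y i \<omega>) \<le> \<delta> * x" using c(2) by simp
      moreover have "0 \<le> (1 - 2 * \<delta>) * x" using d x by simp
      ultimately show ?thesis by linarith
    qed
    then show False using R split \<omega>(2) by (simp add: algebra_simps)
  qed
  then have "prob {\<omega>\<in>space M. x < (\<Sum>i<N. Y i \<omega>)} \<le>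
      prob ((\<Union>i<n. ?A i) \<union> (\<Union>i<n. \<Union>j<i. ?B i j) \<union> ?R)"
    by (rule finite_measure_mono) measurable
  also have "\<dots> \<le> prob (\<Union>i<n. ?A i) + prob (\<Union>i<n. \<Union>j<i. ?B i j) + prob ?R"
    by (intro order_trans[OF measure_Un_le] add_right_mono measure_Un_le) measurable
  also have "prob (\<Union>i<n. ?A i) \<le> (\<Sum>i<n. prob (?A i))"
    by (rule finite_measure_subadditive_finite) auto
  also have "prob (\<Union>i<n. \<Union>j<i. ?B i j) \<le> (\<Sum>i<n. prob (\<Union>j<i. ?B i j))"
    by (rule finite_measure_subadditive_finite) auto
  also have "\<dots> \<le> (\<Sum>i<n. \<Sum>j<i. prob (?B i j))"
    by (intro sum_mono finite_measure_subadditive_finite) auto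
  finally show ?thesis by (simp add: a_def pairs_def)
qed

text \<open>The quantifier over \<open>N\<close> stands inside \<open>eventually\<close>: the
  threshold for \<open>x\<close> must not depend on the number of terms, because \<open>N\<close>
  tends to infinity at fixed \<open>x\<close>.\<close>

lemma eventually_prob_sums_le:
  assumes e: "0 < e"
  shows "\<forall>\<^sub>F x in at_top. \<forall>N. prob {\<omega>\<in>space M. x < (\<Sum>i<N. Y i \<omega>)} \<le> (1 + e) * S x + e * T x"
proof -
  obtain b where b: "0 < b" "b < 1"
    "\<And>i \<kappa>. \<kappa> > 0 \<Longrightarrow> \<forall>\<^sub>F x in at_top. a i (b * x) \<le> (1 + e) * a i x + \<kappa> * T x"
    using consistent[OF e] by (auto simp: a_def)
  \<comment> \<open>Makes \<open>1 - 2 * \<delta>\<close> the factor \<open>b\<close> of consistent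
    variation.\<close>
  define \<delta> where "\<delta> = (1 - b) / 2"
  have d: "0 < \<delta>" "\<delta> < 1 / 2" "1 - 2 * \<delta> = b" using b by (auto simp: \<delta>_def field_simps)
  have ms: "summable (\<lambda>i. m (i + n) powr (1 / r))" for n
    by (rule summable_ignore_initial_segment[OF m_summable])
  \<comment> \<open>The coefficient with which \<open>prob_sum_le\<close> bounds the terms from
    \<open>n\<close> on at level \<open>\<delta> * x\<close>; the factor
    \<open>C * \<delta> powr - q\<close> is the price of \<open>T_scale\<close> for returning to
    \<open>T x\<close>.\<close>
  have "(\<lambda>n. K * C * \<delta> powr - q * (\<Sum>i. m (i + n) powr (1 / r)) powr r) \<longlonglongrightarrow>
      K * C * \<delta> powr - q * 0 powr r"
    by (rule tendsto_mult[OF tendsto_const],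
        rule tendsto_powr'[OF suminf_exist_split2[OF m_summable] tendsto_const])
      (use exponents in \<open>auto intro!: always_eventually suminf_nonneg ms\<close>)
  then have "\<forall>\<^sub>F n in sequentially. K * C * \<delta> powr - q * (\<Sum>i. m (i + n) powr (1 / r)) powr r < e / 3"
    using e exponents by (intro order_tendstoD) auto
  then obtain n where n: "K * C * \<delta> powr - q * (\<Sum>i. m (i + n) powr (1 / r)) powr r < e / 3"
    by (auto simp: eventually_sequentially)
  \<comment> \<open>The \<open>n\<close> errors of this size add up to at most
    \<open>e / 3 * T x\<close>.\<close>
  have "\<forall>\<^sub>F x in at_top. \<forall>i\<in>{..<n}. a i (b * x) \<le> (1 + e) * a i x + e / (3 * Suc n) * T x"
    using e by (intro eventually_ball_finite ballI b(3)) auto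
  moreover have "\<forall>\<^sub>F x in at_top. pairs n (\<delta> / Suc n * x) \<le> e / 3 * T x"
    using e d by (intro eventually_pairs_le) auto
  ultimately show ?thesis
    using eventually_ge_at_top[of D] eventually_ge_at_top[of "D / \<delta>"]
  proof eventually_elim
    case (elim x)
    have x0: "0 < x" using elim D_pos by linarith
    have dx: "D \<le> \<delta> * x" using elim(4) d(1) by (simp add: field_simps)
    have Tx: "0 < T x" by (rule T_pos)
    have "(\<Sum>i<n. a i (b * x)) \<le> (\<Sum>i<n. (1 + e) * a i x + e / (3 * Suc n) * T x)"
      using elim(1) by (intro sum_mono) auto
    also have "\<dots> = (1 + e) * (\<Sum>i<n. a i x) + n * (e / (3 * Suc n)) * T x"
      by (simp add: sum.distrib sum_distrib_left)
    also have "\<dots> \<le> (1 + e) * S x + e / 3 * T x"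
      using e Tx sum_a_le_S[OF elim(3)]
      by (intro add_mono mult_left_mono mult_right_mono) (auto simp: field_simps)
    finally have 1: "(\<Sum>i<n. a i (b * x)) \<le> (1 + e) * S x + e / 3 * T x" .
    have tail: "prob {\<omega>\<in>space M. \<delta> * x < (\<Sum>i\<in>{n..<N}. Y i \<omega>)} \<le> e / 3 * T x" for N
    proof -
      have "(\<Sum>i\<in>{n..<N}. m i powr (1 / r)) = (\<Sum>i<N - n. m (i + n) powr (1 / r))"
        by (rule sum.reindex_bij_witness[of _ "\<lambda>i. i + n" "\<lambda>i. i - n"]) auto
      also have "\<dots> \<le> (\<Sum>i. m (i + n) powr (1 / r))"
        by (intro sum_le_suminf ms) auto
      finally have "(\<Sum>i\<in>{n..<N}. m i powr (1 / r)) powr r \<le> (\<Sum>i. m (i + n) powr (1 / r)) powr r"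
        using exponents by (intro powr_mono2 sum_nonneg) auto
      moreover have "T (\<delta> * x) \<le> C * T x * \<delta> powr - q" using d elim(3) by (intro T_scale) auto
      ultimately have "K * T (\<delta> * x) * (\<Sum>i\<in>{n..<N}. m i powr (1 / r)) powr r \<le>
          K * (C * T x * \<delta> powr - q) * (\<Sum>i. m (i + n) powr (1 / r)) powr r"
        using K_pos T_pos[of "\<delta> * x"] T_pos[of x] C_pos by (intro mult_mono) auto
      also have "\<dots> = K * C * \<delta> powr - q * (\<Sum>i. m (i + n) powr (1 / r)) powr r * T x" by simp
      also have "\<dots> \<le> e / 3 * T x" using n Tx by (intro mult_right_mono) auto
      finally show ?thesis using prob_sum_le[of "{n..<N}" "\<delta> * x"] dx by simp
    qed
    show ?case
    proof
      fix N
      \<comment> \<open>\<open>prob_finite_sum_le\<close> needs at least \<open>n\<close> terms;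
        shorter sums are covered by monotonicity.\<close>
      have mono: "prob {\<omega>\<in>space M. x < (\<Sum>i<N. Y i \<omega>)} \<le> prob {\<omega>\<in>space M. x < (\<Sum>i<max n N. Y i \<omega>)}"
      proof (rule finite_measure_mono)
        show "{\<omega>\<in>space M. x < (\<Sum>i<N. Y i \<omega>)} \<subseteq> {\<omega>\<in>space M. x < (\<Sum>i<max n N. Y i \<omega>)}"
        proof safe
          fix \<omega> assume \<omega>: "\<omega> \<in> space M" "x < (\<Sum>i<N. Y i \<omega>)"
          note this(2)
          also have "(\<Sum>i<N. Y i \<omega>) \<le> (\<Sum>i<max n N. Y i \<omega>)"
            using Y_nonneg[OF \<omega>(1)] by (intro sum_mono2) auto
          finally show "x < (\<Sum>i<max n N. Y i \<omega>)" .
        qed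
      qed measurable
      have "prob {\<omega>\<in>space M. x < (\<Sum>i<max n N. Y i \<omega>)} \<le>
          ((1 + e) * S x + e / 3 * T x) + e / 3 * T x + e / 3 * T x"
        using prob_finite_sum_le[OF d(1,2) x0, of n "max n N"] 1 elim(2) tail[of "max n N"]
        unfolding d(3) by simp
      with mono show "prob {\<omega>\<in>space M. x < (\<Sum>i<N. Y i \<omega>)} \<le> (1 + e) * S x + e * T x"
        by simp
    qed
  qed
qed

text \<open>\<open>upper\<close> asks for a bound common to all partial sums because the event
  behind \<open>p\<close> is covered only by the union over all of them.\<close>

lemma ruin_asymptotics:
  assumes lower: "\<And>x n. 0 < x \<Longrightarrow> prob {\<omega>\<in>space M. \<exists>i<n. x < Y i \<omega>} \<le> p x"
    and upper: "\<And>x B. 0 < x \<Longrightarrow> (\<And>N. prob {\<omega>\<in>space M. x < (\<Sum>i<N. Y i \<omega>)} \<le> B) \<Longrightarrow> p x \<le> B"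
  shows "((\<lambda>x. p x / S x) \<longlongrightarrow> 1) at_top"
proof (rule tendstoI)
  fix d :: real assume d: "0 < d"
  \<comment> \<open>With \<open>T x \<le> S x / c0\<close> the total error is at most
    \<open>e * (1 + 1 / c0) * S x\<close>, that is \<open>d / 2 * S x\<close>.\<close>
  define e where "e = d / (2 * (1 + 1 / c0))"
  have e: "0 < e" using d c0_pos by (simp add: e_def add_pos_pos)
  have ed: "e * (1 + 1 / c0) < d" using d c0_pos by (simp add: e_def field_simps add_pos_pos)
  obtain n where n: "\<forall>\<^sub>F x in at_top. S x - e * T x \<le> prob {\<omega>\<in>space M. \<exists>i<n. x < Y i \<omega>}"
    using eventually_prob_max_ge[OF e] .
  show "\<forall>\<^sub>F x in at_top. dist (p x / S x) 1 < d"
    using n eventually_prob_sums_le[OF e] eventually_le_S eventually_gt_at_top[of 0]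
  proof eventually_elim
    case (elim x)
    have T: "T x \<le> S x / c0" using elim(3) c0_pos by (simp add: field_simps)
    have S: "0 < S x" using elim(3) T_pos[of x] c0_pos by (meson less_le_trans mult_pos_pos)
    have "S x - e * T x \<le> p x" using elim(1) lower[OF elim(4), of n] by linarith
    moreover have "p x \<le> (1 + e) * S x + e * T x" using elim(2) by (intro upper elim(4)) auto
    moreover have "0 \<le> e * S x" using e S by simp
    ultimately have "\<bar>p x - S x\<bar> \<le> e * S x + e * T x"
      by (simp add: abs_le_iff algebra_simps)
    also have "\<dots> \<le> e * S x + e * (S x / c0)" using e T by (intro add_left_mono mult_left_mono) auto
    also have "\<dots> = e * (1 + 1 / c0) * S x" by (simp add: algebra_simps)
    also have "\<dots> < d * S x" using ed S by (intro mult_strict_right_mono) auto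
    finally have "\<bar>p x - S x\<bar> / S x < d" using S by (simp add: pos_divide_less_eq)
    moreover have "p x / S x - 1 = (p x - S x) / S x" using S by (simp add: field_simps)
    ultimately show ?case using S by (simp add: dist_real_def abs_divide)
  qed
qed

end

section \<open>Reduction to one dimension\<close>

lemma measurable_of_subalgebra:
  "f \<in> measurable P N \<Longrightarrow> sets P \<subseteq> sets M \<Longrightarrow> space P = space M \<Longrightarrow> f \<in> measurable M N"
  unfolding measurable_def by auto

text \<open>Separates the scale \<open>u\<close> from the discount \<open>t\<close>, so that
  expectations are taken of a factor free of \<open>u\<close>. An intermediate power of
  \<open>t\<close> is at most the sum of the outer two, and \<open>u \<le> 1\<close> makes
  \<open>u powr - q\<close> the larger scale factor.\<close>

lemma scaled_powr_le:
  fixes t u :: real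
  assumes "0 < t" "0 < u" "u \<le> 1" "0 < p" "p < q" "q \<le> p'"
  shows "max ((t / u) powr p) ((t / u) powr q) \<le> u powr - q * (t powr p + t powr p')"
proof -
  have "t powr q \<le> t powr p + t powr p'"
  proof (cases "t \<le> 1")
    case True
    then have "t powr q \<le> t powr p" using assms by (intro powr_mono') auto
    then show ?thesis using powr_ge_zero[of t p'] by linarith
  next
    case False
    then have "t powr q \<le> t powr p'" using assms by (intro powr_mono) auto
    then show ?thesis using powr_ge_zero[of t p] by linarith
  qed
  then have 1: "u powr - q * t powr q \<le> u powr - q * (t powr p + t powr p')"
    by (intro mult_left_mono) auto
  have "u powr - p \<le> u powr - q" using assms by (intro powr_mono') auto
  then have 2: "u powr - p * t powr p \<le> u powr - q * (t powr p + t powr p')"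
    by (intro mult_mono) auto
  show ?thesis using 1 2 assms by (simp add: powr_divide powr_minus field_simps)
qed

locale reduced_model = risk_model M F X \<theta> \<xi>
  for M :: "'a measure" and F :: "(real ^ 'd) measure" and X :: "nat \<Rightarrow> 'a \<Rightarrow> real ^ 'd"
    and \<theta> :: "nat \<Rightarrow> 'a \<Rightarrow> real" and \<xi> :: "real \<Rightarrow> 'a \<Rightarrow> real" +
  fixes A :: "(real ^ 'd) set"
  assumes ruin_set: "A \<in> ruin_sets"
    and independence: "independent_sources M X \<theta> \<xi>"
    and QAI_claims: "QAI_on A M {1..} X"
    and consistently_varying: "consistently_varying (reduced_distribution A F)"
begin

abbreviation T :: "real \<Rightarrow> real" where
  "T \<equiv> tail (reduced_distribution A F)"

text \<open>Clipping at 0 changes the claims on a null set only and makes all later inclusions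
  hold pointwise. The index is shifted to start at 0.\<close>

definition V :: "nat \<Rightarrow> 'a \<Rightarrow> real ^ 'd" where
  "V i \<omega> = (\<chi> k. max 0 (X (Suc i) \<omega> $ k))"

definition Z :: "nat \<Rightarrow> 'a \<Rightarrow> real" where
  "Z i \<omega> = reduction A (V i \<omega>)"

definition Y :: "nat \<Rightarrow> 'a \<Rightarrow> real" where
  "Y i \<omega> = Z i \<omega> * \<Theta> i \<omega>"

lemma unbounded: "unbounded_nonneg_distribution (reduced_distribution A F)"
  using consistently_varying by (simp add: consistently_varying_def)

lemmas T_pos = tail_pos[OF unbounded]

lemma T_antimono: "antimono T"
  using unbounded tail_antimono unfolding unbounded_nonneg_distribution_def by blast

lemma T_measurable [measurable]: "T \<in> borel_measurable borel"
proof -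
  have "mono (\<lambda>x. - T x)" using T_antimono by (auto simp: mono_def antimono_def)
  then have "(\<lambda>x. - (- T x)) \<in> borel_measurable borel"
    by (intro borel_measurable_uminus borel_measurable_mono)
  then show ?thesis by simp
qed

lemma V_nonneg: "0 \<le> V i \<omega> $ k"
  by (simp add: V_def)

lemma Z_nonneg: "0 \<le> Z i \<omega>"
  unfolding Z_def by (rule reduction_nonneg[OF ruin_set V_nonneg])

lemma source_events:
  "sets claim_source \<subseteq> events" "sets discount_source \<subseteq> events"
  "sets count_source \<subseteq> events" "sets return_source \<subseteq> events"
  using indep_claim_discount[OF independence] indep_return_count[OF independence]
  by (auto dest: indep_setD_ev1 indep_setD_ev2)

lemma clip_measurable: "(\<lambda>x::real ^ 'd. \<chi> k. max 0 (x $ k)) \<in> borel_measurable borel"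
  by (intro borel_measurable_continuous_onI continuous_intros)

lemma Z_claim_measurable: "Z i \<in> borel_measurable claim_source"
proof -
  have "X (Suc i) \<in> borel_measurable claim_source" by (intro measurable_source) auto
  from measurable_compose[OF measurable_compose[OF this clip_measurable] borel_measurable_reduction[OF ruin_set]]
  show ?thesis by (simp add: Z_def[abs_def] V_def)
qed

lemma Z_measurable [measurable]: "random_variable borel (Z i)"
  by (rule measurable_of_subalgebra[OF Z_claim_measurable source_events(1)]) simp

lemma \<Theta>_rv [measurable]: "random_variable borel (\<Theta> i)"
  by (rule measurable_of_subalgebra[OF \<Theta>_measurable source_events(2)]) simp

lemma Y_measurable [measurable]: "random_variable borel (Y i)"
  unfolding Y_def[abs_def] by measurable

lemma X_measurable [measurable]: "random_variable borel (X (Suc i))"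
  by (rule claim_measurable) simp

lemma V_measurable [measurable]: "random_variable borel (V i)"
proof -
  from measurable_compose[OF X_measurable clip_measurable] show ?thesis by (simp add: V_def[abs_def])
qed

lemma reduction_measurable [measurable]: "reduction A \<in> borel_measurable borel"
  by (rule borel_measurable_reduction[OF ruin_set])

lemma AE_V_eq: "AE \<omega> in M. V i \<omega> = X (Suc i) \<omega>"
proof -
  have "AE z in distr M borel (X (Suc i)). (\<forall>k. 0 \<le> z $ k) \<and> z \<noteq> 0"
  proof -
    have "distr M borel (X (Suc i)) = F" by (rule claim_distribution) simp
    then show ?thesis by (simp only: claim_support)
  qed
  then have "AE \<omega> in M. (\<forall>k. 0 \<le> X (Suc i) \<omega> $ k) \<and> X (Suc i) \<omega> \<noteq> 0"
    by (rule AE_distrD[rotated]) measurable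
  then show ?thesis by eventually_elim (simp add: V_def vec_eq_iff)
qed

lemma prob_reduction_claim: "prob {\<omega>\<in>space M. y < reduction A (X (Suc i) \<omega>)} = T y"
proof -
  have "reduced_distribution A F = distr M borel (\<lambda>\<omega>. reduction A (X (Suc i) \<omega>))"
    unfolding reduced_distribution_def claim_distribution[of "Suc i", symmetric, simplified]
    by (subst distr_distr) (auto simp: comp_def)
  then show ?thesis
    unfolding tail_def by (simp add: measure_distr vimage_def Int_def conj_commute)
qed

lemma prob_Z: "prob {\<omega>\<in>space M. y < Z i \<omega>} = T y"
proof -
  have "prob {\<omega>\<in>space M. y < Z i \<omega>} = prob {\<omega>\<in>space M. y < reduction A (X (Suc i) \<omega>)}"
    using AE_V_eq[of i] by (intro finite_measure_eq_AE) (auto simp: Z_def)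
  then show ?thesis by (simp add: prob_reduction_claim)
qed

text \<open>All reduced claims share the tail \<open>T\<close>, so the denominator in
  \<open>QAI\<close> is \<open>2 * T x\<close>.\<close>

lemma joint_Z_tendsto:
  assumes "i \<noteq> j"
  shows "((\<lambda>x. prob {\<omega>\<in>space M. x < Z i \<omega> \<and> x < Z j \<omega>} / T x) \<longlongrightarrow> 0) at_top"
proof -
  let ?J = "\<lambda>x. prob {\<omega>\<in>space M. x < reduction A (X (Suc i) \<omega>) \<and> x < reduction A (X (Suc j) \<omega>)}"
  have "((\<lambda>x. ?J x / (T x + T x)) \<longlongrightarrow> 0) at_top"
    using QAI_claims[unfolded QAI_on_def QAI_def, rule_format, of "Suc i" "Suc j"] assms
    by (simp add: prob_reduction_claim)
  then have "((\<lambda>x. 2 * (?J x / (T x + T x))) \<longlongrightarrow> 2 * 0) at_top" by (intro tendsto_intros)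
  moreover have "?J x = prob {\<omega>\<in>space M. x < Z i \<omega> \<and> x < Z j \<omega>}" for x
    using AE_V_eq[of i] AE_V_eq[of j] by (intro finite_measure_eq_AE) (auto simp: Z_def)
  ultimately show ?thesis by (simp flip: mult_2)
qed

text \<open>Independence integrates out the claim for a given discount. \<open>W\<close> covers both
  a fixed time and a random arrival; \<open>B\<close> serves to cut off large discounts.\<close>

lemma emeasure_product_tail:
  assumes W: "W \<in> borel_measurable discount_source" and W_pos: "\<And>\<omega>. \<omega> \<in> space M \<Longrightarrow> 0 < W \<omega>"
    and [measurable]: "B \<in> sets borel"
  shows "emeasure M {\<omega>\<in>space M. x < Z i \<omega> * W \<omega> \<and> W \<omega> \<in> B} =
    (\<integral>\<^sup>+\<omega>. ennreal (T (x / W \<omega>)) * indicator B (W \<omega>) \<partial>M)"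
proof -
  have [measurable]: "random_variable borel W"
    by (rule measurable_of_subalgebra[OF W source_events(2)]) simp
  let ?f = "\<lambda>(z::real, w). indicator {p. x < fst p * snd p \<and> snd p \<in> B} (z, w) :: ennreal"
  have f: "?f \<in> borel_measurable (borel \<Otimes>\<^sub>M borel)"
    by measurable
  have "emeasure M {\<omega>\<in>space M. x < Z i \<omega> * W \<omega> \<and> W \<omega> \<in> B} = (\<integral>\<^sup>+\<omega>. ?f (Z i \<omega>, W \<omega>) \<partial>M)"
  proof -
    have "emeasure M {\<omega>\<in>space M. x < Z i \<omega> * W \<omega> \<and> W \<omega> \<in> B} =
        (\<integral>\<^sup>+\<omega>. indicator {\<omega>\<in>space M. x < Z i \<omega> * W \<omega> \<and> W \<omega> \<in> B} \<omega> \<partial>M)"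
      by (rule nn_integral_indicator[symmetric]) measurable
    also have "\<dots> = (\<integral>\<^sup>+\<omega>. ?f (Z i \<omega>, W \<omega>) \<partial>M)"
      by (intro nn_integral_cong) (simp add: indicator_def)
    finally show ?thesis .
  qed
  also have "\<dots> = (\<integral>\<^sup>+\<omega>. \<integral>\<^sup>+\<omega>'. ?f (Z i \<omega>', W \<omega>) \<partial>M \<partial>M)"
    by (rule nn_integral_indep[OF indep_claim_discount[OF independence] _ _ Z_claim_measurable W f])
      simp_all
  also have "\<dots> = (\<integral>\<^sup>+\<omega>. ennreal (T (x / W \<omega>)) * indicator B (W \<omega>) \<partial>M)"
  proof (rule nn_integral_cong)
    fix \<omega> assume \<omega>: "\<omega> \<in> space M"
    have "(\<integral>\<^sup>+\<omega>'. ?f (Z i \<omega>', W \<omega>) \<partial>M) =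
        (\<integral>\<^sup>+\<omega>'. indicator {\<omega>'\<in>space M. x / W \<omega> < Z i \<omega>'} \<omega>' * indicator B (W \<omega>) \<partial>M)"
      using W_pos[OF \<omega>] by (intro nn_integral_cong) (auto simp: indicator_def pos_divide_less_eq)
    also have "\<dots> = ennreal (T (x / W \<omega>)) * indicator B (W \<omega>)"
      by (subst nn_integral_multc) (auto simp: emeasure_eq_measure prob_Z)
    finally show "(\<integral>\<^sup>+\<omega>'. ?f (Z i \<omega>', W \<omega>) \<partial>M) = ennreal (T (x / W \<omega>)) * indicator B (W \<omega>)" .
  qed
  finally show ?thesis .
qed

lemma emeasure_Y:
  "B \<in> sets borel \<Longrightarrow> emeasure M {\<omega>\<in>space M. x < Y i \<omega> \<and> \<Theta> i \<omega> \<in> B} =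
    (\<integral>\<^sup>+\<omega>. ennreal (T (x / \<Theta> i \<omega>)) * indicator B (\<Theta> i \<omega>) \<partial>M)"
  unfolding Y_def by (rule emeasure_product_tail[OF \<Theta>_measurable \<Theta>_pos])

text \<open>At a fixed time the inner probability is an expectation of \<open>T\<close>. The renewal
  measure inserts an arrival time from a second sample point, and independence of returns and counts
  merges the two sample points into one.\<close>

lemma integral_renewal_measure_eq:
  assumes x: "0 < x"
  shows "(\<integral>\<^sup>+ s\<in>{0..}. emeasure M {\<omega>\<in>space M. exp (- \<xi> s \<omega>) *\<^sub>R X 1 \<omega> \<in> dilate x A}
      \<partial>renewal_measure M \<theta>) = (\<Sum>i. ennreal (prob {\<omega>\<in>space M. x < Y i \<omega>}))"
proof -
  define h where "h = (\<lambda>(\<omega>, s). ennreal (T (x / exp (- \<xi> (max s 0) \<omega>))))"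
  have [measurable]: "h \<in> borel_measurable (return_source \<Otimes>\<^sub>M borel)"
  proof -
    have [measurable]: "(\<lambda>(\<omega>, t). \<xi> (max t 0) \<omega>) \<in> borel_measurable (return_source \<Otimes>\<^sub>M borel)"
      using measurable_pair_swap[OF returns_jointly_measurable] by simp
    show ?thesis unfolding h_def by measurable
  qed
  have id: "(\<lambda>\<omega>. \<omega>) \<in> measurable M return_source"
    using source_events(4) by (intro measurableI) (auto simp: Int_absorb2 dest: sets.sets_into_space)
  have hM [measurable]: "h \<in> borel_measurable (M \<Otimes>\<^sub>M borel)"
  proof -
    have "(\<lambda>p. (fst p, snd p)) \<in> measurable (M \<Otimes>\<^sub>M (borel :: real measure)) (return_source \<Otimes>\<^sub>M borel)"
      by (intro measurable_Pair measurable_compose[OF measurable_fst id] measurable_snd)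
    from measurable_compose[OF this, of h borel] show ?thesis by simp
  qed
  have g [measurable]: "(\<lambda>s. \<integral>\<^sup>+\<omega>. h (\<omega>, s) \<partial>M) \<in> borel_measurable borel"
    by (rule borel_measurable_nn_integral) (use measurable_pair_swap[OF hM] in \<open>simp add: case_prod_beta'\<close>)
  have inner: "emeasure M {\<omega>\<in>space M. exp (- \<xi> s \<omega>) *\<^sub>R X 1 \<omega> \<in> dilate x A} = (\<integral>\<^sup>+\<omega>. h (\<omega>, s) \<partial>M)"
    if s: "0 \<le> s" for s
  proof -
    have W: "(\<lambda>\<omega>. exp (- \<xi> s \<omega>)) \<in> borel_measurable discount_source"
      using measurable_source[of s "{0..}" M \<xi> borel] s
      by (intro measurable_discount_source(2)) simp
    have [measurable]: "(\<lambda>\<omega>. exp (- \<xi> s \<omega>)) \<in> borel_measurable M"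
      by (rule measurable_of_subalgebra[OF W source_events(2)]) simp
    have "open (dilate x A)" using ruin_set x by (intro open_dilate) (auto simp: ruin_sets_def)
    then have [measurable]: "dilate x A \<in> sets borel" by simp
    have [measurable]: "X 1 \<in> borel_measurable M" by (rule claim_measurable) simp
    have "emeasure M {\<omega>\<in>space M. exp (- \<xi> s \<omega>) *\<^sub>R X 1 \<omega> \<in> dilate x A} =
        emeasure M {\<omega>\<in>space M. x < Z 0 \<omega> * exp (- \<xi> s \<omega>) \<and> exp (- \<xi> s \<omega>) \<in> UNIV}"
    proof (rule emeasure_eq_AE)
      show "AE \<omega> in M. \<omega> \<in> {\<omega>\<in>space M. exp (- \<xi> s \<omega>) *\<^sub>R X 1 \<omega> \<in> dilate x A} \<longleftrightarrow>
          \<omega> \<in> {\<omega>\<in>space M. x < Z 0 \<omega> * exp (- \<xi> s \<omega>) \<and> exp (- \<xi> s \<omega>) \<in> UNIV}"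
        using AE_V_eq[of 0]
      proof eventually_elim
        case (elim \<omega>)
        have "exp (- \<xi> s \<omega>) *\<^sub>R V 0 \<omega> \<in> dilate x A \<longleftrightarrow> x < Z 0 \<omega> * exp (- \<xi> s \<omega>)"
          using less_reduction_iff_dilate[OF ruin_set _ x, of "exp (- \<xi> s \<omega>) *\<^sub>R V 0 \<omega>"]
            reduction_scaleR[OF ruin_set V_nonneg, of "exp (- \<xi> s \<omega>)" 0 \<omega>] V_nonneg[of 0 \<omega>]
          by (simp add: Z_def mult.commute)
        then show ?case using elim by simp
      qed
    qed measurable
    also have "\<dots> = (\<integral>\<^sup>+\<omega>. h (\<omega>, s) \<partial>M)"
      using s by (subst emeasure_product_tail[OF W]) (auto simp: h_def max_absorb1)
    finally show ?thesis .
  qed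
  have "(\<integral>\<^sup>+ s\<in>{0..}. emeasure M {\<omega>\<in>space M. exp (- \<xi> s \<omega>) *\<^sub>R X 1 \<omega> \<in> dilate x A} \<partial>renewal_measure M \<theta>) =
      (\<integral>\<^sup>+ s. (\<integral>\<^sup>+\<omega>. h (\<omega>, s) \<partial>M) * indicator {0..} s \<partial>renewal_measure M \<theta>)"
    by (intro nn_integral_cong) (simp add: indicator_def inner del: One_nat_def)
  also have "\<dots> = (\<Sum>i. \<integral>\<^sup>+\<omega>'. (\<integral>\<^sup>+\<omega>. h (\<omega>, arrival \<theta> (Suc i) \<omega>') \<partial>M) * indicator {0..} (arrival \<theta> (Suc i) \<omega>') \<partial>M)"
    by (rule nn_integral_renewal_measure) measurable
  also have "\<dots> = (\<Sum>i. \<integral>\<^sup>+\<omega>'. (\<integral>\<^sup>+\<omega>. h (\<omega>, arrival \<theta> (Suc i) \<omega>') \<partial>M) \<partial>M)"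
    by (intro suminf_cong nn_integral_cong) (simp add: arrival_nonneg)
  also have "\<dots> = (\<Sum>i. \<integral>\<^sup>+\<omega>. h (\<omega>, arrival \<theta> (Suc i) \<omega>) \<partial>M)"
    by (intro suminf_cong nn_integral_indep[OF indep_return_count[OF independence] _ _
          measurable_ident_sets[OF refl, of return_source] arrival_measurable, of h, symmetric])
      simp_all
  also have "\<dots> = (\<Sum>i. ennreal (prob {\<omega>\<in>space M. x < Y i \<omega>}))"
  proof (intro suminf_cong)
    fix i
    have "(\<integral>\<^sup>+\<omega>. h (\<omega>, arrival \<theta> (Suc i) \<omega>) \<partial>M) = (\<integral>\<^sup>+\<omega>. ennreal (T (x / \<Theta> i \<omega>)) * indicator UNIV (\<Theta> i \<omega>) \<partial>M)"
      by (intro nn_integral_cong) (simp add: h_def \<Theta>_def max_absorb1 arrival_nonneg)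
    also have "\<dots> = emeasure M {\<omega>\<in>space M. x < Y i \<omega> \<and> \<Theta> i \<omega> \<in> UNIV}"
      by (rule emeasure_Y[symmetric]) simp
    finally show "(\<integral>\<^sup>+\<omega>. h (\<omega>, arrival \<theta> (Suc i) \<omega>) \<partial>M) = ennreal (prob {\<omega>\<in>space M. x < Y i \<omega>})"
      by (simp add: emeasure_eq_measure)
  qed
  finally show ?thesis .
qed

section \<open>The discounted sum between the maximum and the sum of the reduced terms\<close>

definition D :: "nat \<Rightarrow> 'a \<Rightarrow> real ^ 'd" where
  "D N \<omega> = (\<Sum>i<N. \<Theta> i \<omega> *\<^sub>R V i \<omega>)"

lemma discounted_claim_nonneg: "0 \<le> \<Theta> i \<omega> * V i \<omega> $ k"
  by (intro mult_nonneg_nonneg less_imp_le[OF \<Theta>_pos] V_nonneg)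

lemma discounted_claims_in_iff:
  assumes x: "0 < x"
  shows "discounted_claims X \<theta> \<xi> \<omega> \<in> upward_extension (dilate x A) \<longleftrightarrow> (\<exists>N. x < reduction A (D N \<omega>))"
proof -
  have ruin: "open A" "increasing_set A" using ruin_set by (auto simp: ruin_sets_def)
  \<comment> \<open>\<open>ennreal\<close> already sends negative components to 0, so clipping the
    claims changes nothing here, at any sample point.\<close>
  have "ennreal (X (Suc i) \<omega> $ k * exp (- \<xi> (arrival \<theta> (Suc i) \<omega>) \<omega>)) =
      ennreal ((\<Theta> i \<omega> *\<^sub>R V i \<omega>) $ k)" for i k
    by (cases "0 \<le> X (Suc i) \<omega> $ k")
      (auto simp: \<Theta>_def V_def max_def mult.commute mult_nonpos_nonneg ennreal_neg)
  then have "discounted_claims X \<theta> \<xi> \<omega> = (\<chi> k. \<Sum>i. ennreal ((\<Theta> i \<omega> *\<^sub>R V i \<omega>) $ k))"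
    unfolding discounted_claims_def by (intro iffD2[OF vec_eq_iff] allI) simp
  also have "\<dots> \<in> upward_extension (dilate x A) \<longleftrightarrow> (\<exists>N. D N \<omega> \<in> dilate x A)"
    unfolding D_def using x ruin
    by (intro mem_upward_extension_suminf open_dilate increasing_dilate)
      (auto simp: discounted_claim_nonneg)
  also have "\<dots> \<longleftrightarrow> (\<exists>N. x < reduction A (D N \<omega>))"
    by (subst less_reduction_iff_dilate[OF ruin_set _ x])
      (auto simp: D_def intro!: sum_nonneg discounted_claim_nonneg)
  finally show ?thesis .
qed

lemma reduction_D_le: "reduction A (D N \<omega>) \<le> (\<Sum>i<N. Y i \<omega>)"
proof -
  have "reduction A (D N \<omega>) \<le> (\<Sum>i<N. reduction A (\<Theta> i \<omega> *\<^sub>R V i \<omega>))"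
    unfolding D_def by (intro reduction_sum_le[OF ruin_set]) (simp add: discounted_claim_nonneg)
  also have "\<dots> = (\<Sum>i<N. Y i \<omega>)"
    using reduction_scaleR[OF ruin_set V_nonneg \<Theta>_pos] by (simp add: Y_def Z_def mult.commute)
  finally show ?thesis .
qed

lemma le_reduction_D:
  assumes "i < N"
  shows "Y i \<omega> \<le> reduction A (D N \<omega>)"
proof -
  have nn: "0 \<le> (\<Theta> i \<omega> *\<^sub>R V i \<omega>) $ k" for i k by (simp add: discounted_claim_nonneg)
  have "reduction A (\<Theta> i \<omega> *\<^sub>R V i \<omega>) \<le> reduction A (D N \<omega>)"
  proof (rule reduction_mono[OF ruin_set nn])
    fix k
    show "(\<Theta> i \<omega> *\<^sub>R V i \<omega>) $ k \<le> D N \<omega> $ k"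
      using member_le_sum[of i "{..<N}" "\<lambda>i. (\<Theta> i \<omega> *\<^sub>R V i \<omega>) $ k"] nn assms
      by (simp add: D_def)
  qed
  then show ?thesis
    using reduction_scaleR[OF ruin_set V_nonneg \<Theta>_pos] by (simp add: Y_def Z_def mult.commute)
qed

definition ruin_prob :: "real \<Rightarrow> real" where
  "ruin_prob x = prob {\<omega>\<in>space M. discounted_claims X \<theta> \<xi> \<omega> \<in> upward_extension (dilate x A)}"

lemma D_measurable [measurable]: "random_variable borel (D N)"
  unfolding D_def[abs_def] by measurable

lemma ruin_prob_lower:
  assumes x: "0 < x"
  shows "prob {\<omega>\<in>space M. \<exists>i<n. x < Y i \<omega>} \<le> ruin_prob x"
  unfolding ruin_prob_def discounted_claims_in_iff[OF x]
proof (rule finite_measure_mono)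
  show "{\<omega>\<in>space M. \<exists>i<n. x < Y i \<omega>} \<subseteq> {\<omega>\<in>space M. \<exists>N. x < reduction A (D N \<omega>)}"
    using le_reduction_D less_le_trans by blast
qed measurable

text \<open>Continuity from below: partial sums are nondecreasing in \<open>N\<close>, so a common
  bound survives the union.\<close>

lemma ruin_prob_upper:
  assumes x: "0 < x" and B: "\<And>N. prob {\<omega>\<in>space M. x < (\<Sum>i<N. Y i \<omega>)} \<le> B"
  shows "ruin_prob x \<le> B"
proof -
  let ?E = "\<lambda>N. {\<omega>\<in>space M. x < (\<Sum>i<N. Y i \<omega>)}"
  have "ruin_prob x \<le> prob (\<Union>N. ?E N)"
    unfolding ruin_prob_def discounted_claims_in_iff[OF x]
  proof (rule finite_measure_mono)
    show "{\<omega>\<in>space M. \<exists>N. x < reduction A (D N \<omega>)} \<subseteq> (\<Union>N. ?E N)"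
      using reduction_D_le less_le_trans by blast
  qed measurable
  also have "\<dots> \<le> B"
  proof (rule LIMSEQ_le_const2)
    show "(\<lambda>N. prob (?E N)) \<longlonglongrightarrow> prob (\<Union>N. ?E N)"
    proof (rule finite_Lim_measure_incseq)
      show "range ?E \<subseteq> events" by auto
      show "incseq ?E"
      proof (rule incseq_SucI)
        fix N
        have "0 \<le> Y N \<omega>" for \<omega> using Z_nonneg \<Theta>_pos[of N \<omega>] by (simp add: Y_def)
        then show "?E N \<subseteq> ?E (Suc N)" by (auto intro: order_less_le_trans)
      qed
    qed
  qed (use B in auto)
  finally show ?thesis .
qed

end

section \<open>Asymptotics of the discounted claims\<close>

text \<open>\<open>q\<close> is the working exponent: \<open>q < r\<close> makes the truncated
  moment finite, and \<open>q \<le> p2\<close> lets the powers \<open>p1\<close> and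
  \<open>p2\<close> of the discount control its power \<open>q\<close>.\<close>

locale discounted_model = reduced_model M F X \<theta> \<xi> A
  for M :: "'a measure" and F :: "(real ^ 'd) measure" and X :: "nat \<Rightarrow> 'a \<Rightarrow> real ^ 'd"
    and \<theta> :: "nat \<Rightarrow> 'a \<Rightarrow> real" and \<xi> :: "real \<Rightarrow> 'a \<Rightarrow> real" and A :: "(real ^ 'd) set" +
  fixes p1 p2 q r C x0 :: real
  assumes exponents: "0 < p1" "p1 < q" "q \<le> p2" "q < r" "1 \<le> r"
    and constants: "0 < C" "0 < x0"
    and Potter: "\<And>x t. x0 \<le> x \<Longrightarrow> 0 < t \<Longrightarrow> T (x / t) \<le> C * T x * max (t powr p1) (t powr q)"
    and integrable_powers: "\<And>i. integrable M (\<lambda>\<omega>. \<Theta> i \<omega> powr p1 + \<Theta> i \<omega> powr p2)"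
    and summable_moments:
      "summable (\<lambda>i. expectation (\<lambda>\<omega>. \<Theta> i \<omega> powr p1 + \<Theta> i \<omega> powr p2) powr (1 / r))"
begin

definition g :: "nat \<Rightarrow> 'a \<Rightarrow> real" where
  "g i \<omega> = \<Theta> i \<omega> powr p1 + \<Theta> i \<omega> powr p2"

definition m :: "nat \<Rightarrow> real" where
  "m i = expectation (g i)"

lemma g_pos: "0 < g i \<omega>"
  using \<Theta>_pos[of i \<omega>] by (simp add: g_def add_pos_pos)

lemma g_integrable: "integrable M (g i)"
  using integrable_powers by (simp add: g_def[abs_def])

lemma g_measurable [measurable]: "random_variable borel (g i)"
  using g_integrable by auto

lemma m_pos: "0 < m i"
proof -
  have "0 \<le> m i" unfolding m_def by (intro Bochner_Integration.integral_nonneg less_imp_le g_pos)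
  moreover have "m i \<noteq> 0"
  proof
    assume "m i = 0"
    then have "AE \<omega> in M. g i \<omega> = 0"
      using integral_nonneg_eq_0_iff_AE[OF g_integrable] g_pos by (simp add: m_def less_imp_le)
    then have "AE \<omega> in M. False" by eventually_elim (use g_pos in \<open>metis less_irrefl\<close>)
    then show False by (simp add: AE_False)
  qed
  ultimately show ?thesis by simp
qed

lemma indicator_integrable:
  "B \<in> sets borel \<Longrightarrow> integrable M (\<lambda>\<omega>. g i \<omega> * indicator B (\<Theta> i \<omega>))"
  by (rule Bochner_Integration.integrable_bound[OF g_integrable[of i]])
    (use g_pos in \<open>auto simp: indicator_def less_imp_le\<close>)

text \<open>The Potter bound at \<open>t = \<Theta> i \<omega> / u\<close>, averaged over the
  discount. \<open>B = UNIV\<close> gives the bound by \<open>m i\<close>; a half-line gives the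
  smallness of the part with large discounts.\<close>

lemma prob_Y_restricted_le:
  assumes x: "x0 \<le> x" and u: "0 < u" "u \<le> 1" and B [measurable]: "B \<in> sets borel"
  shows "prob {\<omega>\<in>space M. u * x < Y i \<omega> \<and> \<Theta> i \<omega> \<in> B} \<le>
    C * T x * u powr - q * expectation (\<lambda>\<omega>. g i \<omega> * indicator B (\<Theta> i \<omega>))"
proof -
  let ?c = "C * T x * u powr - q"
  have c: "0 \<le> ?c" using constants T_pos[of x] by simp
  have "ennreal (prob {\<omega>\<in>space M. u * x < Y i \<omega> \<and> \<Theta> i \<omega> \<in> B}) =
      (\<integral>\<^sup>+\<omega>. ennreal (T (u * x / \<Theta> i \<omega>)) * indicator B (\<Theta> i \<omega>) \<partial>M)"
    using emeasure_Y[OF B] by (simp add: emeasure_eq_measure)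
  also have "\<dots> \<le> (\<integral>\<^sup>+\<omega>. ennreal (?c * (g i \<omega> * indicator B (\<Theta> i \<omega>))) \<partial>M)"
  proof (rule nn_integral_mono)
    fix \<omega>
    have "T (u * x / \<Theta> i \<omega>) \<le> C * T x * max ((\<Theta> i \<omega> / u) powr p1) ((\<Theta> i \<omega> / u) powr q)"
      using Potter[OF x, of "\<Theta> i \<omega> / u"] u \<Theta>_pos[of i \<omega>] by (simp add: mult.commute)
    also have "\<dots> \<le> C * T x * (u powr - q * g i \<omega>)"
      unfolding g_def using constants T_pos[of x] u \<Theta>_pos[of i \<omega>] exponents
      by (intro mult_left_mono scaled_powr_le) auto
    finally show "ennreal (T (u * x / \<Theta> i \<omega>)) * indicator B (\<Theta> i \<omega>) \<le>
        ennreal (?c * (g i \<omega> * indicator B (\<Theta> i \<omega>)))"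
      by (auto simp: indicator_def mult.assoc intro!: ennreal_leI)
  qed
  also have "\<dots> = ennreal (expectation (\<lambda>\<omega>. ?c * (g i \<omega> * indicator B (\<Theta> i \<omega>))))"
    by (intro nn_integral_eq_integral integrable_mult_right indicator_integrable B AE_I2
        mult_nonneg_nonneg[OF c] mult_nonneg_nonneg[OF less_imp_le[OF g_pos]]) simp
  also have "expectation (\<lambda>\<omega>. ?c * (g i \<omega> * indicator B (\<Theta> i \<omega>))) =
      ?c * expectation (\<lambda>\<omega>. g i \<omega> * indicator B (\<Theta> i \<omega>))"
    by (rule integral_mult_right_zero)
  finally show ?thesis
    by (subst (asm) ennreal_le_iff)
      (intro mult_nonneg_nonneg[OF c] Bochner_Integration.integral_nonneg
        mult_nonneg_nonneg[OF less_imp_le[OF g_pos]] indicator_pos_le)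
qed

lemma prob_Y_le:
  assumes "x0 \<le> x" "0 < u" "u \<le> 1"
  shows "prob {\<omega>\<in>space M. u * x < Y i \<omega>} \<le> C * T x * u powr - q * m i"
  using prob_Y_restricted_le[OF assms, of UNIV i] by (simp add: m_def)

lemma T_scale:
  assumes "x0 \<le> x" "0 < u" "u \<le> 1"
  shows "T (u * x) \<le> C * T x * u powr - q"
proof -
  have "T (u * x) \<le> C * T x * max ((1 / u) powr p1) ((1 / u) powr q)"
    using Potter[OF assms(1), of "1 / u"] assms by (simp add: mult.commute)
  also have "max ((1 / u) powr p1) ((1 / u) powr q) = (1 / u) powr q"
    using assms exponents powr_mono[of p1 q "1 / u"] by (simp add: max_def)
  also have "(1 / u) powr q = u powr - q" using assms by (simp add: powr_divide powr_minus field_simps)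
  finally show ?thesis .
qed

text \<open>Dominated convergence with majorant \<open>g i\<close>: at each sample point the
  discount is finite, so the indicator eventually vanishes.\<close>

lemma large_discount_negligible:
  assumes e: "0 < e"
  obtains L where "1 \<le> L" "expectation (\<lambda>\<omega>. g i \<omega> * indicator {L<..} (\<Theta> i \<omega>)) < e"
proof -
  have "(\<lambda>n. expectation (\<lambda>\<omega>. g i \<omega> * indicator {real n<..} (\<Theta> i \<omega>))) \<longlonglongrightarrow> expectation (\<lambda>\<omega>. 0)"
  proof (rule integral_dominated_convergence[where w = "g i"])
    show "AE \<omega> in M. (\<lambda>n. g i \<omega> * indicator {real n<..} (\<Theta> i \<omega>)) \<longlonglongrightarrow> 0"
    proof (rule AE_I2)
      fix \<omega>
      obtain n0 :: nat where n0: "\<Theta> i \<omega> < real n0" using reals_Archimedean2 by blast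
      have "\<forall>\<^sub>F n in sequentially. g i \<omega> * indicator {real n<..} (\<Theta> i \<omega>) = 0"
        using eventually_ge_at_top[of n0]
      proof eventually_elim
        case (elim n)
        then have "real n0 \<le> real n" by simp
        with n0 have "\<not> real n < \<Theta> i \<omega>" by linarith
        then show ?case by (simp add: indicator_def)
      qed
      then show "(\<lambda>n. g i \<omega> * indicator {real n<..} (\<Theta> i \<omega>)) \<longlonglongrightarrow> 0"
        by (rule tendsto_eventually)
    qed
    show "AE \<omega> in M. norm (g i \<omega> * indicator {real n<..} (\<Theta> i \<omega>)) \<le> g i \<omega>" for n
      using g_pos by (intro AE_I2) (auto simp: indicator_def less_imp_le)
  qed (auto intro: g_integrable)
  then have "\<forall>\<^sub>F n in sequentially. expectation (\<lambda>\<omega>. g i \<omega> * indicator {real n<..} (\<Theta> i \<omega>)) < e"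
    using e by (intro order_tendstoD) auto
  then have "\<forall>\<^sub>F n in sequentially. 1 \<le> n \<and> expectation (\<lambda>\<omega>. g i \<omega> * indicator {real n<..} (\<Theta> i \<omega>)) < e"
    by (intro eventually_conj eventually_ge_at_top)
  then obtain n where "1 \<le> n" "expectation (\<lambda>\<omega>. g i \<omega> * indicator {real n<..} (\<Theta> i \<omega>)) < e"
    using eventually_happens'[OF sequentially_bot] by fast
  then show ?thesis using that[of "real n"] by simp
qed

text \<open>While both discounts stay below their cut-offs, large products force both claims above
  \<open>s * x\<close>, where quasi-asymptotic independence applies. This part and the two parts
  with a large discount each cost at most \<open>e / 4 * T x\<close>, which fixes \<open>d\<close>
  and \<open>d'\<close>.\<close>

lemma joint_Y_tendsto:
  assumes ij: "i \<noteq> j" and c: "0 < c"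
  shows "((\<lambda>x. prob {\<omega>\<in>space M. c * x < Y i \<omega> \<and> c * x < Y j \<omega>} / T x) \<longlongrightarrow> 0) at_top"
proof (rule tendstoI)
  fix e :: real assume e: "0 < e"
  \<comment> \<open>The probability bounds hold for scales at most 1 only, so a larger
    \<open>c\<close> is lowered to 1.\<close>
  define u where "u = min c 1"
  have u: "0 < u" "u \<le> 1" "u \<le> c" using c by (auto simp: u_def)
  define d where "d = e / (4 * (C * u powr - q))"
  have d: "0 < d" "C * u powr - q * d = e / 4"
    using e constants u by (auto simp: d_def)
  have "\<exists>L\<ge>1. expectation (\<lambda>\<omega>. g k \<omega> * indicator {L<..} (\<Theta> k \<omega>)) < d" for k
    using large_discount_negligible[OF d(1)] by metis
  then obtain L where L: "\<And>k. 1 \<le> L k" "\<And>k. expectation (\<lambda>\<omega>. g k \<omega> * indicator {L k<..} (\<Theta> k \<omega>)) < d"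
    by metis
  define s where "s = u / max (L i) (L j)"
  have s: "0 < s" "s \<le> 1" using u L(1)[of i] by (auto simp: s_def field_simps le_max_iff_disj)
  define d' where "d' = e / (4 * (C * s powr - q))"
  have d': "0 < d'" "C * s powr - q * d' = e / 4" using e constants s by (auto simp: d'_def)
  have big: "prob {\<omega>\<in>space M. u * x < Y k \<omega> \<and> \<Theta> k \<omega> \<in> {L k<..}} \<le> e / 4 * T x" if "x0 \<le> x" for k x
  proof -
    have "prob {\<omega>\<in>space M. u * x < Y k \<omega> \<and> \<Theta> k \<omega> \<in> {L k<..}} \<le> C * T x * u powr - q * d"
      using L(2)[of k] constants T_pos[of x]
      by (intro order_trans[OF prob_Y_restricted_le[OF that u(1,2)]] mult_left_mono) auto
    also have "\<dots> = (C * u powr - q * d) * T x" by simp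
    finally show ?thesis by (simp only: d)
  qed
  have "filterlim (\<lambda>x. s * x) at_top at_top"
    using s by (intro filterlim_tendsto_pos_mult_at_top[OF tendsto_const] filterlim_ident)
  from filterlim_compose[OF joint_Z_tendsto[OF ij] this]
  have "\<forall>\<^sub>F x in at_top. prob {\<omega>\<in>space M. s * x < Z i \<omega> \<and> s * x < Z j \<omega>} / T (s * x) < d'"
    using d' by (intro order_tendstoD) auto
  then show "\<forall>\<^sub>F x in at_top. dist (prob {\<omega>\<in>space M. c * x < Y i \<omega> \<and> c * x < Y j \<omega>} / T x) 0 < e"
    using eventually_ge_at_top[of x0]
  proof eventually_elim
    case (elim x)
    have x: "0 < x" using elim constants by linarith
    let ?Bi = "{\<omega>\<in>space M. u * x < Y i \<omega> \<and> \<Theta> i \<omega> \<in> {L i<..}}"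
    let ?Bj = "{\<omega>\<in>space M. u * x < Y j \<omega> \<and> \<Theta> j \<omega> \<in> {L j<..}}"
    let ?E = "{\<omega>\<in>space M. s * x < Z i \<omega> \<and> s * x < Z j \<omega>}"
    have Z_gt: "s * x < Z k \<omega>" if "c * x < Y k \<omega>" "\<Theta> k \<omega> \<le> L k" "k = i \<or> k = j" for k \<omega>
    proof -
      have "u * x \<le> c * x" using u x by simp
      also have "\<dots> < Z k \<omega> * \<Theta> k \<omega>" using that by (simp add: Y_def)
      also have "\<dots> \<le> Z k \<omega> * max (L i) (L j)"
        using that Z_nonneg by (intro mult_left_mono) auto
      finally show ?thesis using L(1)[of i] by (simp add: s_def field_simps less_max_iff_disj)
    qed
    have "{\<omega>\<in>space M. c * x < Y i \<omega> \<and> c * x < Y j \<omega>} \<subseteq> ?Bi \<union> ?Bj \<union> ?E"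
    proof
      fix \<omega> assume \<omega>: "\<omega> \<in> {\<omega>\<in>space M. c * x < Y i \<omega> \<and> c * x < Y j \<omega>}"
      have "u * x \<le> c * x" using u x by simp
      then show "\<omega> \<in> ?Bi \<union> ?Bj \<union> ?E" using \<omega> Z_gt[of i \<omega>] Z_gt[of j \<omega>] by (auto simp: not_less)
    qed
    then have "prob {\<omega>\<in>space M. c * x < Y i \<omega> \<and> c * x < Y j \<omega>} \<le> prob (?Bi \<union> ?Bj \<union> ?E)"
      by (rule finite_measure_mono) measurable
    also have "\<dots> \<le> prob ?Bi + prob ?Bj + prob ?E"
      by (intro order_trans[OF measure_Un_le] add_right_mono measure_Un_le) measurable
    also have "prob ?Bi \<le> e / 4 * T x" by (rule big[OF elim(2)])
    also have "prob ?Bj \<le> e / 4 * T x" by (rule big[OF elim(2)])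
    also have "prob ?E \<le> e / 4 * T x"
    proof -
      have "prob ?E \<le> d' * T (s * x)"
        using elim(1) T_pos[of "s * x"] by (simp add: pos_divide_less_eq less_imp_le)
      also have "\<dots> \<le> d' * (C * T x * s powr - q)"
        using d' by (intro mult_left_mono T_scale[OF elim(2) s]) auto
      also have "\<dots> = (C * s powr - q * d') * T x" by simp
      finally show ?thesis by (simp only: d')
    qed
    finally have "prob {\<omega>\<in>space M. c * x < Y i \<omega> \<and> c * x < Y j \<omega>} \<le> 3 / 4 * e * T x" by simp
    also have "\<dots> < e * T x" using e T_pos[of x] by (intro mult_strict_right_mono) auto
    finally show ?case using T_pos[of x] by (simp add: dist_real_def pos_divide_less_eq)
  qed
qed

text \<open>For discounts at most \<open>L\<close> the argument
  \<open>x / \<Theta> i \<omega>\<close> is at least \<open>x / L\<close>, so the inequality for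
  \<open>T\<close> holds under the integral once \<open>x \<ge> L * x1\<close>; larger discounts go
  into \<open>\<kappa> * T x\<close>. Only \<open>L\<close> depends on \<open>i\<close>;
  \<open>b\<close> comes from \<open>T\<close> alone.\<close>

lemma Y_consistent:
  assumes \<eta>: "0 < \<eta>"
  obtains b where "0 < b" "b < 1" "\<And>i \<kappa>. 0 < \<kappa> \<Longrightarrow> \<forall>\<^sub>F x in at_top.
    prob {\<omega>\<in>space M. b * x < Y i \<omega>} \<le> (1 + \<eta>) * prob {\<omega>\<in>space M. x < Y i \<omega>} + \<kappa> * T x"
proof -
  obtain b x1 where b: "0 < b" "b < 1" "0 < x1" "\<And>x. x1 \<le> x \<Longrightarrow> T (b * x) \<le> (1 + \<eta>) * T x"
    using consistently_varyingD[OF consistently_varying \<eta>] by metis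
  have "\<forall>\<^sub>F x in at_top.
    prob {\<omega>\<in>space M. b * x < Y i \<omega>} \<le> (1 + \<eta>) * prob {\<omega>\<in>space M. x < Y i \<omega>} + \<kappa> * T x"
    if \<kappa>: "0 < \<kappa>" for i \<kappa>
  proof -
    define d where "d = \<kappa> / (C * b powr - q)"
    have d: "0 < d" "C * b powr - q * d = \<kappa>" using \<kappa> constants b by (auto simp: d_def)
    obtain L where L: "1 \<le> L" "expectation (\<lambda>\<omega>. g i \<omega> * indicator {L<..} (\<Theta> i \<omega>)) < d"
      using large_discount_negligible[OF d(1)] .
    show ?thesis
      using eventually_ge_at_top[of x0] eventually_ge_at_top[of "L * x1"]
    proof eventually_elim
      case (elim x)
      have x: "0 < x" using elim(1) constants by linarith
      let ?B = "{\<omega>\<in>space M. b * x < Y i \<omega> \<and> \<Theta> i \<omega> \<in> {L<..}}"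
      let ?S = "{\<omega>\<in>space M. b * x < Y i \<omega> \<and> \<Theta> i \<omega> \<in> {..L}}"
      have "{\<omega>\<in>space M. b * x < Y i \<omega>} = ?B \<union> ?S" by auto
      then have "prob {\<omega>\<in>space M. b * x < Y i \<omega>} \<le> prob ?B + prob ?S"
        by (simp add: measure_Un_le)
      also have "prob ?B \<le> \<kappa> * T x"
      proof -
        have "prob ?B \<le> C * T x * b powr - q * d"
          using L(2) constants T_pos[of x] b
          by (intro order_trans[OF prob_Y_restricted_le[OF elim(1)]] mult_left_mono) auto
        also have "\<dots> = (C * b powr - q * d) * T x" by simp
        finally show ?thesis by (simp only: d)
      qed
      also have "prob ?S \<le> (1 + \<eta>) * prob {\<omega>\<in>space M. x < Y i \<omega>}"
      proof -
        have "ennreal (prob ?S) = (\<integral>\<^sup>+\<omega>. ennreal (T (b * x / \<Theta> i \<omega>)) * indicator {..L} (\<Theta> i \<omega>) \<partial>M)"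
          using emeasure_Y[of "{..L}"] by (simp add: emeasure_eq_measure)
        also have "\<dots> \<le> (\<integral>\<^sup>+\<omega>. ennreal (1 + \<eta>) * (ennreal (T (x / \<Theta> i \<omega>)) * indicator UNIV (\<Theta> i \<omega>)) \<partial>M)"
        proof (rule nn_integral_mono)
          fix \<omega>
          have "ennreal (T (b * x / \<Theta> i \<omega>)) \<le> ennreal (1 + \<eta>) * ennreal (T (x / \<Theta> i \<omega>))"
            if "\<Theta> i \<omega> \<le> L"
          proof -
            have "x1 * \<Theta> i \<omega> \<le> x1 * L" using that b by simp
            then have "x1 * \<Theta> i \<omega> \<le> x" using elim(2) by (simp add: mult.commute)
            then have "x1 \<le> x / \<Theta> i \<omega>" using \<Theta>_pos[of i \<omega>] by (simp add: pos_le_divide_eq)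
            from b(4)[OF this] have "T (b * x / \<Theta> i \<omega>) \<le> (1 + \<eta>) * T (x / \<Theta> i \<omega>)" by simp
            then show ?thesis
              using \<eta> T_pos by (subst ennreal_mult[symmetric]) (auto intro: ennreal_leI less_imp_le)
          qed
          then show "ennreal (T (b * x / \<Theta> i \<omega>)) * indicator {..L} (\<Theta> i \<omega>) \<le>
              ennreal (1 + \<eta>) * (ennreal (T (x / \<Theta> i \<omega>)) * indicator UNIV (\<Theta> i \<omega>))"
            by (simp add: indicator_def del: ennreal_plus)
        qed
        also have "\<dots> = ennreal (1 + \<eta>) * (\<integral>\<^sup>+\<omega>. ennreal (T (x / \<Theta> i \<omega>)) * indicator UNIV (\<Theta> i \<omega>) \<partial>M)"
          by (rule nn_integral_cmult) measurable
        also have "\<dots> = ennreal ((1 + \<eta>) * prob {\<omega>\<in>space M. x < Y i \<omega>})"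
          using emeasure_Y[of UNIV x i] \<eta> by (simp add: emeasure_eq_measure ennreal_mult)
        finally show ?thesis using \<eta> by (subst (asm) ennreal_le_iff) auto
      qed
      finally show ?case by simp
    qed
  qed
  with b show ?thesis using that by blast
qed

text \<open>A positive discount exceeds some \<open>s > 0\<close> with positive probability
  \<open>P\<close>. This yields at least \<open>P * T (x / s)\<close>, which \<open>T_scale\<close>
  compares with \<open>T x\<close>.\<close>

lemma first_term:
  obtains c where "0 < c" "\<forall>\<^sub>F x in at_top. c * T x \<le> prob {\<omega>\<in>space M. x < Y 0 \<omega>}"
proof -
  have "\<exists>n. prob {\<omega>\<in>space M. 1 / real (Suc n) < \<Theta> 0 \<omega>} \<noteq> 0"
  proof (rule ccontr)
    assume "\<nexists>n. prob {\<omega>\<in>space M. 1 / real (Suc n) < \<Theta> 0 \<omega>} \<noteq> 0"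
    then have "AE \<omega> in M. \<not> 1 / real (Suc n) < \<Theta> 0 \<omega>" for n
      by (subst AE_iff_measurable[OF _ refl]) (auto simp: emeasure_eq_measure)
    then have "AE \<omega> in M. \<forall>n. \<not> 1 / real (Suc n) < \<Theta> 0 \<omega>" by (simp add: AE_all_countable)
    then have "AE \<omega> in M. False"
    proof eventually_elim
      case (elim \<omega>)
      obtain n where "inverse (real (Suc n)) < \<Theta> 0 \<omega>" using reals_Archimedean[OF \<Theta>_pos] by blast
      with elim show ?case by (auto simp: inverse_eq_divide)
    qed
    then show False by (simp add: AE_False)
  qed
  then obtain n where n: "prob {\<omega>\<in>space M. 1 / real (Suc n) < \<Theta> 0 \<omega>} \<noteq> 0" by blast
  define s where "s = 1 / real (Suc n)"
  define P where "P = prob {\<omega>\<in>space M. s < \<Theta> 0 \<omega>}"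
  have P: "0 < P" using n by (simp add: P_def s_def zero_less_measure_iff)
  have s: "0 < s" "s \<le> 1" by (auto simp: s_def)
  define c where "c = P / (C * s powr - q)"
  have c: "0 < c" using P constants s by (simp add: c_def)
  have "\<forall>\<^sub>F x in at_top. c * T x \<le> prob {\<omega>\<in>space M. x < Y 0 \<omega>}"
    using eventually_ge_at_top[of x0]
  proof eventually_elim
    case (elim x)
    have x: "0 < x" using elim constants by linarith
    have "x0 * s \<le> x0 * 1" using s constants by (intro mult_left_mono) auto
    then have xs: "x0 \<le> x / s" using elim s by (simp add: pos_le_divide_eq)
    have "T x \<le> C * T (x / s) * s powr - q" using T_scale[OF xs s] s by simp
    then have le: "c * T x \<le> P * T (x / s)"
      using P s constants by (simp add: c_def field_simps)
    have "ennreal (P * T (x / s)) = (\<integral>\<^sup>+\<omega>. ennreal (T (x / s)) * indicator {\<omega>\<in>space M. s < \<Theta> 0 \<omega>} \<omega> \<partial>M)"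
      using T_pos[of "x / s"] P
      by (subst nn_integral_cmult_indicator) (auto simp: emeasure_eq_measure P_def ennreal_mult mult.commute)
    also have "\<dots> \<le> (\<integral>\<^sup>+\<omega>. ennreal (T (x / \<Theta> 0 \<omega>)) * indicator UNIV (\<Theta> 0 \<omega>) \<partial>M)"
      using x s
      by (intro nn_integral_mono)
        (auto simp: indicator_def intro!: ennreal_leI antimonoD[OF T_antimono] divide_left_mono)
    also have "\<dots> = ennreal (prob {\<omega>\<in>space M. x < Y 0 \<omega>})"
      using emeasure_Y[of UNIV x 0] by (simp add: emeasure_eq_measure)
    finally have "P * T (x / s) \<le> prob {\<omega>\<in>space M. x < Y 0 \<omega>}"
      by (subst (asm) ennreal_le_iff) auto
    with le show ?case by linarith
  qed
  with c show ?thesis by (rule that)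
qed

lemma ruin_prob_ratio:
  "((\<lambda>x. emeasure M {\<omega>\<in>space M. discounted_claims X \<theta> \<xi> \<omega> \<in> upward_extension (dilate x A)} /
      (\<integral>\<^sup>+ s\<in>{0..}. emeasure M {\<omega>\<in>space M. exp (- \<xi> s \<omega>) *\<^sub>R X 1 \<omega> \<in> dilate x A}
         \<partial>renewal_measure M \<theta>)) \<longlongrightarrow> 1) at_top"
proof -
  obtain c where c: "0 < c" "\<forall>\<^sub>F x in at_top. c * T x \<le> prob {\<omega>\<in>space M. x < Y 0 \<omega>}"
    using first_term .
  interpret H: heavy_tailed_sequence M Y T m q r C x0 c
  proof
    show "\<exists>b. 0 < b \<and> b < 1 \<and> (\<forall>i. \<forall>\<kappa>>0. \<forall>\<^sub>F x in at_top.
          prob {\<omega>\<in>space M. b * x < Y i \<omega>} \<le> (1 + \<eta>) * prob {\<omega>\<in>space M. x < Y i \<omega>} + \<kappa> * T x)"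
      if "0 < \<eta>" for \<eta>
    proof (rule Y_consistent[OF that])
      fix b :: real
      assume "0 < b" "b < 1" "\<And>i \<kappa>. 0 < \<kappa> \<Longrightarrow> \<forall>\<^sub>F x in at_top.
        prob {\<omega>\<in>space M. b * x < Y i \<omega>} \<le> (1 + \<eta>) * prob {\<omega>\<in>space M. x < Y i \<omega>} + \<kappa> * T x"
      then show ?thesis by (intro exI[of _ b] conjI allI impI)
    qed
    show "summable (\<lambda>i. m i powr (1 / r))"
      using summable_moments by (simp add: m_def g_def[abs_def])
    show "0 \<le> Y i \<omega>" for i \<omega> using Z_nonneg[of i \<omega>] \<Theta>_pos[of i \<omega>] by (simp add: Y_def)
  qed (use exponents constants c T_pos m_pos prob_Y_le T_scale joint_Y_tendsto in \<open>assumption | simp\<close>)+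
  have "((\<lambda>x. ruin_prob x / H.S x) \<longlongrightarrow> 1) at_top"
    by (rule H.ruin_asymptotics[OF ruin_prob_lower ruin_prob_upper])
  then have "((\<lambda>x. ennreal (ruin_prob x / H.S x)) \<longlongrightarrow> ennreal 1) at_top"
    by (rule tendsto_ennrealI)
  \<comment> \<open>The quotient in \<open>ennreal\<close> agrees with the real one as soon as the
    series is positive and finite.\<close>
  moreover have "\<forall>\<^sub>F x in at_top. ennreal (ruin_prob x / H.S x) =
      emeasure M {\<omega>\<in>space M. discounted_claims X \<theta> \<xi> \<omega> \<in> upward_extension (dilate x A)} /
      (\<integral>\<^sup>+ s\<in>{0..}. emeasure M {\<omega>\<in>space M. exp (- \<xi> s \<omega>) *\<^sub>R X 1 \<omega> \<in> dilate x A}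
         \<partial>renewal_measure M \<theta>)"
    using H.eventually_le_S eventually_ge_at_top[of x0]
  proof eventually_elim
    case (elim x)
    have x: "0 < x" using elim constants by linarith
    have S: "0 < H.S x" using elim(1) T_pos[of x] c(1) by (meson less_le_trans mult_pos_pos)
    have "(\<Sum>i. ennreal (prob {\<omega>\<in>space M. x < Y i \<omega>})) = ennreal (H.S x)"
      using H.summable_a[OF elim(2)]
      by (simp add: H.S_def H.a_def suminf_ennreal2)
    then have int: "(\<integral>\<^sup>+ s\<in>{0..}. emeasure M {\<omega>\<in>space M. exp (- \<xi> s \<omega>) *\<^sub>R X 1 \<omega> \<in> dilate x A}
         \<partial>renewal_measure M \<theta>) = ennreal (H.S x)"
      using integral_renewal_measure_eq[OF x] by (simp only:)
    show ?case
      using S unfolding int by (simp add: ruin_prob_def emeasure_eq_measure divide_ennreal)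
  qed
  ultimately show ?thesis by (simp add: tendsto_cong)
qed

end

lemma ennreal_powr_less_top: "ennreal_powr y a < \<infinity> \<Longrightarrow> y < \<infinity>"
  by (cases "y = top") (simp_all add: ennreal_powr_def less_top[symmetric])

lemma ennreal_powr_finite: "y < \<infinity> \<Longrightarrow> ennreal_powr y a = ennreal (enn2real y powr a)"
  by (cases "y = top") (simp_all add: ennreal_powr_def)

theorem theorem3p3:
  fixes M :: "'a measure"
    and F :: "(real ^ 'd) measure"
    and X :: "nat \<Rightarrow> 'a \<Rightarrow> real ^ 'd"
    and \<theta> :: "nat \<Rightarrow> 'a \<Rightarrow> real"
    and \<xi> :: "real \<Rightarrow> 'a \<Rightarrow> real"
    and A :: "(real ^ 'd) set"
    and p1 p2 \<rho> :: real
  assumes "risk_model M F X \<theta> \<xi>"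
    and "A \<in> ruin_sets"
    and "independent_sources M X \<theta> \<xi>"
    and "QAI_on A M {1..} X"
    and "consistently_varying (reduced_distribution A F)"
    and "positively_decreasing (reduced_distribution A F)"
    and "0 < p1"
    and "ereal p1 < lower_Matuszewska (reduced_distribution A F)"
    and "lower_Matuszewska (reduced_distribution A F) \<le> upper_Matuszewska (reduced_distribution A F)"
    and "upper_Matuszewska (reduced_distribution A F) < ereal p2"
    and "\<rho> = (if upper_Matuszewska (reduced_distribution A F) < 1 then 1 else p2)"
    and "(\<Sum>i. ennreal_powr
           (max (discount_moment M \<theta> \<xi> p1 (Suc i)) (discount_moment M \<theta> \<xi> p2 (Suc i)))
           (1 / \<rho>)) < \<infinity>"
  shows "((\<lambda>x. emeasure M {\<omega>\<in>space M. discounted_claims X \<theta> \<xi> \<omega> \<in> upward_extension (dilate x A)} /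
            (\<integral>\<^sup>+ s\<in>{0..}. emeasure M {\<omega>\<in>space M. exp (- \<xi> s \<omega>) *\<^sub>R X 1 \<omega> \<in> dilate x A}
               \<partial>renewal_measure M \<theta>))
          \<longlongrightarrow> 1) at_top"
proof -
  interpret risk_model M F X \<theta> \<xi> by fact
  interpret reduced_model M F X \<theta> \<xi> A by unfold_locales fact+
  let ?J = "upper_Matuszewska (reduced_distribution A F)"
  have p1J: "ereal p1 < ?J" using assms(8,9) by (rule less_le_trans)
  then obtain J where J: "?J = ereal J" "p1 < J" "J < p2"
    using assms(10) by (cases ?J) auto
  \<comment> \<open>\<open>q\<close> must exceed the upper index for the Potter bound, stay below
    \<open>\<rho>\<close> for the truncated moment and not exceed \<open>p2\<close> for the discount
    moments. There is room because \<open>J\<close> is below both \<open>p2\<close> and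
    \<open>\<rho>\<close>.\<close>
  obtain q where q: "J < q" "q \<le> p2" "q < \<rho>" "1 \<le> \<rho>"
  proof (cases "J < 1")
    case True
    then show ?thesis
      using that[of "(J + min 1 p2) / 2"] J assms(11) by (auto simp: min_def field_simps)
  next
    case False
    then show ?thesis using that[of "(J + p2) / 2"] J assms(11) by (auto simp: field_simps)
  qed
  have pq: "p1 < q" using J(2) q(1) by (rule less_trans)
  have Jq: "?J < ereal q" using J(1) q(1) by simp
  obtain C x0 where C: "0 < C" "0 < x0"
    "\<And>x t. x0 \<le> x \<Longrightarrow> 0 < t \<Longrightarrow> T (x / t) \<le> C * T x * max (t powr p1) (t powr q)"
    by (rule tail_Potter_bound[OF unbounded assms(7,8) pq Jq], rule that)
  let ?b = "\<lambda>i. max (discount_moment M \<theta> \<xi> p1 (Suc i)) (discount_moment M \<theta> \<xi> p2 (Suc i))"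
  have moment: "discount_moment M \<theta> \<xi> p (Suc i) = (\<integral>\<^sup>+\<omega>. ennreal (\<Theta> i \<omega> powr p) \<partial>M)" for p i
    unfolding discount_moment_def \<Theta>_def by (intro nn_integral_cong) (simp add: powr_def)
  \<comment> \<open>A finite series has finite terms, so every moment is finite and
    \<open>enn2real\<close> loses nothing.\<close>
  have fin: "?b i < \<infinity>" for i
  proof -
    have "ennreal_powr (?b i) (1 / \<rho>) \<le> (\<Sum>i. ennreal_powr (?b i) (1 / \<rho>))"
      using sum_le_suminf[of "\<lambda>i. ennreal_powr (?b i) (1 / \<rho>)" "{i}"] by simp
    then have "ennreal_powr (?b i) (1 / \<rho>) < \<infinity>" using assms(12) by (rule le_less_trans)
    then show ?thesis by (rule ennreal_powr_less_top)
  qed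
  have integrable_power: "integrable M (\<lambda>\<omega>. \<Theta> i \<omega> powr p)" 
    and power_le: "expectation (\<lambda>\<omega>. \<Theta> i \<omega> powr p) \<le> enn2real (?b i)" if "p = p1 \<or> p = p2" for i p
  proof -
    have le: "(\<integral>\<^sup>+\<omega>. ennreal (\<Theta> i \<omega> powr p) \<partial>M) \<le> ?b i"
      using that by (auto simp: moment)
    then have "(\<integral>\<^sup>+\<omega>. ennreal (\<Theta> i \<omega> powr p) \<partial>M) < \<infinity>" using fin by (rule le_less_trans)
    then show "integrable M (\<lambda>\<omega>. \<Theta> i \<omega> powr p)"
      by (intro integrableI_nonneg) auto
    show "expectation (\<lambda>\<omega>. \<Theta> i \<omega> powr p) \<le> enn2real (?b i)"
      using le fin[of i] by (subst integral_eq_nn_integral) (auto intro!: enn2real_mono)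
  qed
  have "summable (\<lambda>i. enn2real (?b i) powr (1 / \<rho>))"
  proof (rule summable_suminf_not_top)
    have "ennreal_powr (?b i) (1 / \<rho>) = ennreal (enn2real (?b i) powr (1 / \<rho>))" for i
      by (rule ennreal_powr_finite[OF fin])
    then show "(\<Sum>i. ennreal (enn2real (?b i) powr (1 / \<rho>))) \<noteq> top"
      using assms(12) by (simp add: less_top)
  qed simp
  \<comment> \<open>The factor \<open>2 powr (1 / \<rho>)\<close> comes from bounding the sum of two
    moments by twice their maximum.\<close>
  then have sum2: "summable (\<lambda>i. 2 powr (1 / \<rho>) * enn2real (?b i) powr (1 / \<rho>))"
    by (rule summable_mult)
  interpret discounted_model M F X \<theta> \<xi> A p1 p2 q \<rho> C x0
  proof
    show int: "integrable M (\<lambda>\<omega>. \<Theta> i \<omega> powr p1 + \<Theta> i \<omega> powr p2)" for i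
      using integrable_power by simp
    show "summable (\<lambda>i. expectation (\<lambda>\<omega>. \<Theta> i \<omega> powr p1 + \<Theta> i \<omega> powr p2) powr (1 / \<rho>))"
    proof (rule summable_comparison_test'[OF sum2, of 0])
      fix i
      have "expectation (\<lambda>\<omega>. \<Theta> i \<omega> powr p1 + \<Theta> i \<omega> powr p2) \<le> 2 * enn2real (?b i)"
        using power_le[of p1 i] power_le[of p2 i] integrable_power by simp
      moreover have "0 \<le> expectation (\<lambda>\<omega>. \<Theta> i \<omega> powr p1 + \<Theta> i \<omega> powr p2)"
        by (intro Bochner_Integration.integral_nonneg) auto
      ultimately have "expectation (\<lambda>\<omega>. \<Theta> i \<omega> powr p1 + \<Theta> i \<omega> powr p2) powr (1 / \<rho>) \<le>
          (2 * enn2real (?b i)) powr (1 / \<rho>)"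
        using q by (intro powr_mono2) auto
      then show "norm (expectation (\<lambda>\<omega>. \<Theta> i \<omega> powr p1 + \<Theta> i \<omega> powr p2) powr (1 / \<rho>)) \<le>
          2 powr (1 / \<rho>) * enn2real (?b i) powr (1 / \<rho>)"
        by (simp add: powr_mult)
    qed
  qed (use assms(7) J q C in auto)
  show ?thesis by (rule ruin_prob_ratio)
qed

end
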